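(* Let $p$ be a prime, $u \geq 0$ an integer, $\varepsilon > 0$ a real number, and $B$ a finite abelian $p$-group. Let $\alpha, \beta > 0$ be real numbers satisfying $\alpha + \beta < 1$. For each positive integer $n$, let $M(n)$ be a random matrix valued in $\mathrm{M}_{n \times (n+u)}(\mathbb{Z}_p)$ with independent entries $M(n)_{ij}$, with at most $\alpha n$ $\varepsilon$-degenerate entries in each column and at most $\beta n$ $\varepsilon$-degenerate entries in each row. Then \[\lim_{n \to \infty} \mathbb{P}(\mathrm{cok}(M(n)) \simeq B) = \frac{\prod_{k=1}^\infty (1-p^{-k-u})}{|B|^u\,|\mathrm{Aut}(B)|}.\]
   Context: $\mathbb{Z}_p$ denotes the $p$-adic integers. For $R \in \mathrm{M}_{n\times(n+u)}(\mathbb{Z}_p)$, $\mathrm{cok}(R) := \mathbb{Z}_p^n / R\,\mathbb{Z}_p^{n+u}$. A random variable $X$ valued in $\mathbb{Z}_p$ is $\varepsilon$-balanced if $\mathbb{P}(X \equiv t \pmod p) \leq 1-\varepsilon$ for all $t \in \mathbb{Z}/p\mathbb{Z}$; otherwise $X$ is $\varepsilon$-degenerate. The entries are not assumed identically distributed. *)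

theory Defs
  imports
    "HOL-Probability.Probability"
    "HOL-Algebra.Product_Groups"
    "HOL-Algebra.Bij"
    "HOL-Algebra.Ring"
    "HOL-Number_Theory.Cong"
begin

text \<open>
  The ring of \<open>p\<close>-adic integers as the inverse limit of the rings of integers modulo \<open>p ^ k\<close>:
  an element is a compatible sequence \<open>x\<close>, where \<open>x k\<close> is the representative in
  \<open>{0..<p ^ k}\<close> of its residue class modulo \<open>p ^ k\<close>.
\<close>

definition padic_int_set :: "nat \<Rightarrow> (nat \<Rightarrow> int) set" where
  "padic_int_set p =
     {x. \<forall>k. x k \<in> {0..<int p ^ k} \<and> [x (Suc k) = x k] (mod int p ^ k)}"

definition padic_int :: "nat \<Rightarrow> (nat \<Rightarrow> int) ring" where
  "padic_int p =
     \<lparr>carrier = padic_int_set p,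
      mult = (\<lambda>x y k. (x k * y k) mod int p ^ k),
      one = (\<lambda>k. 1 mod int p ^ k),
      zero = (\<lambda>k. 0),
      add = (\<lambda>x y k. (x k + y k) mod int p ^ k)\<rparr>"

text \<open>
  The \<open>p\<close>-adic topology is the inverse limit topology, that is, the subspace topology in the
  product of discrete spaces. Random variables are measurable for its Borel sigma-algebra.
\<close>

definition padic_topology :: "nat \<Rightarrow> (nat \<Rightarrow> int) topology" where
  "padic_topology p =
     subtopology (product_topology (\<lambda>k. discrete_topology UNIV) UNIV) (carrier (padic_int p))"

definition padic_borel :: "nat \<Rightarrow> (nat \<Rightarrow> int) measure" where
  "padic_borel p = sigma (carrier (padic_int p)) {U. openin (padic_topology p) U}"

definition padic_vec :: "nat \<Rightarrow> nat \<Rightarrow> (nat \<Rightarrow> nat \<Rightarrow> int) monoid" where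
  "padic_vec p n = product_group {..<n} (\<lambda>i. add_monoid (padic_int p))"

text \<open>
  An \<open>n \<times> m\<close> matrix is a function \<open>R\<close> with entries \<open>R i j\<close> for \<open>i < n\<close>, \<open>j < m\<close>; its values outside
  this range are irrelevant.
\<close>

definition padic_mat_vec ::
  "nat \<Rightarrow> nat \<Rightarrow> nat \<Rightarrow> (nat \<Rightarrow> nat \<Rightarrow> (nat \<Rightarrow> int)) \<Rightarrow> (nat \<Rightarrow> nat \<Rightarrow> int) \<Rightarrow> (nat \<Rightarrow> nat \<Rightarrow> int)"
  where "padic_mat_vec p n m R v =
     (\<lambda>i\<in>{..<n}. \<Oplus>\<^bsub>padic_int p\<^esub>j\<in>{..<m}. R i j \<otimes>\<^bsub>padic_int p\<^esub> v j)"

definition padic_cok ::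
  "nat \<Rightarrow> nat \<Rightarrow> nat \<Rightarrow> (nat \<Rightarrow> nat \<Rightarrow> (nat \<Rightarrow> int)) \<Rightarrow> (nat \<Rightarrow> nat \<Rightarrow> int) set monoid"
  where "padic_cok p n m R =
     padic_vec p n Mod (padic_mat_vec p n m R ` carrier (padic_vec p m))"

text \<open>
  For a \<open>p\<close>-adic integer \<open>x\<close>, the residue class modulo \<open>p\<close> is that of the integer \<open>x 1\<close>.
\<close>

definition balanced :: "'a measure \<Rightarrow> nat \<Rightarrow> real \<Rightarrow> ('a \<Rightarrow> (nat \<Rightarrow> int)) \<Rightarrow> bool" where
  "balanced \<Omega> p \<epsilon> X \<longleftrightarrow>
     (\<forall>t::int. measure \<Omega> {\<omega> \<in> space \<Omega>. [X \<omega> 1 = t] (mod int p)} \<le> 1 - \<epsilon>)"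

abbreviation degenerate :: "'a measure \<Rightarrow> nat \<Rightarrow> real \<Rightarrow> ('a \<Rightarrow> (nat \<Rightarrow> int)) \<Rightarrow> bool" where
  "degenerate \<Omega> p \<epsilon> X \<equiv> \<not> balanced \<Omega> p \<epsilon> X"

end

theory Submission
  imports Defs "HOL-Algebra.Multiplicative_Group"
begin

text \<open>
  Let \<open>order B = p ^ r\<close> and \<open>q = p ^ (r + 1)\<close>. By Nakayama's lemma the cokernel is isomorphic to
  \<open>B\<close> iff the quotient of \<open>V = (\<int>/q)\<^sup>n\<close> by the span of the columns modulo \<open>q\<close> is. This reduced
  event is compared with its probability for a uniform matrix by making the columns uniform one
  at a time. Fix all columns but one, with span \<open>L\<close>. The indicator of \<open>V/(L + v) \<cong> B\<close> is an
  \<open>L\<close>-invariant function of the remaining column \<open>v\<close>, so only the at most \<open>q |B|\<close> characters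
  trivial on \<open>L\<close> contribute, and the Fourier coefficient of the law of \<open>v\<close> at such a character \<open>y\<close>
  is exponentially small if \<open>y\<close> has linearly many nonzero coordinates among the balanced entries.
  A multiple of \<open>y\<close> reduces to a nonzero vector \<open>w\<close> modulo \<open>p\<close> orthogonal to \<open>L\<close>. A union bound
  over all \<open>w\<close> with few nonzero coordinates at balanced entries shows that such a \<open>w\<close> exists only
  with exponentially small probability: there are about \<open>p\<^bsup>\<alpha>n\<^esup>\<close> of them, and each is orthogonal to
  the other columns with probability about \<open>p\<^bsup>-(1-\<beta>)n\<^esup>\<close> unless its support is tiny. For uniform
  matrices, count pairs of a matrix and a surjection \<open>f : V \<rightarrow> B\<close> whose kernel is spanned by the
  columns: every matrix with cokernel \<open>B\<close> occurs \<open>|Aut B|\<close> times, and the tuples generating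
  \<open>ker f\<close> are counted by adding one generator at a time.
\<close>

section \<open>Fourier analysis on vectors modulo \<open>q\<close>\<close>

text \<open>The exponent \<open>r + 1\<close> instead of \<open>r\<close> serves twice. Modulo
  \<open>p ^ r\<close> the groups Z/p^r and Z/p^(r+1) look alike, so the reduced event would not
  determine the cokernel; with one more level, a reduced quotient killed by \<open>p ^ r\<close>
  puts all \<open>p ^ r\<close>-multiples in the image up to \<open>p ^ (r + 1)\<close>-multiples,
  which is what Nakayama's lemma needs. In the uniform count the extra level makes the kernel of
  every epimorphism onto \<open>B\<close> contain the whole \<open>p\<close>-torsion of V, so all
  these kernels have rank \<open>n\<close> and equally many generating tuples. The obstacle in the
  union bound is that a column whose degenerate entries cover the support of \<open>w\<close> adds
  no randomness to its product with \<open>w\<close>. The row condition limits the number of such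
  columns by double counting, the column condition limits the number of \<open>w\<close>, and
  \<alpha> + \<beta> < 1 lets the gain beat the entropy. Tiny supports are separate because there a
  column gains only some constant factor below 1 and not nearly 1/p. A uniform column has no
  degenerate entry, so the hypotheses survive every replacement and the \<open>n + u\<close> errors
  can be added.\<close>

definition zmod_vec :: "nat \<Rightarrow> nat \<Rightarrow> (nat \<Rightarrow> int) monoid" where
  "zmod_vec q n = product_group {..<n} (\<lambda>_. integer_mod_group q)"

abbreviation vecs :: "nat \<Rightarrow> nat \<Rightarrow> (nat \<Rightarrow> int) set" where
  "vecs q n \<equiv> PiE {..<n} (\<lambda>_. {0..<int q})"

definition dot :: "nat \<Rightarrow> (nat \<Rightarrow> int) \<Rightarrow> (nat \<Rightarrow> int) \<Rightarrow> int" where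
  "dot n y v = (\<Sum>i<n. y i * v i)"

definition add_char :: "nat \<Rightarrow> int \<Rightarrow> complex" where
  "add_char q t = cis (2 * pi * of_int t / of_nat q)"

lemma carrier_zmod_vec: "q > 0 \<Longrightarrow> carrier (zmod_vec q n) = vecs q n"
  by (simp add: zmod_vec_def carrier_integer_mod_group)

lemma mult_zmod_vec: "x \<otimes>\<^bsub>zmod_vec q n\<^esub> y = (\<lambda>i\<in>{..<n}. (x i + y i) mod int q)"
  by (simp add: zmod_vec_def)

lemma comm_group_zmod_vec: "comm_group (zmod_vec q n)"
  unfolding zmod_vec_def
  by (rule group.group_comm_groupI) (auto simp: add.commute)

lemma group_zmod_vec: "group (zmod_vec q n)"
  using comm_group_zmod_vec comm_group.axioms(2) by blast

lemma zmod_vec_pow: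
  assumes "x \<in> carrier (zmod_vec q n)"
  shows "x [^]\<^bsub>zmod_vec q n\<^esub> (m::nat) = (\<lambda>i\<in>{..<n}. (int m * x i) mod int q)"
proof (induction m)
  case 0 then show ?case by (simp add: zmod_vec_def)
next
  case (Suc m)
  interpret comm_group "zmod_vec q n" by (rule comm_group_zmod_vec)
  have "x [^]\<^bsub>zmod_vec q n\<^esub> Suc m = x [^]\<^bsub>zmod_vec q n\<^esub> m \<otimes>\<^bsub>zmod_vec q n\<^esub> x" by simp
  also have "\<dots> = (\<lambda>i\<in>{..<n}. (int (Suc m) * x i) mod int q)"
    unfolding Suc.IH mult_zmod_vec
    by (intro restrict_ext) (simp add: mod_simps algebra_simps)
  finally show ?case .
qed

lemma group_homI: "group G \<Longrightarrow> group H \<Longrightarrow> h \<in> hom G H \<Longrightarrow> group_hom G H h"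
  by (simp add: group_hom_def group_hom_axioms_def)

lemma card_vecs: "card (vecs q n) = q ^ n"
  by (simp add: card_PiE)

lemma finite_vecs: "finite (vecs q n)"
  by (intro finite_PiE) auto

lemma add_char_add: "add_char q (a + b) = add_char q a * add_char q b"
  by (simp add: add_char_def cis_mult distrib_left add_divide_distrib)

lemma add_char_0 [simp]: "add_char q 0 = 1"
  by (simp add: add_char_def)

lemma norm_add_char [simp]: "norm (add_char q t) = 1"
  by (simp add: add_char_def)

lemma add_char_sum: "add_char q (sum f A) = (\<Prod>i\<in>A. add_char q (f i))"
  by (induction A rule: infinite_finite_induct) (auto simp: add_char_add)

lemma add_char_eq_1_iff:
  assumes "q > 0" shows "add_char q t = 1 \<longleftrightarrow> int q dvd t"
proof
  assume "add_char q t = 1"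
  then have "cos (2 * pi * of_int t / of_nat q) = 1"
    by (simp add: add_char_def complex_eq_iff)
  then obtain m :: int where "2 * pi * of_int t / of_nat q = of_int m * 2 * pi"
    using cos_one_2pi_int by auto
  then have "real_of_int t = of_int m * real q"
    using assms by (simp add: field_simps)
  then have "t = m * int q" by (metis of_int_eq_iff of_int_mult of_int_of_nat_eq)
  then show "int q dvd t" by simp
next
  assume "int q dvd t"
  then obtain m where m: "t = int q * m" by auto
  have "2 * pi * of_int t / of_nat q = 2 * pi * of_int m"
    using assms by (simp add: m)
  then have "add_char q t = cis (2 * pi * of_int m)" unfolding add_char_def by metis
  then show "add_char q t = 1" by simp
qed

lemma add_char_cong:
  assumes "q > 0" "[a = b] (mod int q)" shows "add_char q a = add_char q b"
proof -
  have "add_char q (a - b) = 1" using assms by (subst add_char_eq_1_iff) (auto simp: cong_iff_dvd_diff)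
  then show ?thesis using add_char_add[of q "a - b" b] by simp
qed

lemma add_char_power: "add_char q (int m * t) = add_char q t ^ m"
  by (induction m) (auto simp: add_char_add algebra_simps)

text \<open>A geometric sum: the ratio \<open>add_char q t\<close> is a \<open>q\<close>-th root of
  unity and equals 1 exactly when \<open>q\<close> divides \<open>t\<close>.\<close>

lemma sum_add_char:
  assumes "q > 0"
  shows "(\<Sum>y\<in>{0..<int q}. add_char q (y * t)) = (if int q dvd t then of_nat q else 0)"
proof -
  have "(\<Sum>y\<in>{0..<int q}. add_char q (y * t)) = (\<Sum>m<q. add_char q t ^ m)"
    by (rule sum.reindex_bij_witness[of _ int nat]) (auto simp: add_char_power[symmetric])
  also have "\<dots> = (if int q dvd t then of_nat q else 0)"
  proof (cases "int q dvd t")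
    case True then show ?thesis using assms add_char_eq_1_iff[of q t] by simp
  next
    case False
    then have "add_char q t \<noteq> 1" using assms add_char_eq_1_iff by blast
    moreover have "add_char q t ^ q = 1"
      using assms by (simp add: add_char_power[symmetric] add_char_eq_1_iff)
    ultimately show ?thesis using False by (simp add: geometric_sum)
  qed
  finally show ?thesis .
qed

lemma add_char_dot: "add_char q (dot n y v) = (\<Prod>i<n. add_char q (y i * v i))"
  by (simp add: dot_def add_char_sum)

lemma dot_diff: "dot n y (\<lambda>i. v i - x i) = dot n y v - dot n y x"
  by (simp add: dot_def right_diff_distrib sum_subtractf)

text \<open>Orthogonality of characters: the sum over \<open>y\<close> factors into one geometric
  sum per coordinate, and for entries in \<open>{0..<q}\<close> congruence is equality.\<close>

lemma sum_add_char_dot: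
  assumes "q > 0" "v \<in> vecs q n" "x \<in> vecs q n"
  shows "(\<Sum>y\<in>vecs q n. add_char q (dot n y v - dot n y x)) = (if v = x then of_nat (q ^ n) else 0)"
proof -
  have "(\<Sum>y\<in>vecs q n. add_char q (dot n y v - dot n y x)) =
        (\<Sum>y\<in>vecs q n. \<Prod>i<n. add_char q (y i * (v i - x i)))"
    by (simp add: dot_diff[symmetric] add_char_dot)
  also have "\<dots> = (\<Prod>i<n. \<Sum>a\<in>{0..<int q}. add_char q (a * (v i - x i)))"
    by (rule prod_sum_PiE[symmetric]) auto
  also have "\<dots> = (\<Prod>i<n. if v i = x i then of_nat q else 0)"
  proof (rule prod.cong[OF refl], subst sum_add_char[OF assms(1)])
    fix i assume i: "i \<in> {..<n}"
    have "v i \<in> {0..<int q}" "x i \<in> {0..<int q}" using assms i by (auto simp: PiE_iff)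
    then have "int q dvd v i - x i \<longleftrightarrow> v i = x i"
      by (metis atLeastLessThan_iff mod_eq_dvd_iff mod_pos_pos_trivial)
    then show "(if int q dvd v i - x i then of_nat q else (0::complex)) =
        (if v i = x i then of_nat q else 0)" by simp
  qed
  also have "\<dots> = (if v = x then of_nat (q ^ n) else 0)"
  proof (cases "v = x")
    case False
    then obtain i where "i < n" "v i \<noteq> x i"
      using assms PiE_ext[of v "{..<n}" _ x] by (metis lessThan_iff)
    then have "(\<Prod>i<n. if v i = x i then of_nat q else (0::complex)) = 0"
      by (intro prod_zero) auto
    then show ?thesis using False by simp
  qed simp
  finally show ?thesis .
qed

lemma dot_mult_cong:
  "[dot n y (x \<otimes>\<^bsub>zmod_vec q n\<^esub> l) = dot n y x + dot n y l] (mod int q)"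
proof -
  have "[(\<Sum>i<n. y i * ((x i + l i) mod int q)) = (\<Sum>i<n. y i * (x i + l i))] (mod int q)"
    by (intro cong_sum cong_scalar_left) (simp add: cong_def)
  then show ?thesis
    by (simp add: dot_def mult_zmod_vec sum.distrib distrib_left)
qed

text \<open>The annihilator of \<open>L\<close> when (Z/q)^n is identified with its character group
  through the pairing \<open>dot\<close>.\<close>

definition perp :: "nat \<Rightarrow> nat \<Rightarrow> (nat \<Rightarrow> int) set \<Rightarrow> (nat \<Rightarrow> int) set" where
  "perp q n L = {y \<in> vecs q n. \<forall>l\<in>L. int q dvd dot n y l}"

text \<open>Normalised so that the coefficient at zero is the mean of \<open>g\<close> and the
  inversion formula carries no factor.\<close>

definition fcoeff :: "nat \<Rightarrow> nat \<Rightarrow> ((nat \<Rightarrow> int) \<Rightarrow> real) \<Rightarrow> (nat \<Rightarrow> int) \<Rightarrow> complex" where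
  "fcoeff q n g y = (\<Sum>x\<in>vecs q n. of_real (g x) * add_char q (- dot n y x)) / of_nat (q ^ n)"

lemma fourier_inversion:
  assumes "q > 0" "v \<in> vecs q n"
  shows "of_real (g v) = (\<Sum>y\<in>vecs q n. fcoeff q n g y * add_char q (dot n y v))"
proof -
  have "(\<Sum>y\<in>vecs q n. fcoeff q n g y * add_char q (dot n y v)) * of_nat (q ^ n) =
      (\<Sum>y\<in>vecs q n. \<Sum>x\<in>vecs q n. of_real (g x) * add_char q (dot n y v - dot n y x))"
    unfolding sum_distrib_right
  proof (rule sum.cong[OF refl])
    fix y
    have "fcoeff q n g y * of_nat (q ^ n) = (\<Sum>x\<in>vecs q n. of_real (g x) * add_char q (- dot n y x))"
      using assms(1) by (simp add: fcoeff_def)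
    then have "fcoeff q n g y * add_char q (dot n y v) * of_nat (q ^ n) =
        (\<Sum>x\<in>vecs q n. of_real (g x) * add_char q (- dot n y x)) * add_char q (dot n y v)"
      by (simp only: mult.assoc mult.commute[of "add_char q (dot n y v)"]) (simp only: mult.assoc[symmetric])
    then show "fcoeff q n g y * add_char q (dot n y v) * of_nat (q ^ n) =
        (\<Sum>x\<in>vecs q n. of_real (g x) * add_char q (dot n y v - dot n y x))"
      by (simp add: sum_distrib_right mult.assoc add_char_add[symmetric])
  qed
  also have "\<dots> = (\<Sum>x\<in>vecs q n. of_real (g x) * (\<Sum>y\<in>vecs q n. add_char q (dot n y v - dot n y x)))"
    by (subst sum.swap) (simp add: sum_distrib_left)
  also have "\<dots> = (\<Sum>x\<in>vecs q n. of_real (g x) * (if v = x then of_nat (q ^ n) else 0))"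
    by (intro sum.cong refl) (simp add: sum_add_char_dot assms del: of_nat_power)
  also have "\<dots> = of_real (g v) * of_nat (q ^ n)"
    using assms by (simp add: if_distrib finite_vecs cong: if_cong)
  finally show ?thesis using assms(1) by simp
qed

text \<open>Translation by an \<open>l\<close> in \<open>L\<close> with \<open>dot n y l\<close>
  nonzero modulo \<open>q\<close> multiplies the coefficient by a number other than 1, yet
  invariance of \<open>g\<close> leaves it unchanged.\<close>

lemma fcoeff_invariant:
  assumes "q > 0" "y \<in> vecs q n" "y \<notin> perp q n L" "L \<subseteq> vecs q n"
    and inv: "\<And>v l. v \<in> vecs q n \<Longrightarrow> l \<in> L \<Longrightarrow> g (v \<otimes>\<^bsub>zmod_vec q n\<^esub> l) = g v"
  shows "fcoeff q n g y = 0"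
proof -
  obtain l where l: "l \<in> L" "\<not> int q dvd dot n y l"
    using assms by (auto simp: perp_def)
  interpret comm_group "zmod_vec q n" by (rule comm_group_zmod_vec)
  note car = carrier_zmod_vec[OF assms(1), of n]
  have lV: "l \<in> carrier (zmod_vec q n)" using l assms car by auto
  let ?f = "\<lambda>x. of_real (g x) * add_char q (- dot n y x)"
  have "(\<Sum>x\<in>vecs q n. ?f x) = (\<Sum>x\<in>vecs q n. ?f (x \<otimes>\<^bsub>zmod_vec q n\<^esub> l))"
    unfolding car[symmetric]
    by (rule sum.reindex_bij_witness[of _ "\<lambda>x. x \<otimes>\<^bsub>zmod_vec q n\<^esub> l" "\<lambda>x. x \<otimes>\<^bsub>zmod_vec q n\<^esub> inv\<^bsub>zmod_vec q n\<^esub> l"])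
      (use lV in \<open>auto simp: m_assoc\<close>)
  also have "\<dots> = (\<Sum>x\<in>vecs q n. ?f x * add_char q (- dot n y l))"
  proof (rule sum.cong[OF refl])
    fix x assume x: "x \<in> vecs q n"
    have "add_char q (- dot n y (x \<otimes>\<^bsub>zmod_vec q n\<^esub> l)) = add_char q (- dot n y x + - dot n y l)"
      by (intro add_char_cong assms) (use dot_mult_cong[of n y q x l] in \<open>metis cong_minus_minus_iff minus_add_distrib\<close>)
    then show "?f (x \<otimes>\<^bsub>zmod_vec q n\<^esub> l) = ?f x * add_char q (- dot n y l)"
      using inv[OF x l(1)] by (simp only: add_char_add) simp
  qed
  also have "\<dots> = (\<Sum>x\<in>vecs q n. ?f x) * add_char q (- dot n y l)"
    by (simp add: sum_distrib_right)
  finally have "(\<Sum>x\<in>vecs q n. ?f x) = (\<Sum>x\<in>vecs q n. ?f x) * add_char q (- dot n y l)" .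
  moreover have "add_char q (- dot n y l) \<noteq> 1" using l assms(1) by (subst add_char_eq_1_iff) auto
  ultimately have "(\<Sum>x\<in>vecs q n. ?f x) = 0" by simp
  then show ?thesis by (simp add: fcoeff_def)
qed

lemma finite_perp: "finite (perp q n L)"
  unfolding perp_def using finite_vecs by auto

text \<open>Fourier inversion for the indicator of \<open>L\<close>, evaluated at the zero vector:
  the coefficients are \<open>card L / q ^ n\<close> on the annihilator and 0 elsewhere, and they
  sum to 1.\<close>

lemma card_perp:
  assumes "q > 0" "subgroup L (zmod_vec q n)"
  shows "card (perp q n L) * card L = q ^ n"
proof -
  interpret comm_group "zmod_vec q n" by (rule comm_group_zmod_vec)
  note car = carrier_zmod_vec[OF assms(1), of n]
  have LV: "L \<subseteq> vecs q n" using subgroup.subset[OF assms(2)] car by simp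
  let ?g = "indicator L :: _ \<Rightarrow> real"
  let ?z = "\<one>\<^bsub>zmod_vec q n\<^esub>"
  have z: "?z = (\<lambda>i\<in>{..<n}. 0)" by (simp add: zmod_vec_def)
  have dz: "dot n y ?z = 0" for y by (simp add: dot_def z)
  have inv: "?g (v \<otimes>\<^bsub>zmod_vec q n\<^esub> l) = ?g v" if v: "v \<in> vecs q n" "l \<in> L" for v l
  proof -
    have "v \<otimes>\<^bsub>zmod_vec q n\<^esub> l \<in> L \<longleftrightarrow> v \<in> L"
    proof
      assume a: "v \<otimes>\<^bsub>zmod_vec q n\<^esub> l \<in> L"
      have "v = (v \<otimes>\<^bsub>zmod_vec q n\<^esub> l) \<otimes>\<^bsub>zmod_vec q n\<^esub> inv\<^bsub>zmod_vec q n\<^esub> l"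
        using v LV car by (metis inv_solve_right m_closed subsetD)
      then show "v \<in> L" using a v subgroup.m_closed[OF assms(2)] subgroup.m_inv_closed[OF assms(2)]
        by metis
    qed (use v subgroup.m_closed[OF assms(2)] in auto)
    then show ?thesis by (simp add: indicator_def)
  qed
  have zV: "?z \<in> vecs q n" using one_closed car by simp
  have "1 = complex_of_real (?g ?z)" using subgroup.one_closed[OF assms(2)] by simp
  also have "\<dots> = (\<Sum>y\<in>vecs q n. fcoeff q n ?g y)"
    using fourier_inversion[OF assms(1) zV, of ?g] by (simp add: dz)
  also have "\<dots> = (\<Sum>y\<in>perp q n L. fcoeff q n ?g y)"
    by (rule sum.mono_neutral_right[OF finite_vecs])
      (use fcoeff_invariant[OF assms(1) _ _ LV, of _ ?g] inv in \<open>auto simp: perp_def\<close>)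
  also have "\<dots> = (\<Sum>y\<in>perp q n L. of_nat (card L) / of_nat (q ^ n))"
  proof (rule sum.cong[OF refl])
    fix y assume y: "y \<in> perp q n L"
    have "(\<Sum>x\<in>vecs q n. of_real (?g x) * add_char q (- dot n y x)) = (\<Sum>x\<in>L. 1)"
    proof (rule sum.mono_neutral_cong_right[OF finite_vecs LV])
      show "of_real (?g x) * add_char q (- dot n y x) = 1" if "x \<in> L" for x
        using y that add_char_eq_1_iff[of q "- dot n y x"] assms(1) by (simp add: perp_def)
    qed auto
    then show "fcoeff q n ?g y = of_nat (card L) / of_nat (q ^ n)"
      by (simp add: fcoeff_def)
  qed
  finally have "of_nat (card (perp q n L) * card L) = (of_nat (q ^ n) :: complex)"
    using assms(1) by (simp add: field_simps)
  then show ?thesis using of_nat_eq_iff by blast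
qed

text \<open>In the Fourier expansion of the mean under \<open>\<nu>\<close>, the zero frequency
  reproduces the uniform mean and frequencies outside \<open>perp q n L\<close> vanish. Each
  remaining one costs at most \<open>r\<close>, since a function bounded by 1 has coefficients
  bounded by 1.\<close>

lemma invariant_expectation_bound:
  fixes r :: real
  assumes "q > 0" and L: "subgroup L (zmod_vec q n)"
    and inv: "\<And>v l. v \<in> vecs q n \<Longrightarrow> l \<in> L \<Longrightarrow> g (v \<otimes>\<^bsub>zmod_vec q n\<^esub> l) = g v"
    and g: "\<And>v. v \<in> vecs q n \<Longrightarrow> \<bar>g v\<bar> \<le> 1"
    and "(\<Sum>v\<in>vecs q n. \<nu> v) = 1"
    and r: "\<And>y. y \<in> perp q n L \<Longrightarrow> y \<noteq> (\<lambda>i\<in>{..<n}. 0) \<Longrightarrow>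
              norm (\<Sum>v\<in>vecs q n. of_real (\<nu> v) * add_char q (dot n y v)) \<le> r"
    and "r \<ge> 0"
  shows "\<bar>(\<Sum>v\<in>vecs q n. \<nu> v * g v) - (\<Sum>v\<in>vecs q n. g v) / q ^ n\<bar> \<le> card (perp q n L) * r"
proof -
  let ?V = "vecs q n" and ?z = "(\<lambda>i\<in>{..<n}. 0::int)"
  let ?h = "\<lambda>y. \<Sum>v\<in>?V. of_real (\<nu> v) * add_char q (dot n y v)"
  have LV: "L \<subseteq> ?V" using subgroup.subset[OF L] carrier_zmod_vec[OF assms(1), of n] by simp
  have zV: "?z \<in> ?V" using assms(1) by auto
  have dz: "dot n ?z v = 0" for v by (simp add: dot_def)
  have zP: "?z \<in> perp q n L" using zV by (simp add: perp_def dz)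
  have "complex_of_real (\<Sum>v\<in>?V. \<nu> v * g v) =
     (\<Sum>v\<in>?V. of_real (\<nu> v) * (\<Sum>y\<in>?V. fcoeff q n g y * add_char q (dot n y v)))"
    using fourier_inversion[OF assms(1), of _ n g] by simp
  also have "\<dots> = (\<Sum>y\<in>?V. \<Sum>v\<in>?V. of_real (\<nu> v) * (fcoeff q n g y * add_char q (dot n y v)))"
    by (simp add: sum_distrib_left) (rule sum.swap)
  also have "\<dots> = (\<Sum>y\<in>?V. fcoeff q n g y * ?h y)"
    by (simp add: sum_distrib_left mult_ac)
  also have "\<dots> = (\<Sum>y\<in>perp q n L. fcoeff q n g y * ?h y)"
    by (rule sum.mono_neutral_right[OF finite_vecs])
      (use fcoeff_invariant[OF assms(1) _ _ LV, of _ g] inv in \<open>auto simp: perp_def\<close>)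
  also have "\<dots> = fcoeff q n g ?z * ?h ?z + (\<Sum>y\<in>perp q n L - {?z}. fcoeff q n g y * ?h y)"
    by (rule sum.remove[OF finite_perp zP])
  also have "?h ?z = 1" using assms(5) by (simp add: dz of_real_sum[symmetric] del: of_real_sum)
  also have "fcoeff q n g ?z = of_real ((\<Sum>v\<in>?V. g v) / q ^ n)"
    by (simp add: fcoeff_def dz)
  finally have eq: "complex_of_real ((\<Sum>v\<in>?V. \<nu> v * g v) - (\<Sum>v\<in>?V. g v) / q ^ n) =
      (\<Sum>y\<in>perp q n L - {?z}. fcoeff q n g y * ?h y)"
    by (simp only: of_real_diff mult_1_right add_diff_cancel_left')
  have fc: "norm (fcoeff q n g y) \<le> 1" for y
  proof -
    have "norm (\<Sum>x\<in>?V. of_real (g x) * add_char q (- dot n y x)) \<le> (\<Sum>x\<in>?V. 1)"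
      by (rule sum_norm_le) (use g in \<open>auto simp: norm_mult\<close>)
    then show ?thesis using assms(1) by (simp add: fcoeff_def norm_divide norm_power card_vecs del: sum_constant) (simp add: card_vecs)
  qed
  have "\<bar>(\<Sum>v\<in>?V. \<nu> v * g v) - (\<Sum>v\<in>?V. g v) / q ^ n\<bar> =
     norm (\<Sum>y\<in>perp q n L - {?z}. fcoeff q n g y * ?h y)"
    by (simp only: eq[symmetric] norm_of_real)
  also have "\<dots> \<le> (\<Sum>y\<in>perp q n L - {?z}. r)"
  proof (rule sum_norm_le)
    fix y assume y: "y \<in> perp q n L - {?z}"
    have "norm (fcoeff q n g y * ?h y) \<le> 1 * r"
      unfolding norm_mult by (intro mult_mono fc r) (use y \<open>r \<ge> 0\<close> in auto)
    then show "norm (fcoeff q n g y * ?h y) \<le> r" by simp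
  qed
  also have "\<dots> = card (perp q n L - {?z}) * r" by simp
  also have "\<dots> \<le> card (perp q n L) * r"
    by (intro mult_right_mono \<open>r \<ge> 0\<close>) (simp add: card_mono finite_perp)
  finally show ?thesis by (simp only: of_nat_power)
qed

section \<open>Laws of entries and columns, and their character sums\<close>

definition law :: "nat \<Rightarrow> (int \<Rightarrow> real) \<Rightarrow> bool" where
  "law q m \<longleftrightarrow> (\<forall>a. 0 \<le> m a) \<and> (\<Sum>a\<in>{0..<int q}. m a) = 1"

definition balanced_law :: "nat \<Rightarrow> nat \<Rightarrow> real \<Rightarrow> (int \<Rightarrow> real) \<Rightarrow> bool" where
  "balanced_law p q \<epsilon> m \<longleftrightarrow> (\<forall>t. (\<Sum>a\<in>{a\<in>{0..<int q}. [a = t] (mod int p)}. m a) \<le> 1 - \<epsilon>)"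

definition col_law :: "nat \<Rightarrow> (nat \<Rightarrow> int \<Rightarrow> real) \<Rightarrow> (nat \<Rightarrow> int) \<Rightarrow> real" where
  "col_law n M v = (\<Prod>i<n. M i (v i))"

text \<open>The only consequence of balancedness that the comparison of laws uses. The uniform law
  has it for every nonnegative bound, so uniform columns count as free of degenerate
  entries.\<close>

definition char_small :: "nat \<Rightarrow> real \<Rightarrow> (int \<Rightarrow> real) \<Rightarrow> bool" where
  "char_small q \<rho> m \<longleftrightarrow> (\<forall>y. \<not> int q dvd y \<longrightarrow>
     norm (\<Sum>a\<in>{0..<int q}. of_real (m a) * add_char q (y * a)) \<le> \<rho>)"

lemma add_char_diff: "add_char q (a - b) = add_char q a * cnj (add_char q b)"
  by (simp add: add_char_def cis_mult cis_cnj right_diff_distrib diff_divide_distrib)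

lemma Re_add_char_gap:
  assumes "q > 0"
  obtains \<kappa> where "\<kappa> > 0" "\<And>t. \<not> int q dvd t \<Longrightarrow> Re (add_char q t) \<le> 1 - \<kappa>"
proof -
  \<comment> \<open>The extra element 1 keeps the minimum meaningful for \<open>q = 1\<close>, when
    there is no nonzero residue.\<close>
  define \<kappa> where "\<kappa> = Min (insert 1 ((\<lambda>t. 1 - Re (add_char q t)) ` {1..<int q}))"
  have gap: "Re (add_char q t) < 1" if "\<not> int q dvd t" for t
  proof -
    have n: "norm (add_char q t) = 1" by simp
    have "Re (add_char q t) \<le> 1" using complex_Re_le_cmod[of "add_char q t"] n by simp
    moreover have "Re (add_char q t) \<noteq> 1"
    proof
      assume "Re (add_char q t) = 1"
      then have "add_char q t = 1" using n by (simp add: cmod_def complex_eq_iff)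
      then show False using that add_char_eq_1_iff[OF assms] by blast
    qed
    ultimately show ?thesis by simp
  qed
  have "\<kappa> > 0"
    unfolding \<kappa>_def using gap zdvd_not_zless by (subst Min_gr_iff) force+
  moreover have "Re (add_char q t) \<le> 1 - \<kappa>" if "\<not> int q dvd t" for t
  proof -
    have eq: "add_char q t = add_char q (t mod int q)" using assms by (intro add_char_cong) (auto simp: cong_def)
    have "t mod int q \<noteq> 0" "0 \<le> t mod int q" "t mod int q < int q"
      using that assms by (auto simp: dvd_eq_mod_eq_0)
    then have "t mod int q \<in> {1..<int q}" by auto
    then have "\<kappa> \<le> 1 - Re (add_char q (t mod int q))"
      unfolding \<kappa>_def by (intro Min_le) auto
    then show ?thesis using eq by simp
  qed
  ultimately show ?thesis using that by blast
qed

text \<open>The squared modulus is the mean of \<open>add_char q (y * (a - b))\<close> over two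
  independent copies \<open>a\<close>, \<open>b\<close>. If they differ modulo \<open>p\<close>,
  then \<open>a - b\<close> is a unit modulo \<open>q\<close>, so the real part is at most
  \<open>1 - \<kappa>\<close>; balancedness gives this case mass at least \<open>\<epsilon>\<close>.
  The resulting bound \<open>1 - \<kappa> * \<epsilon>\<close> is the same for all balanced
  laws.\<close>

lemma entry_char_bound:
  assumes "prime p" "q = p ^ k" "\<epsilon> > 0"
  obtains \<rho> :: real where "0 < \<rho>" "\<rho> < 1"
    "\<And>m. law q m \<Longrightarrow> balanced_law p q \<epsilon> m \<Longrightarrow> char_small q \<rho> m"
proof -
  have q: "q > 0" using assms prime_gt_0_nat by simp
  obtain \<kappa> where \<kappa>: "\<kappa> > 0" "\<And>t. \<not> int q dvd t \<Longrightarrow> Re (add_char q t) \<le> 1 - \<kappa>"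
    using Re_add_char_gap[OF q] by blast
  \<comment> \<open>The maximum with 1/4 keeps \<open>\<rho>\<close> positive even if
    \<open>1 - \<kappa> * \<epsilon>\<close> is not.\<close>
  define \<rho> where "\<rho> = sqrt (max (1 - \<kappa> * \<epsilon>) (1/4))"
  have r: "0 < \<rho>" "\<rho> < 1"
    using \<kappa> assms(3) by (auto simp: \<rho>_def real_sqrt_lt_1_iff)
  have "norm (\<Sum>a\<in>{0..<int q}. of_real (m a) * add_char q (y * a)) \<le> \<rho>"
    if m: "law q m" "balanced_law p q \<epsilon> m" and y: "\<not> int q dvd y" for m y
  proof -
    let ?Z = "{0..<int q}"
    let ?S = "\<Sum>a\<in>?Z. of_real (m a) * add_char q (y * a)"
    have m0: "m a \<ge> 0" for a using m by (simp add: law_def)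
    have m1: "(\<Sum>a\<in>?Z. m a) = 1" using m by (simp add: law_def)
    have ndvd: "\<not> int q dvd y * (a - b)" if ab: "\<not> [b = a] (mod int p)" for a b
    proof
      assume d: "int q dvd y * (a - b)"
      have "\<not> int p dvd a - b" using ab by (metis cong_iff_dvd_diff cong_sym)
      then have "coprime (int p) (a - b)"
        using assms(1) prime_imp_coprime prime_int_nat_transfer by (metis of_nat_id prime_nat_int_transfer)
      then have "coprime (int q) (a - b)" by (simp add: assms(2))
      then show False using d y coprime_dvd_mult_left_iff by blast
    qed
    have tm: "Re (add_char q (y * (a - b))) \<le> 1 - \<kappa> + \<kappa> * (if [b = a] (mod int p) then 1 else 0)" for a b
      using \<kappa>(2)[OF ndvd, of b a] complex_Re_le_cmod[of "add_char q (y * (a - b))"] by auto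
    have "(norm ?S)\<^sup>2 = Re (?S * cnj ?S)"
      by (metis Re_complex_of_real complex_norm_square)
    also have "?S * cnj ?S = (\<Sum>a\<in>?Z. \<Sum>b\<in>?Z. of_real (m a * m b) * add_char q (y * (a - b)))"
      by (simp add: sum_product right_diff_distrib add_char_diff mult_ac)
    also have "Re \<dots> = (\<Sum>a\<in>?Z. \<Sum>b\<in>?Z. m a * m b * Re (add_char q (y * (a - b))))"
      by simp
    also have "\<dots> \<le> (\<Sum>a\<in>?Z. \<Sum>b\<in>?Z. m a * m b * (1 - \<kappa> + \<kappa> * (if [b = a] (mod int p) then 1 else 0)))"
      by (intro sum_mono mult_left_mono tm) (simp add: m0)
    also have "\<dots> = (\<Sum>a\<in>?Z. m a * ((1 - \<kappa>) * (\<Sum>b\<in>?Z. m b) +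
          \<kappa> * (\<Sum>b\<in>?Z. if [b = a] (mod int p) then m b else 0)))"
      by (simp add: sum_distrib_left sum.distrib[symmetric] algebra_simps if_distrib cong: if_cong)
    also have "\<dots> \<le> (\<Sum>a\<in>?Z. m a * ((1 - \<kappa>) * 1 + \<kappa> * (1 - \<epsilon>)))"
    unfolding m1
    proof (intro sum_mono mult_left_mono add_left_mono m0)
      fix a
      have "(\<Sum>b\<in>?Z. if [b = a] (mod int p) then m b else 0) =
          (\<Sum>b\<in>{b\<in>?Z. [b = a] (mod int p)}. m b)"
        by (rule sum.inter_filter[symmetric]) simp
      also have "\<dots> \<le> 1 - \<epsilon>" using m(2) by (simp add: balanced_law_def)
      finally show "(\<Sum>b\<in>?Z. if [b = a] (mod int p) then m b else 0) \<le> 1 - \<epsilon>" .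
    qed (use \<kappa> in auto)
    also have "\<dots> = 1 - \<kappa> * \<epsilon>" 
      using m1 by (simp add: sum_distrib_right[symmetric]) (simp add: algebra_simps)
    finally have "(norm ?S)\<^sup>2 \<le> max (1 - \<kappa> * \<epsilon>) (1/4)" by simp
    then show ?thesis unfolding \<rho>_def by (rule real_le_rsqrt)
  qed
  then show ?thesis using r that by (metis char_small_def)
qed

lemma col_law_nonneg: "(\<And>i. i < n \<Longrightarrow> law q (M i)) \<Longrightarrow> 0 \<le> col_law n M v"
  unfolding col_law_def by (intro prod_nonneg) (auto simp: law_def)

lemma sum_col_law: "(\<And>i. i < n \<Longrightarrow> law q (M i)) \<Longrightarrow> (\<Sum>v\<in>vecs q n. col_law n M v) = 1"
  unfolding col_law_def by (subst prod_sum_PiE[symmetric]) (auto simp: law_def)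

definition uniform_law :: "nat \<Rightarrow> int \<Rightarrow> real" where
  "uniform_law q a = 1 / q"

lemma law_uniform: "q > 0 \<Longrightarrow> law q (uniform_law q)"
  by (simp add: law_def uniform_law_def)

lemma char_small_uniform:
  assumes "q > 0" "\<rho> \<ge> 0"
  shows "char_small q \<rho> (uniform_law q)"
  unfolding char_small_def
proof (intro allI impI)
  fix y assume "\<not> int q dvd y"
  then have "(\<Sum>a\<in>{0..<int q}. add_char q (a * y)) = 0" using sum_add_char[OF assms(1), of y] by simp
  then show "norm (\<Sum>a\<in>{0..<int q}. of_real (uniform_law q a) * add_char q (y * a)) \<le> \<rho>"
    using assms by (simp add: uniform_law_def sum_divide_distrib[symmetric] mult.commute)
qed

locale char_bounded =
  fixes p k q :: nat and \<rho> :: real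
  assumes p: "prime p" and q: "q = p ^ k" and k: "k > 0"
    and \<rho>: "0 < \<rho>" "\<rho> < 1"
begin

lemma q_pos: "q > 0"
  using p q prime_gt_0_nat by simp

lemma p_pos: "p > 0"
  using p prime_gt_0_nat by simp

text \<open>Independence factors the sum over coordinates: a factor at a balanced entry with
  \<open>y i\<close> nonzero modulo \<open>q\<close> is at most \<open>\<rho>\<close>, any other at
  most 1.\<close>

lemma col_char_bound:
  assumes M: "\<And>i. i < n \<Longrightarrow> law q (M i)"
    and bal: "\<And>i. i < n \<Longrightarrow> i \<notin> D \<Longrightarrow> char_small q \<rho> (M i)"
  shows "norm (\<Sum>v\<in>vecs q n. of_real (col_law n M v) * add_char q (dot n y v))
    \<le> \<rho> ^ card {i\<in>{..<n} - D. \<not> int q dvd y i}"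
proof -
  have "(\<Sum>v\<in>vecs q n. of_real (col_law n M v) * add_char q (dot n y v)) =
      (\<Sum>v\<in>vecs q n. \<Prod>i<n. of_real (M i (v i)) * add_char q (y i * v i))"
    by (simp add: col_law_def add_char_dot prod.distrib)
  also have "\<dots> = (\<Prod>i<n. \<Sum>a\<in>{0..<int q}. of_real (M i a) * add_char q (y i * a))"
    by (rule prod_sum_PiE[symmetric]) auto
  also have "norm \<dots> \<le> (\<Prod>i<n. if i \<notin> D \<and> \<not> int q dvd y i then \<rho> else 1)"
    unfolding prod_norm[symmetric]
  proof (intro prod_mono conjI)
    fix i assume i: "i \<in> {..<n}"
    show "norm (\<Sum>a\<in>{0..<int q}. of_real (M i a) * add_char q (y i * a)) \<le>
        (if i \<notin> D \<and> \<not> int q dvd y i then \<rho> else 1)"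
    proof (cases "i \<notin> D \<and> \<not> int q dvd y i")
      case False
      have "norm (\<Sum>a\<in>{0..<int q}. of_real (M i a) * add_char q (y i * a)) \<le> (\<Sum>a\<in>{0..<int q}. M i a)"
        by (rule sum_norm_le) (use M i in \<open>auto simp: norm_mult law_def\<close>)
      also have "\<dots> = 1" using M i by (simp add: law_def)
      finally show ?thesis using False by (simp only: if_False)
    qed (use bal i in \<open>auto simp: char_small_def\<close>)
  qed auto
  also have "\<dots> = (\<Prod>i\<in>{i\<in>{..<n}. i \<notin> D \<and> \<not> int q dvd y i}. \<rho>)"
    by (rule prod.inter_filter[symmetric]) simp
  also have "{i\<in>{..<n}. i \<notin> D \<and> \<not> int q dvd y i} = {i\<in>{..<n} - D. \<not> int q dvd y i}"
    by auto
  finally show ?thesis by simp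
qed

text \<open>Averaging over the \<open>p\<close> characters of Z/p detects divisibility by
  \<open>p\<close>. The trivial one contributes \<open>1 / p\<close>; each of the other
  \<open>p - 1\<close> is small because \<open>w\<close> meets balanced entries.\<close>

lemma col_kernel_bound:
  assumes M: "\<And>i. i < n \<Longrightarrow> law q (M i)"
    and bal: "\<And>i. i < n \<Longrightarrow> i \<notin> D \<Longrightarrow> char_small q \<rho> (M i)"
  shows "(\<Sum>v\<in>{v\<in>vecs q n. int p dvd dot n w v}. col_law n M v)
    \<le> 1 / p + (1 - 1 / p) * \<rho> ^ card {i\<in>{..<n} - D. \<not> int p dvd w i}"
proof -
  define s where "s = card {i\<in>{..<n} - D. \<not> int p dvd w i}"
  define P where "P = (\<Sum>v\<in>{v\<in>vecs q n. int p dvd dot n w v}. col_law n M v)"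
  define T where "T = (\<lambda>t. \<Sum>v\<in>vecs q n. complex_of_real (col_law n M v) * add_char p (t * dot n w v))"
  have "complex_of_real P * of_nat p =
      (\<Sum>v\<in>vecs q n. of_real (col_law n M v) * (if int p dvd dot n w v then of_nat p else 0))"
  proof -
    have "P = (\<Sum>v\<in>vecs q n. if int p dvd dot n w v then col_law n M v else 0)"
      unfolding P_def by (rule sum.inter_filter[OF finite_vecs])
    then have "complex_of_real P * of_nat p = (\<Sum>v\<in>vecs q n.
        complex_of_real (if int p dvd dot n w v then col_law n M v else 0) * of_nat p)"
      by (simp only: of_real_sum sum_distrib_right)
    then show ?thesis by (auto intro: sum.cong elim!: trans)
  qed
  also have "\<dots> = (\<Sum>v\<in>vecs q n. \<Sum>t\<in>{0..<int p}. of_real (col_law n M v) * add_char p (t * dot n w v))"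
    by (simp only: sum_add_char[OF p_pos, symmetric] sum_distrib_left)
  also have "\<dots> = (\<Sum>t\<in>{0..<int p}. T t)"
    unfolding T_def by (rule sum.swap)
  also have "\<dots> = T 0 + (\<Sum>t\<in>{0..<int p} - {0}. T t)"
    using p_pos by (intro sum.remove) auto
  also have "T 0 = 1"
    using sum_col_law[where n=n and q=q and M=M] M by (simp add: T_def of_real_sum[symmetric] del: of_real_sum)
  finally have eq: "complex_of_real P * of_nat p = 1 + (\<Sum>t\<in>{0..<int p} - {0}. T t)" .
  have Tb: "norm (T t) \<le> \<rho> ^ s" if t: "t \<in> {0..<int p} - {0}" for t
  proof -
    have tp: "\<not> int p dvd t" using t zdvd_not_zless by force
    \<comment> \<open>A character modulo \<open>p\<close> is a character modulo \<open>q\<close>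
      whose frequency carries the factor \<open>p ^ (k - 1)\<close>, so
      \<open>col_char_bound\<close> applies to it.\<close>
    have q': "q = p * p ^ (k - 1)" using q k by (cases k) auto
    have dot_scale: "dot n (\<lambda>i. c * t * w i) v = c * t * dot n w v" for c v
      by (simp add: dot_def sum_distrib_left mult.assoc)
    have "add_char p (t * x) = add_char q (int p ^ (k - 1) * t * x)" for x
      using p_pos by (simp add: add_char_def q' mult.assoc)
    then have "T t = (\<Sum>v\<in>vecs q n. of_real (col_law n M v) * add_char q (dot n (\<lambda>i. int p ^ (k - 1) * t * w i) v))"
      unfolding T_def by (simp only: dot_scale)
    also have "norm \<dots> \<le> \<rho> ^ card {i\<in>{..<n} - D. \<not> int q dvd int p ^ (k - 1) * t * w i}"
      by (rule col_char_bound[OF M bal])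
    finally have le: "norm (T t) \<le> \<rho> ^ card {i\<in>{..<n} - D. \<not> int q dvd int p ^ (k - 1) * t * w i}" .
    have "int q dvd int p ^ (k - 1) * t * w i \<longleftrightarrow> int p dvd w i" for i
    proof -
      have "int q dvd int p ^ (k - 1) * t * w i \<longleftrightarrow> int p ^ (k - 1) * int p dvd int p ^ (k - 1) * (t * w i)"
        by (simp add: q' mult_ac)
      also have "\<dots> \<longleftrightarrow> int p dvd t * w i" using p_pos by simp
      also have "\<dots> \<longleftrightarrow> int p dvd w i"
        using p tp by (simp add: prime_dvd_mult_iff)
      finally show ?thesis .
    qed
    then show ?thesis using le by (simp add: s_def)
  qed
  have "P * p = Re (complex_of_real P * of_nat p)" by simp
  also have "\<dots> \<le> norm (complex_of_real P * of_nat p)" by (rule complex_Re_le_cmod)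
  also have "\<dots> \<le> norm (1::complex) + norm (\<Sum>t\<in>{0..<int p} - {0}. T t)"
    unfolding eq by (rule norm_triangle_ineq)
  also have "norm (\<Sum>t\<in>{0..<int p} - {0}. T t) \<le> (\<Sum>t\<in>{0..<int p} - {0}. \<rho> ^ s)"
    by (rule sum_norm_le) (rule Tb)
  also have "\<dots> = (real p - 1) * \<rho> ^ s"
    using p_pos by (simp add: card_Diff_singleton of_nat_diff)
  finally have "P * p \<le> 1 + (real p - 1) * \<rho> ^ s" by simp
  then have "P \<le> (1 + (real p - 1) * \<rho> ^ s) / p" using p_pos by (simp add: pos_le_divide_eq)
  also have "\<dots> = 1 / p + (1 - 1 / p) * \<rho> ^ s" using p_pos by (simp add: field_simps)
  finally show ?thesis unfolding P_def s_def .
qed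

end

section \<open>Sparse vectors modulo \<open>p\<close>\<close>

text \<open>The part of the support of \<open>w\<close> not hidden by the degenerate entries
  \<open>D\<close> of a column; \<open>D = {}\<close> gives the full support size.\<close>

definition supp_off :: "nat \<Rightarrow> nat set \<Rightarrow> (nat \<Rightarrow> int) \<Rightarrow> nat" where
  "supp_off n D w = card {i\<in>{..<n} - D. w i \<noteq> 0}"

text \<open>Markov's inequality for the weight \<open>x ^ supp_off n D w\<close>.\<close>
lemma card_small_supp:
  fixes x t :: real
  assumes "p > 0" "0 < x" "x < 1"
  shows "card {w\<in>vecs p n. real (supp_off n D w) < t}
     \<le> x powr (-t) * real p ^ card (D \<inter> {..<n}) * (1 + real p * x) ^ n"
proof -
  let ?A = "{w\<in>vecs p n. real (supp_off n D w) < t}"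
  have "real (card ?A) * x powr t = (\<Sum>w\<in>?A. x powr t)" by simp
  also have "\<dots> \<le> (\<Sum>w\<in>?A. x ^ supp_off n D w)"
  proof (rule sum_mono)
    fix w assume "w \<in> ?A"
    then have "x powr t \<le> x powr real (supp_off n D w)"
      using assms by (intro powr_mono') auto
    then show "x powr t \<le> x ^ supp_off n D w" using assms by (simp add: powr_realpow)
  qed
  also have "\<dots> \<le> (\<Sum>w\<in>vecs p n. x ^ supp_off n D w)"
    using assms by (intro sum_mono2 finite_vecs) auto
  also have "\<dots> = (\<Sum>w\<in>vecs p n. \<Prod>i<n. if i \<notin> D \<and> w i \<noteq> 0 then x else 1)"
  proof (rule sum.cong[OF refl])
    fix w :: "nat \<Rightarrow> int"
    have "(\<Prod>i<n. if i \<notin> D \<and> w i \<noteq> 0 then x else 1) = (\<Prod>i\<in>{i\<in>{..<n}. i \<notin> D \<and> w i \<noteq> 0}. x)"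
      by (rule prod.inter_filter[symmetric]) simp
    also have "{i\<in>{..<n}. i \<notin> D \<and> w i \<noteq> 0} = {i\<in>{..<n} - D. w i \<noteq> 0}" by auto
    finally show "x ^ supp_off n D w = (\<Prod>i<n. if i \<notin> D \<and> w i \<noteq> 0 then x else 1)"
      by (simp add: supp_off_def)
  qed
  also have "\<dots> = (\<Prod>i<n. \<Sum>a\<in>{0..<int p}. if i \<notin> D \<and> a \<noteq> 0 then x else 1)"
    by (rule prod_sum_PiE[symmetric]) auto
  \<comment> \<open>A coordinate in \<open>D\<close> is unweighted and costs the full factor
    \<open>p\<close>; one outside costs at most \<open>1 + p * x\<close>, which is close to 1 for
    small \<open>x\<close>.\<close>
  also have "\<dots> \<le> (\<Prod>i<n. (if i \<in> D then real p else 1) * (1 + real p * x))"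
  proof (intro prod_mono conjI)
    fix i
    have z: "{0..<int p} = insert 0 {1..<int p}" using assms by auto
    have "(\<Sum>a\<in>{0..<int p}. if i \<notin> D \<and> a \<noteq> 0 then x else 1) =
       1 + (\<Sum>a\<in>{1..<int p}. if i \<notin> D then x else 1)"
      unfolding z by (subst sum.insert) (auto intro!: sum.cong)
    also have "\<dots> \<le> (if i \<in> D then real p else 1) * (1 + real p * x)"
    proof (cases "i \<in> D")
      case True
      have "1 + real (nat (int p - 1)) = real p" using assms by linarith
      moreover have "real p * 1 \<le> real p * (1 + real p * x)" using assms by (intro mult_left_mono) auto
      ultimately show ?thesis using True by simp
    next
      case False
      have "real (nat (int p - 1)) * x \<le> real p * x" using assms by (intro mult_right_mono) auto
      then show ?thesis using False by simp
    qed
    finally show "(\<Sum>a\<in>{0..<int p}. if i \<notin> D \<and> a \<noteq> 0 then x else 1) \<le> \<dots>" .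
  qed (use assms in \<open>auto intro!: sum_nonneg\<close>)
  also have "\<dots> = (\<Prod>i<n. if i \<in> D then real p else 1) * (1 + real p * x) ^ n"
    by (simp add: prod.distrib)
  also have "(\<Prod>i<n. if i \<in> D then real p else 1) = (\<Prod>i\<in>{i\<in>{..<n}. i \<in> D}. real p)"
    by (rule prod.inter_filter[symmetric]) simp
  also have "\<dots> = real p ^ card (D \<inter> {..<n})"
    by (simp add: Int_def conj_commute)
  finally have "real (card ?A) * x powr t \<le> real p ^ card (D \<inter> {..<n}) * (1 + real p * x) ^ n" .
  then show ?thesis
    using assms by (simp add: powr_minus_divide pos_le_divide_eq field_simps)
qed

text \<open>Double counting of the pairs \<open>(i, j)\<close> with \<open>i\<close> in the support of \<open>w\<close> and \<open>i \<in> D j\<close>.\<close>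
lemma card_light_columns:
  fixes \<beta> g \<eta> :: real
  assumes J: "finite J" and row: "\<And>i. i < n \<Longrightarrow> real (card {j\<in>J. i \<in> D j}) \<le> b"
    and \<eta>: "\<eta> < 1" and g: "g \<le> \<eta> * supp_off n {} w" and w: "supp_off n {} w > 0"
  shows "real (card {j\<in>J. real (supp_off n (D j) w) < g}) \<le> b / (1 - \<eta>)"
proof -
  let ?T = "{j\<in>J. real (supp_off n (D j) w) < g}" and ?S = "{i\<in>{..<n}. w i \<noteq> 0}"
  have sS: "supp_off n {} w = card ?S" by (simp add: supp_off_def)
  have split: "card ?S = supp_off n (D j) w + card (?S \<inter> D j)" for j
  proof -
    have "?S = {i\<in>{..<n} - D j. w i \<noteq> 0} \<union> (?S \<inter> D j)" by auto
    then show ?thesis unfolding supp_off_def by (subst card_Un_disjoint[symmetric]) auto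
  qed
  have "real (card ?T) * ((1 - \<eta>) * card ?S) = (\<Sum>j\<in>?T. (1 - \<eta>) * card ?S)" by simp
  also have "\<dots> \<le> (\<Sum>j\<in>?T. real (card (?S \<inter> D j)))"
  proof (rule sum_mono)
    fix j assume j: "j \<in> ?T"
    \<comment> \<open>A light column sees fewer than \<open>g \<le> \<eta> * card ?S\<close> points
      of the support off \<open>D j\<close>, so at least the share \<open>1 - \<eta>\<close> of the
      support lies in \<open>D j\<close>.\<close>
    show "(1 - \<eta>) * card ?S \<le> real (card (?S \<inter> D j))"
      using split[of j] j g by (simp add: sS algebra_simps)
  qed
  also have "\<dots> \<le> (\<Sum>j\<in>J. real (card (?S \<inter> D j)))"
    using J by (intro sum_mono2) auto
  also have "\<dots> = (\<Sum>j\<in>J. \<Sum>i\<in>?S. if i \<in> D j then 1 else 0)"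
    by (simp add: sum.If_cases)
  also have "\<dots> = (\<Sum>i\<in>?S. \<Sum>j\<in>J. if i \<in> D j then 1 else 0)"
    by (rule sum.swap)
  also have "\<dots> = (\<Sum>i\<in>?S. real (card {j\<in>J. i \<in> D j}))"
    using J by (simp add: sum.If_cases Int_def)
  also have "\<dots> \<le> (\<Sum>i\<in>?S. b)" by (intro sum_mono row) auto
  also have "\<dots> = b * card ?S" by simp
  finally have "real (card ?T) * (1 - \<eta>) * card ?S \<le> b * card ?S" by (simp add: mult.assoc)
  then have "real (card ?T) * (1 - \<eta>) \<le> b" using w sS by simp
  then show ?thesis using \<eta> by (simp add: pos_le_divide_eq)
qed

lemma prod_bound_off_small:
  fixes f :: "'a \<Rightarrow> real"
  assumes "finite J" "\<And>j. j \<in> J \<Longrightarrow> 0 \<le> f j" "\<And>j. j \<in> J \<Longrightarrow> f j \<le> 1"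
    and "\<And>j. j \<in> J \<Longrightarrow> j \<notin> T \<Longrightarrow> f j \<le> c" and c: "0 < c" "c \<le> 1"
    and m: "m \<le> real (card (J - T))"
  shows "prod f J \<le> c powr m"
proof -
  have "prod f J \<le> (\<Prod>j\<in>J. if j \<notin> T then c else 1)"
    using assms by (intro prod_mono) auto
  also have "\<dots> = (\<Prod>j\<in>{j\<in>J. j \<notin> T}. c)"
    using assms by (intro prod.inter_filter[symmetric])
  also have "{j\<in>J. j \<notin> T} = J - T" by auto
  also have "(\<Prod>j\<in>J - T. c) = c powr real (card (J - T))"
    using c by (simp add: powr_realpow)
  also have "\<dots> \<le> c powr m" using c m by (intro powr_mono') auto
  finally show ?thesis .
qed

text \<open>
  \<open>thin_bound\<close> is the union bound for some thin vector being orthogonal to all columns in \<open>J\<close>: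
  \<open>D j\<close> is the set of degenerate entries of column \<open>j\<close>, and \<open>\<rho>\<close> bounds the expectation of a
  nontrivial character at a balanced entry.
\<close>

definition thin_vecs :: "nat \<Rightarrow> nat \<Rightarrow> real \<Rightarrow> nat set \<Rightarrow> (nat \<Rightarrow> int) set" where
  "thin_vecs p n t D = {w\<in>vecs p n. (\<exists>i<n. w i \<noteq> 0) \<and> real (supp_off n D w) < t}"

definition thin_bound ::
  "nat \<Rightarrow> real \<Rightarrow> nat \<Rightarrow> real \<Rightarrow> nat set \<Rightarrow> (nat \<Rightarrow> nat set) \<Rightarrow> nat set \<Rightarrow> real" where
  "thin_bound p \<rho> n t J D D0 =
     (\<Sum>w\<in>thin_vecs p n t D0. \<Prod>j\<in>J. 1 / p + (1 - 1 / p) * \<rho> ^ supp_off n (D j) w)"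

text \<open>The constants must not depend on \<open>n\<close>, \<open>J\<close> or \<open>D\<close>,
  since the bound is applied to every column at every stage of the replacement.
  \<open>n - 1 \<le> card J\<close> allows for the one column left out; the shift by one in the
  exponents goes into \<open>K\<close>.\<close>

lemma thin_bound_exponential:
  fixes \<alpha> \<beta> \<rho> :: real and p :: nat
  assumes p: "p \<ge> 2" and \<rho>: "0 < \<rho>" "\<rho> < 1" and ab: "0 < \<alpha>" "0 < \<beta>" "\<alpha> + \<beta> < 1"
  obtains \<delta> \<theta> K :: real and n0 :: nat where "0 < \<delta>" "0 < \<theta>" "\<theta> < 1" "0 \<le> K"
    "\<And>n (J :: nat set) D j0. n \<ge> n0 \<Longrightarrow> finite J \<Longrightarrow> n - 1 \<le> card J \<Longrightarrow>
       real (card (D j0 \<inter> {..<n})) \<le> \<alpha> * n \<Longrightarrow>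
       (\<And>i. i < n \<Longrightarrow> real (card {j\<in>J. i \<in> D j}) \<le> \<beta> * n) \<Longrightarrow>
       thin_bound p \<rho> n (\<delta> * n) J D (D j0) \<le> K * \<theta> ^ n"
proof -
  define P where "P = real p"
  define \<tau> where "\<tau> = 1 - \<alpha> - \<beta>"
  \<comment> \<open>Half of the slack \<open>\<tau>\<close> is spent on enlarging
    \<open>\<beta>\<close>; the other half remains as decay, since
    \<open>\<alpha> - (1 - \<beta>') = - \<tau> / 2\<close>.\<close>
  define \<beta>' where "\<beta>' = \<beta> + \<tau> / 2"
  define c where "c = 1 / P + (1 - 1 / P) * \<rho>"
  \<comment> \<open>The decay rates of the two regimes before losses: the first for larger supports,
    the second for tiny ones, where \<open>c\<close> is the kernel bound of a column in which
    \<open>w\<close> meets at least one balanced entry.\<close>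
  define \<theta>0 where "\<theta>0 = max (P powr (- \<tau> / 2)) (c powr (1 - \<beta>))"
  have P: "P \<ge> 2" using p by (simp add: P_def)
  have \<tau>: "0 < \<tau>" "\<tau> < 1" using ab by (auto simp: \<tau>_def)
  have \<beta>': "\<beta> < \<beta>'" "\<beta>' < 1" using ab by (auto simp: \<beta>'_def \<tau>_def field_simps)
  have c0: "0 < c" unfolding c_def using P \<rho> by (intro add_pos_pos mult_pos_pos) (auto simp: field_simps)
  have c1: "c < 1"
  proof -
    have "(1 - 1 / P) * \<rho> < (1 - 1 / P) * 1" using P \<rho> by (intro mult_strict_left_mono) auto
    then show ?thesis by (simp add: c_def)
  qed
  have \<theta>0: "0 < \<theta>0" "\<theta>0 < 1"
  proof -
    have "P powr (- \<tau> / 2) < 1" using P \<tau> powr_less_mono[of "- \<tau> / 2" 0 P] by simp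
    moreover have "c powr (1 - \<beta>) < 1" using c0 c1 ab powr_less_mono2[of "1 - \<beta>" c 1] by simp
    ultimately show "\<theta>0 < 1" by (simp add: \<theta>0_def)
    show "0 < \<theta>0" using P by (simp add: \<theta>0_def less_max_iff_disj)
  qed
  \<comment> \<open>A number \<open>\<kappa>\<close> slightly above 1 gives the room for losses. At
    most three factors \<open>\<kappa> ^ n\<close> occur: two from counting vectors of small
    support, one from using \<open>\<kappa> / P\<close> in place of \<open>1 / P\<close> for the
    columns. \<open>\<kappa> < P\<close> keeps \<open>\<kappa> / P\<close> below 1.\<close>
  have "((\<lambda>k. k ^ 3 * \<theta>0) \<longlongrightarrow> 1 ^ 3 * \<theta>0) (at_right (1::real))" by (intro tendsto_intros)
  then have "eventually (\<lambda>k. k ^ 3 * \<theta>0 < 1) (at_right 1)"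
    using \<theta>0 by (intro order_tendstoD(2)) auto
  moreover have "eventually (\<lambda>k. k \<in> {1<..<P}) (at_right 1)"
    using P by (intro eventually_at_right_real) simp
  ultimately have "eventually (\<lambda>k. k ^ 3 * \<theta>0 < 1 \<and> 1 < k \<and> k < P) (at_right 1)"
    by eventually_elim auto
  then obtain \<kappa> where \<kappa>: "\<kappa> ^ 3 * \<theta>0 < 1" and \<kappa>1: "1 < \<kappa>" and \<kappa>P: "\<kappa> < P"
    using eventually_happens trivial_limit_at_right_real by blast
  define \<theta> where "\<theta> = \<kappa> ^ 3 * \<theta>0"
  \<comment> \<open>\<open>x\<close> and \<open>\<delta>\<close> are chosen so that in
    \<open>card_small_supp\<close> at \<open>t = \<delta> * n\<close> both
    \<open>x powr (- t)\<close> and \<open>(1 + P * x) ^ n\<close> are at most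
    \<open>\<kappa> ^ n\<close>.\<close>
  define x where "x = min (1/2) ((\<kappa> - 1) / P)"
  define \<delta> where "\<delta> = ln \<kappa> / (- ln x)"
  \<comment> \<open>With this \<open>\<eta>\<close> the bound
    \<open>\<beta> * n / (1 - \<eta>)\<close> on the number of light columns is exactly
    \<open>\<beta>' * n\<close>.\<close>
  define \<eta> where "\<eta> = 1 - \<beta> / \<beta>'"
  define r where "r = \<rho> powr (\<eta> * \<delta>)"
  have \<theta>: "0 < \<theta>" "\<theta> < 1" using \<theta>0 \<kappa> \<kappa>1 by (auto simp: \<theta>_def)
  have \<kappa>2: "\<kappa> ^ 2 * \<theta>0 \<le> \<theta>"
  proof -
    have "\<kappa> ^ 2 \<le> \<kappa> ^ 3" using \<kappa>1 by (intro power_increasing) auto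
    then show ?thesis using \<theta>0 unfolding \<theta>_def by (intro mult_right_mono) auto
  qed
  have x: "0 < x" "x < 1" "1 + P * x \<le> \<kappa>"
  proof -
    show "0 < x" "x < 1" using \<kappa>1 P by (auto simp: x_def)
    have "P * x \<le> P * ((\<kappa> - 1) / P)" using P by (intro mult_left_mono) (auto simp: x_def)
    then show "1 + P * x \<le> \<kappa>" using P by simp
  qed
  have lnx: "ln x < 0" using x by simp
  have \<delta>: "0 < \<delta>" using lnx \<kappa>1 by (simp add: \<delta>_def divide_pos_neg zero_less_divide_iff)
  have xd: "x powr (- (\<delta> * real n)) = \<kappa> ^ n" for n
  proof -
    have "x powr (- (\<delta> * real n)) = exp (ln \<kappa> * real n)"
      using x lnx by (simp add: powr_def \<delta>_def)
    also have "\<dots> = \<kappa> powr real n" using \<kappa>1 by (simp add: powr_def mult.commute)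
    also have "\<dots> = \<kappa> ^ n" using \<kappa>1 by (simp add: powr_realpow)
    finally show ?thesis .
  qed
  have \<eta>: "0 < \<eta>" "\<eta> < 1" using \<beta>' ab by (auto simp: \<eta>_def)
  have r: "0 < r" "r < 1" using \<rho> \<eta> \<delta> powr_less_mono'[of \<rho> 0 "\<eta> * \<delta>"] by (auto simp: r_def)
  \<comment> \<open>For supports of size at least \<open>\<delta> * n\<close>, a column that is not
    light has kernel probability at most \<open>(1 + P * r ^ n) / P\<close>; from \<open>n1\<close>
    on this is below \<open>\<kappa> / P\<close>.\<close>
  have "(\<lambda>n. P * r ^ n) \<longlonglongrightarrow> 0"
    using r by (intro tendsto_mult_right_zero LIMSEQ_realpow_zero) auto
  then have "eventually (\<lambda>n. P * r ^ n < \<kappa> - 1) sequentially"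
    using \<kappa>1 by (intro order_tendstoD) auto
  then obtain n1 where n1: "\<And>n. n \<ge> n1 \<Longrightarrow> P * r ^ n < \<kappa> - 1"
    by (auto simp: eventually_sequentially)
  define n0 where "n0 = max 1 n1"
  define K where "K = P + 1 / c"
  have K: "0 \<le> K" using P c0 by (simp add: K_def)
  define f where "f = (\<lambda>s. 1 / P + (1 - 1 / P) * \<rho> ^ s)"
  have f0: "0 \<le> f s" for s unfolding f_def using P \<rho> by (intro add_nonneg_nonneg mult_nonneg_nonneg) auto
  have f1: "f s \<le> 1" for s
  proof -
    have "(1 - 1 / P) * \<rho> ^ s \<le> (1 - 1 / P) * 1"
      using P \<rho> by (intro mult_left_mono power_le_one) auto
    then show ?thesis by (simp add: f_def)
  qed
  have main: "(\<Sum>w\<in>{w\<in>vecs p n. (\<exists>i<n. w i \<noteq> 0) \<and> real (supp_off n (D j0) w) < \<delta> * n}.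
          \<Prod>j\<in>J. f (supp_off n (D j) w)) \<le> K * \<theta> ^ n"
    if n: "n \<ge> n0" and J: "finite J" "n - 1 \<le> card J"
      and col: "real (card (D j0 \<inter> {..<n})) \<le> \<alpha> * n"
      and row: "\<And>i. i < n \<Longrightarrow> real (card {j\<in>J. i \<in> D j}) \<le> \<beta> * n"
    for n D j0 and J :: "nat set"
  proof -
    let ?pr = "\<lambda>w. \<Prod>j\<in>J. f (supp_off n (D j) w)"
    have n_pos: "n \<ge> 1" using n by (simp add: n0_def)
    have Jn: "real n - 1 \<le> card J" using J n_pos by linarith
    \<comment> \<open>For tiny supports, one coordinate of \<open>w\<close> is balanced in about \<open>(1 - \<beta>) n\<close> columns, and there are
      at most \<open>\<kappa> ^ (2 * n)\<close> such \<open>w\<close>, with \<open>\<kappa>\<close> close to 1. Otherwise, all but about \<open>\<beta> n\<close> columns have linearly many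
      balanced entries on the support, and there are about \<open>P powr (\<alpha> * n)\<close> such \<open>w\<close>.\<close>
    define B1 where "B1 = {w\<in>vecs p n. (\<exists>i<n. w i \<noteq> 0) \<and> real (supp_off n {} w) < \<delta> * n}"
    define B2 where "B2 = {w\<in>vecs p n. real (supp_off n (D j0) w) < \<delta> * n \<and> real (supp_off n {} w) \<ge> \<delta> * n}"
    have fin: "finite B1" "finite B2" by (auto simp: B1_def B2_def finite_vecs)
    have pr0: "0 \<le> ?pr w" for w by (intro prod_nonneg) (auto simp: f0)
    have xk: "(1 + P * x) ^ n \<le> \<kappa> ^ n" using x P by (intro power_mono) auto
    have le1: "?pr w \<le> \<theta>0 ^ n / c" if w: "w \<in> B1" for w
    proof -
      obtain i where i: "i < n" "w i \<noteq> 0" using w by (auto simp: B1_def)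
      have "?pr w \<le> c powr ((1 - \<beta>) * n - 1)"
      proof (rule prod_bound_off_small[where T = "{j\<in>J. i \<in> D j}"])
        fix j assume j: "j \<in> J" "j \<notin> {j\<in>J. i \<in> D j}"
        have "supp_off n (D j) w > 0"
          unfolding supp_off_def using i j by (subst card_gt_0_iff) auto
        then have "\<rho> ^ supp_off n (D j) w \<le> \<rho> ^ 1"
          using \<rho> by (intro power_decreasing) auto
        then show "f (supp_off n (D j) w) \<le> c"
          unfolding f_def c_def using P by (intro add_left_mono mult_left_mono) auto
      next
        have "card (J - {j\<in>J. i \<in> D j}) = card J - card {j\<in>J. i \<in> D j}"
          using J by (intro card_Diff_subset) auto
        moreover have "card {j\<in>J. i \<in> D j} \<le> card J" using J by (intro card_mono) auto
        ultimately have "real (card (J - {j\<in>J. i \<in> D j})) = real (card J) - real (card {j\<in>J. i \<in> D j})"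
          by simp
        then show "(1 - \<beta>) * n - 1 \<le> real (card (J - {j\<in>J. i \<in> D j}))"
          using Jn row[OF i(1)] by (simp add: algebra_simps)
      qed (use J f0 f1 c0 c1 in auto)
      also have "\<dots> = (c powr (1 - \<beta>)) ^ n / c"
        using c0 by (simp add: powr_diff powr_powr[symmetric] powr_realpow)
      also have "\<dots> \<le> \<theta>0 ^ n / c"
        using c0 by (intro divide_right_mono power_mono) (auto simp: \<theta>0_def)
      finally show ?thesis .
    qed
    have card1: "real (card B1) \<le> \<kappa> ^ n * \<kappa> ^ n"
    proof -
      have "card B1 \<le> card {w\<in>vecs p n. real (supp_off n {} w) < \<delta> * n}"
        unfolding B1_def by (intro card_mono) (auto simp: finite_vecs)
      then have "real (card B1) \<le> x powr (-(\<delta> * n)) * real p ^ card ({} \<inter> {..<n}) * (1 + real p * x) ^ n"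
        using card_small_supp[of p x n "{}" "\<delta> * n"] p x by linarith
      also have "\<dots> \<le> \<kappa> ^ n * 1 * \<kappa> ^ n"
        unfolding xd using xk \<kappa>1 P x by (intro mult_mono) (auto simp: P_def)
      finally show ?thesis by simp
    qed
    have sum1: "(\<Sum>w\<in>B1. ?pr w) \<le> \<theta> ^ n / c"
    proof -
      have "(\<Sum>w\<in>B1. ?pr w) \<le> real (card B1) * (\<theta>0 ^ n / c)"
        by (intro sum_bounded_above le1)
      also have "\<dots> \<le> \<kappa> ^ n * \<kappa> ^ n * (\<theta>0 ^ n / c)"
        using \<theta>0 c0 by (intro mult_right_mono card1) auto
      also have "\<dots> = (\<kappa> ^ 2 * \<theta>0) ^ n / c"
        by (simp add: power_mult_distrib power2_eq_square mult.assoc)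
      also have "\<dots> \<le> \<theta> ^ n / c"
        using \<theta>0 c0 \<kappa>1 by (intro divide_right_mono power_mono \<kappa>2) auto
      finally show ?thesis .
    qed
    have le2: "?pr w \<le> \<kappa> ^ n * (P * P powr (- ((1 - \<beta>') * n)))" if w: "w \<in> B2" for w
    proof -
      define g where "g = \<eta> * \<delta> * n"
      define T where "T = {j\<in>J. real (supp_off n (D j) w) < g}"
      have S: "real (supp_off n {} w) \<ge> \<delta> * n" using w by (simp add: B2_def)
      then have "real (supp_off n {} w) > 0" using \<delta> n_pos
        by (metis mult_pos_pos less_le_trans of_nat_0_less_iff zero_less_one)
      then have S0: "supp_off n {} w > 0" by simp
      have "g \<le> \<eta> * supp_off n {} w" 
        unfolding g_def mult.assoc using S \<eta> by (intro mult_left_mono) auto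
      then have "real (card T) \<le> \<beta> * n / (1 - \<eta>)"
        unfolding T_def by (intro card_light_columns J row \<eta> S0)
      also have "\<dots> = \<beta>' * n" using ab \<beta>' by (simp add: \<eta>_def)
      finally have T: "real (card T) \<le> \<beta>' * n" .
      have "?pr w \<le> (\<kappa> / P) powr ((1 - \<beta>') * n - 1)"
      proof (rule prod_bound_off_small[where T = T])
        fix j assume j: "j \<in> J" "j \<notin> T"
        have "\<rho> ^ supp_off n (D j) w = \<rho> powr real (supp_off n (D j) w)" using \<rho> by (simp add: powr_realpow)
        also have "\<dots> \<le> \<rho> powr g" using j \<rho> by (intro powr_mono') (auto simp: T_def)
        also have "\<dots> = r ^ n"
          using \<rho> by (simp add: r_def g_def powr_powr[symmetric] powr_realpow)
        finally have "(1 - 1 / P) * \<rho> ^ supp_off n (D j) w \<le> 1 * r ^ n"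
          using P \<rho> by (intro mult_mono) auto
        then have "f (supp_off n (D j) w) \<le> (1 + P * r ^ n) / P"
          using P by (simp add: f_def add_divide_distrib)
        also have "\<dots> \<le> \<kappa> / P"
          using n1[of n] n P by (intro divide_right_mono) (auto simp: n0_def)
        finally show "f (supp_off n (D j) w) \<le> \<kappa> / P" .
      next
        have "card (J - T) = card J - card T"
          using J by (intro card_Diff_subset) (auto simp: T_def)
        moreover have "card T \<le> card J" using J by (intro card_mono) (auto simp: T_def)
        ultimately have "real (card (J - T)) = real (card J) - real (card T)"
          by simp
        then show "(1 - \<beta>') * n - 1 \<le> real (card (J - T))"
          using Jn T by (simp add: algebra_simps)
      qed (use J f0 f1 \<kappa>1 \<kappa>P P in auto)
      also have "\<dots> = \<kappa> powr ((1 - \<beta>') * n - 1) * P powr (- ((1 - \<beta>') * n - 1))"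
        unfolding powr_minus_divide using \<kappa>1 P by (simp add: powr_divide)
      also have "P powr (- ((1 - \<beta>') * n - 1)) = P powr (1 + - ((1 - \<beta>') * n))" by simp
      also have "\<dots> = P * P powr (- ((1 - \<beta>') * n))"
        using P by (subst powr_add) auto
      also have "\<kappa> powr ((1 - \<beta>') * n - 1) \<le> \<kappa> powr real n"
        using \<kappa>1 \<beta>' ab by (intro powr_mono) (auto simp: algebra_simps intro: add_increasing)
      also have "\<dots> = \<kappa> ^ n" using \<kappa>1 by (simp add: powr_realpow)
      finally show ?thesis using P by (simp add: mult_right_mono)
    qed
    have card2: "real (card B2) \<le> \<kappa> ^ n * P powr (\<alpha> * n) * \<kappa> ^ n"
    proof -
      have "card B2 \<le> card {w\<in>vecs p n. real (supp_off n (D j0) w) < \<delta> * n}"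
        unfolding B2_def by (intro card_mono) (auto simp: finite_vecs)
      then have "real (card B2) \<le> x powr (-(\<delta> * n)) * real p ^ card (D j0 \<inter> {..<n}) * (1 + real p * x) ^ n"
        using card_small_supp[of p x n "D j0" "\<delta> * n"] p x by linarith
      also have "real p ^ card (D j0 \<inter> {..<n}) = P powr real (card (D j0 \<inter> {..<n}))"
        using P by (simp add: P_def powr_realpow)
      also have "x powr (-(\<delta> * n)) * P powr real (card (D j0 \<inter> {..<n})) * (1 + real p * x) ^ n
         \<le> \<kappa> ^ n * P powr (\<alpha> * n) * \<kappa> ^ n"
        unfolding xd using xk \<kappa>1 P col x by (intro mult_mono powr_mono) (auto simp: P_def)
      finally show ?thesis .
    qed
    have sum2: "(\<Sum>w\<in>B2. ?pr w) \<le> P * \<theta> ^ n"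
    proof -
      have "(\<Sum>w\<in>B2. ?pr w) \<le> real (card B2) * (\<kappa> ^ n * (P * P powr (- ((1 - \<beta>') * n))))"
        by (intro sum_bounded_above le2)
      also have "\<dots> \<le> \<kappa> ^ n * P powr (\<alpha> * n) * \<kappa> ^ n * (\<kappa> ^ n * (P * P powr (- ((1 - \<beta>') * n))))"
        using \<kappa>1 P by (intro mult_right_mono card2) auto
      also have "\<dots> = P * ((\<kappa> ^ n * \<kappa> ^ n * \<kappa> ^ n) * (P powr (\<alpha> * n) * P powr (- ((1 - \<beta>') * n))))"
        by simp
      also have "P powr (\<alpha> * n) * P powr (- ((1 - \<beta>') * n)) = P powr ((- \<tau> / 2) * n)"
        unfolding powr_add[symmetric] by (simp add: \<beta>'_def \<tau>_def field_simps)
      also have "\<dots> = (P powr (- \<tau> / 2)) ^ n"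
        using P by (simp only: powr_powr[symmetric]) (simp add: powr_realpow)
      also have "\<kappa> ^ n * \<kappa> ^ n * \<kappa> ^ n * (P powr (- \<tau> / 2)) ^ n = (\<kappa> ^ 3 * P powr (- \<tau> / 2)) ^ n"
        by (simp add: power_mult_distrib power3_eq_cube)
      also have "P * \<dots> \<le> P * (\<kappa> ^ 3 * \<theta>0) ^ n"
        using P \<kappa>1 by (intro mult_left_mono power_mono) (auto simp: \<theta>0_def)
      finally show ?thesis by (simp only: \<theta>_def)
    qed
    have "(\<Sum>w\<in>{w\<in>vecs p n. (\<exists>i<n. w i \<noteq> 0) \<and> real (supp_off n (D j0) w) < \<delta> * n}. ?pr w)
       \<le> (\<Sum>w\<in>B1 \<union> B2. ?pr w)"
      using fin pr0 by (intro sum_mono2) (auto simp: B1_def B2_def)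
    also have "\<dots> \<le> (\<Sum>w\<in>B1. ?pr w) + (\<Sum>w\<in>B2. ?pr w)"
      using fin pr0 sum.union_inter[OF fin, of ?pr] sum_nonneg[of "B1 \<inter> B2" ?pr] by simp
    also have "\<dots> \<le> \<theta> ^ n / c + P * \<theta> ^ n" by (intro add_mono sum1 sum2)
    also have "\<dots> = K * \<theta> ^ n" by (simp add: K_def algebra_simps)
    finally show ?thesis .
  qed
  show ?thesis
    by (rule that[of \<delta> \<theta> K n0]) (use \<delta> \<theta> K main in \<open>auto simp: f_def P_def thin_bound_def thin_vecs_def\<close>)
qed

section \<open>Generating tuples in abelian \<open>p\<close>-groups\<close>

text \<open>The probability that \<open>N\<close> uniform vectors span the space of dimension
  \<open>d\<close> over the field with \<open>p\<close> elements; it vanishes for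
  \<open>N < d\<close>.\<close>

definition gen_prob :: "nat \<Rightarrow> nat \<Rightarrow> nat \<Rightarrow> real" where
  "gen_prob p N d = (\<Prod>i<d. 1 - real p ^ i / real p ^ N)"

lemma gen_prob_0_right [simp]: "gen_prob p N 0 = 1"
  by (simp add: gen_prob_def)

lemma gen_prob_0_left: "gen_prob p 0 d = (if d = 0 then 1 else 0)"
proof (cases d)
  case (Suc m)
  then show ?thesis by (simp only: gen_prob_def prod.lessThan_Suc_shift) simp
qed simp

text \<open>Condition on one vector in dimension \<open>Suc d\<close>: it is zero with probability
  \<open>1 / p ^ Suc d\<close>, and otherwise the quotient by its line has dimension
  \<open>d\<close>.\<close>

lemma gen_prob_Suc:
  assumes "p > 0"
  shows "gen_prob p (Suc N) (Suc d) =
    gen_prob p N (Suc d) / real p ^ Suc d + (1 - 1 / real p ^ Suc d) * gen_prob p N d"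
proof -
  have "gen_prob p (Suc N) (Suc d) = (1 - 1 / real p ^ Suc N) * gen_prob p N d"
    using assms unfolding gen_prob_def prod.lessThan_Suc_shift by (simp add: field_simps)
  also have "1 - 1 / real p ^ Suc N =
      (1 - real p ^ d / real p ^ N) / real p ^ Suc d + (1 - 1 / real p ^ Suc d)"
    using assms by (simp add: field_simps)
  also have "\<dots> * gen_prob p N d = gen_prob p N d * (1 - real p ^ d / real p ^ N) / real p ^ Suc d +
      (1 - 1 / real p ^ Suc d) * gen_prob p N d"
    by (simp add: distrib_right)
  also have "gen_prob p N d * (1 - real p ^ d / real p ^ N) = gen_prob p N (Suc d)"
    by (simp add: gen_prob_def)
  finally show ?thesis .
qed

text \<open>Exponents of \<open>v\<close> can be reduced modulo \<open>p\<close>, the excess lying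
  in \<open>K\<close>. Used with a prime for counting generators and with the modulus
  \<open>q\<close> for the growth of a column span.\<close>

lemma (in comm_group) cosets_by_powers:
  assumes K: "subgroup K G" and v: "v \<in> carrier G" "v [^] (p::nat) \<in> K" and p: "p > 0"
  shows "generate G (insert v K) \<subseteq> (\<lambda>(c, x). v [^] c \<otimes> x) ` ({..<p} \<times> K)"
proof -
  have Kc: "K \<subseteq> carrier G" by (rule subgroup.subset[OF K])
  have sv: "subgroup (generate G {v}) G" by (rule generate_is_subgroup) (use v in auto)
  have "generate G (insert v K) \<subseteq> generate G {v} <#> K"
  proof (rule generate_subgroup_incl)
    show "subgroup (generate G {v} <#> K) G" by (rule mult_subgroups[OF sv K])
    have "v \<otimes> \<one> \<in> generate G {v} <#> K"
      unfolding set_mult_def using subgroup.one_closed[OF K] by (blast intro: generate.incl)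
    moreover have "s \<in> generate G {v} <#> K" if "s \<in> K" for s
    proof -
      have "\<one> \<otimes> s \<in> generate G {v} <#> K"
        unfolding set_mult_def using that by (blast intro: generate.one)
      then show ?thesis using that Kc by (simp add: subset_iff)
    qed
    ultimately show "insert v K \<subseteq> generate G {v} <#> K"
      using v Kc by auto
  qed
  also have "\<dots> \<subseteq> (\<lambda>(c, x). v [^] c \<otimes> x) ` ({..<p} \<times> K)"
  proof
    fix y assume "y \<in> generate G {v} <#> K"
    then obtain m :: int and x where y: "y = v [^] m \<otimes> x" and x: "x \<in> K"
      using generate_pow[OF v(1)] by (auto simp: set_mult_def)
    define c where "c = nat (m mod int p)"
    have c: "c < p" "int c = m mod int p" using p by (auto simp: c_def nat_less_iff)
    have "m = int c + int p * (m div int p)" using c by simp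
    then have "v [^] m = v [^] int c \<otimes> v [^] (int p * (m div int p))"
      using v by (metis int_pow_mult)
    also have "\<dots> = v [^] c \<otimes> (v [^] p) [^] (m div int p)"
      using v by (simp add: int_pow_pow[symmetric] int_pow_int)
    finally have "y = v [^] c \<otimes> ((v [^] p) [^] (m div int p) \<otimes> x)"
      using y v x Kc by (simp add: m_assoc subsetD)
    moreover have "(v [^] p) [^] (m div int p) \<otimes> x \<in> K"
      by (intro subgroup.m_closed[OF K] subgroup_int_pow_closed[OF K] v x)
    ultimately show "y \<in> (\<lambda>(c, x). v [^] c \<otimes> x) ` ({..<p} \<times> K)" using c by force
  qed
  finally show ?thesis .
qed

lemma (in group) card_subgroup_dvd_card:
  assumes "subgroup K G" "subgroup H G" "K \<subseteq> H"
  shows "card K dvd card H"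
proof -
  interpret H: group "G\<lparr>carrier := H\<rparr>" by (rule subgroup_imp_group[OF assms(2)])
  have "subgroup K (G\<lparr>carrier := H\<rparr>)" by (rule subgroup_incl[OF assms])
  from H.lagrange[OF this] have "card (rcosets\<^bsub>G\<lparr>carrier := H\<rparr>\<^esub> K) * card K = card H"
    by (simp add: order_def)
  then show ?thesis by (metis dvd_triv_right)
qed

text \<open>The index of \<open>K\<close> in the larger group exceeds 1, is at most \<open>p\<close>
  by \<open>cosets_by_powers\<close>, and divides \<open>p ^ d\<close>.\<close>

lemma (in comm_group) card_generate_insert_prime:
  assumes fin: "finite (carrier G)" and p: "prime p"
    and K: "subgroup K G" and v: "v \<in> carrier G" "v [^] p \<in> K" "v \<notin> K"
    and card: "card (carrier G) = card K * p ^ d"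
  shows "card (generate G (insert v K)) = p * card K"
proof -
  let ?H = "generate G (insert v K)"
  have p0: "p > 0" using p prime_gt_0_nat by simp
  have Kc: "K \<subseteq> carrier G" by (rule subgroup.subset[OF K])
  have H: "subgroup ?H G" by (rule generate_is_subgroup) (use v Kc in auto)
  have Hc: "?H \<subseteq> carrier G" by (rule subgroup.subset[OF H])
  have KH: "K \<subseteq> ?H" by (auto intro: generate.incl)
  have finK: "finite K" "finite ?H" using fin Kc Hc by (auto intro: finite_subset)
  have K0: "card K > 0" using subgroup.one_closed[OF K] finK by (auto simp: card_gt_0_iff)
  have "card ?H \<le> card ((\<lambda>(c, x). v [^] c \<otimes> x) ` ({..<p} \<times> K))"
    by (rule card_mono[OF _ cosets_by_powers[OF K v(1,2) p0]]) (use finK in auto)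
  also have "\<dots> \<le> card ({..<p} \<times> K)" by (rule card_image_le) (use finK in auto)
  finally have le: "card ?H \<le> p * card K" by (simp add: card_cartesian_product)
  obtain m where m: "card ?H = card K * m" using card_subgroup_dvd_card[OF K H KH] by auto
  have "K \<subset> ?H" using KH v(3) by (auto intro: generate.incl)
  then have "card K < card ?H" by (rule psubset_card_mono[OF finK(2)])
  then have m1: "m > 1" using m K0 by (cases "m = 0 \<or> m = 1") auto
  have "card K * m dvd card K * p ^ d"
    using card_subgroup_dvd_card[OF H subgroup_self Hc] m card by simp
  then have "m dvd p ^ d" using K0 by simp
  then obtain e where e: "m = p ^ e" using p by (metis divides_primepow_nat)
  have "m \<le> p" using le m K0 by (simp add: mult.commute)
  moreover have "p dvd m" using e m1 by (cases e) auto
  ultimately have "m = p" using m1 by (auto dest: dvd_imp_le)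
  then show ?thesis using m by simp
qed

text \<open>As \<open>P\<close> sees only the set of entries, the last entry can be treated as
  adjoined before the others; induction on \<open>N\<close> then amounts to enlarging a
  subgroup.\<close>

lemma card_tuples_Suc:
  assumes "finite A"
  shows "card {C\<in>PiE {..<Suc N} (\<lambda>_. A). P (C ` {..<Suc N})} =
    (\<Sum>v\<in>A. card {C\<in>PiE {..<N} (\<lambda>_. A). P (insert v (C ` {..<N}))})"
proof -
  have eq: "{C\<in>PiE {..<Suc N} (\<lambda>_. A). P (C ` {..<Suc N})} =
    (\<lambda>(v, C). C(N := v)) ` (SIGMA v:A. {C\<in>PiE {..<N} (\<lambda>_. A). P (insert v (C ` {..<N}))})"
    (is "?L = ?f ` ?R")
  proof
    have im: "(C(N := v)) ` {..<Suc N} = insert v (C ` {..<N})" for C :: "nat \<Rightarrow> 'a" and v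
      by (auto simp: lessThan_Suc)
    show "?f ` ?R \<subseteq> ?L"
    proof (intro image_subsetI, clarify)
      fix v C
      assume v: "v \<in> A" and C: "C \<in> PiE {..<N} (\<lambda>_. A)" and P: "P (insert v (C ` {..<N}))"
      have "C(N := v) \<in> PiE {..<Suc N} (\<lambda>_. A)"
        unfolding lessThan_Suc using v C by (rule PiE_fun_upd)
      then show "C(N := v) \<in> PiE {..<Suc N} (\<lambda>_. A) \<and> P ((C(N := v)) ` {..<Suc N})"
        using P by (simp only: im)
    qed
    show "?L \<subseteq> ?f ` ?R"
    proof
      fix C assume C: "C \<in> ?L"
      let ?C' = "C(N := undefined)"
      have C': "?C' \<in> PiE {..<N} (\<lambda>_. A)" using C by (auto simp: PiE_iff extensional_def)
      have "C = ?C'(N := C N)" by simp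
      moreover have "insert (C N) (?C' ` {..<N}) = C ` {..<Suc N}" by (auto simp: lessThan_Suc)
      ultimately have "(C N, ?C') \<in> ?R" "C = ?f (C N, ?C')" using C C' by (auto simp: PiE_iff)
      then show "C \<in> ?f ` ?R" by blast
    qed
  qed
  have "inj_on ?f (A \<times> PiE {..<N} (\<lambda>_. A))" using inj_combinator[of N "{..<N}" "\<lambda>_. A"] by simp
  then have "inj_on ?f ?R" by (rule inj_on_subset) auto
  then have "card ?L = card ?R" unfolding eq by (rule card_image)
  also have "\<dots> = (\<Sum>v\<in>A. card {C\<in>PiE {..<N} (\<lambda>_. A). P (insert v (C ` {..<N}))})"
    using assms by (intro card_SigmaI ballI finite_subset[OF _ finite_PiE[of "{..<N}" "\<lambda>_. A"]]) auto
  finally show ?thesis .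
qed

text \<open>The quotient by \<open>K\<close> is elementary abelian of rank \<open>d\<close>. In the
  induction on \<open>N\<close> with \<open>K\<close> varying, an entry in \<open>K\<close> changes
  nothing, while any other multiplies \<open>card K\<close> by \<open>p\<close> and lowers
  \<open>d\<close> by one. The two cases have the weights of \<open>gen_prob_Suc\<close>.\<close>

lemma (in comm_group) card_generating_tuples_over:
  assumes fin: "finite (carrier G)" and p: "prime p"
    and K: "subgroup K G" and pw: "\<And>x. x \<in> carrier G \<Longrightarrow> x [^] p \<in> K"
    and card: "card (carrier G) = card K * p ^ d"
  shows "real (card {C\<in>PiE {..<N} (\<lambda>_. carrier G). generate G (K \<union> C ` {..<N}) = carrier G})
    = real (card (carrier G)) ^ N * gen_prob p N d"
  using K pw card
proof (induction N arbitrary: K d)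
  case 0
  have "card (carrier G) > 0" using fin one_closed by (auto simp: card_gt_0_iff)
  have gK: "generate G K = K"
    using generate_subgroup_incl[OF subset_refl 0(1)] by (auto intro: generate.incl)
  have "K = carrier G \<longleftrightarrow> d = 0"
  proof
    assume "K = carrier G"
    then have "p ^ d = 1" using 0(3) \<open>card (carrier G) > 0\<close> by simp
    then show "d = 0" using prime_gt_1_nat[OF p] by simp
  next
    assume "d = 0"
    then show "K = carrier G" using 0(3) card_subset_eq[OF fin subgroup.subset[OF 0(1)]] by simp
  qed
  then show ?case by (simp add: gen_prob_0_left gK)
next
  case (Suc N)
  let ?n = "real (card (carrier G))"
  have p0: "p > 0" using p prime_gt_0_nat by simp
  have Kc: "K \<subseteq> carrier G" by (rule subgroup.subset[OF Suc.prems(1)])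
  have K0: "card K > 0" using subgroup.one_closed[OF Suc.prems(1)] finite_subset[OF Kc fin] by (auto simp: card_gt_0_iff)
  let ?H = "\<lambda>v. generate G (insert v K)"
  have H: "subgroup (?H v) G" if "v \<in> carrier G" for v
    by (rule generate_is_subgroup) (use that Kc in auto)
  have step: "generate G (K \<union> insert v S) = generate G (?H v \<union> S)" if "v \<in> carrier G" "S \<subseteq> carrier G" for v S
  proof
    have s: "subgroup (generate G (?H v \<union> S)) G" "subgroup (generate G (K \<union> insert v S)) G"
      by (rule generate_is_subgroup; use that Kc subgroup.subset[OF H[OF that(1)]] in auto)+
    show "generate G (K \<union> insert v S) \<subseteq> generate G (?H v \<union> S)"
      by (rule generate_subgroup_incl[OF _ s(1)]) (auto intro!: generate.incl)
    have "?H v \<subseteq> generate G (K \<union> insert v S)"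
      by (rule mono_generate) auto
    then show "generate G (?H v \<union> S) \<subseteq> generate G (K \<union> insert v S)"
      by (intro generate_subgroup_incl[OF _ s(2)]) (auto intro: generate.incl)
  qed
  have cnt: "real (card {C\<in>PiE {..<N} (\<lambda>_. carrier G). generate G (K \<union> insert v (C ` {..<N})) = carrier G})
     = (if v \<in> K then ?n ^ N * gen_prob p N d else ?n ^ N * gen_prob p N (d - 1))"
    if v: "v \<in> carrier G" for v
  proof -
    have "{C\<in>PiE {..<N} (\<lambda>_. carrier G). generate G (K \<union> insert v (C ` {..<N})) = carrier G} =
       {C\<in>PiE {..<N} (\<lambda>_. carrier G). generate G (?H v \<union> C ` {..<N}) = carrier G}"
      by (intro Collect_cong conj_cong refl) (subst step[OF v], auto)
    also have "real (card \<dots>) = (if v \<in> K then ?n ^ N * gen_prob p N d else ?n ^ N * gen_prob p N (d - 1))"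
    proof (cases "v \<in> K")
      case True
      then have "?H v = K"
        using generate_subgroup_incl[OF _ Suc.prems(1), of "insert v K"] by (auto intro: generate.incl)
      then show ?thesis using True Suc.IH[OF Suc.prems] by simp
    next
      case False
      have "d \<noteq> 0"
      proof
        assume "d = 0"
        then have "K = carrier G" using Suc.prems(3) card_subset_eq[OF fin Kc] by simp
        then show False using False v by simp
      qed
      have "card (?H v) = p * card K"
        by (rule card_generate_insert_prime[OF fin p Suc.prems(1) v Suc.prems(2)[OF v] False Suc.prems(3)])
      then have "card (carrier G) = card (?H v) * p ^ (d - 1)"
        using Suc.prems(3) \<open>d \<noteq> 0\<close> by (cases d) auto
      moreover have "x [^] p \<in> ?H v" if "x \<in> carrier G" for x
        using Suc.prems(2)[OF that] by (auto intro: generate.incl)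
      ultimately show ?thesis using False Suc.IH[OF H[OF v]] by simp
    qed
    finally show ?thesis .
  qed
  have "real (card {C\<in>PiE {..<Suc N} (\<lambda>_. carrier G). generate G (K \<union> C ` {..<Suc N}) = carrier G})
     = (\<Sum>v\<in>carrier G. if v \<in> K then ?n ^ N * gen_prob p N d else ?n ^ N * gen_prob p N (d - 1))"
    using cnt by (subst card_tuples_Suc[OF fin, of N "\<lambda>S. generate G (K \<union> S) = carrier G"]) simp
  also have "\<dots> = real (card K) * (?n ^ N * gen_prob p N d) + (?n - real (card K)) * (?n ^ N * gen_prob p N (d - 1))"
  proof -
    have "carrier G \<inter> {v. v \<in> K} = K" "carrier G \<inter> {v. v \<notin> K} = carrier G - K" using Kc by auto
    moreover have "real (card (carrier G - K)) = ?n - real (card K)"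
      using card_Diff_subset[OF finite_subset[OF Kc fin] Kc] card_mono[OF fin Kc] by simp
    ultimately show ?thesis using fin by (simp add: sum.If_cases Collect_neg_eq[symmetric] Int_def)
  qed
  also have "\<dots> = ?n ^ Suc N * gen_prob p (Suc N) d"
  proof (cases d)
    \<comment> \<open>Now \<open>K\<close> is the whole group, so the term with the truncated
      \<open>d - 1\<close> has weight 0.\<close>
    case 0
    then show ?thesis using Suc.prems(3) by simp
  next
    case (Suc e)
    define Q where "Q = real p ^ Suc e"
    have Q: "Q > 0" using p0 by (simp add: Q_def)
    have n: "?n = real (card K) * Q" using Suc.prems(3) by (simp add: Q_def Suc)
    have "?n * (gen_prob p N (Suc e) / Q + (1 - 1 / Q) * gen_prob p N e) =
        real (card K) * gen_prob p N (Suc e) + (?n - real (card K)) * gen_prob p N e"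
      unfolding n using Q by (simp add: field_simps)
    then have "?n ^ N * (real (card K) * gen_prob p N (Suc e) + (?n - real (card K)) * gen_prob p N e) =
        ?n ^ Suc N * (gen_prob p N (Suc e) / Q + (1 - 1 / Q) * gen_prob p N e)" by simp
    then show ?thesis
      unfolding Suc gen_prob_Suc[OF p0] Q_def by (simp add: algebra_simps)
  qed
  finally show ?case .
qed

lemma (in comm_group) subgroup_powers: "subgroup ((\<lambda>x. x [^] (m::nat)) ` carrier G) G"
proof -
  interpret h: group_hom G G "\<lambda>x. x [^] m"
    by (intro group_homI is_group homI) (simp_all add: nat_pow_distrib)
  show ?thesis by (rule h.img_is_subgroup)
qed

text \<open>Burnside's basis theorem for abelian \<open>p\<close>-groups. Every \<open>x\<close> is
  \<open>h \<otimes> z [^] p\<close> with \<open>h\<close> generated by \<open>S\<close>;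
  substituting the same form for \<open>z\<close> again and again gives
  \<open>h \<otimes> z [^] (p ^ m)\<close>, and the power is trivial at
  \<open>m = r\<close>.\<close>

lemma (in comm_group) burnside_basis:
  assumes ord: "order G = p ^ r" and fin: "finite (carrier G)" and S: "S \<subseteq> carrier G"
    and gen: "generate G ((\<lambda>x. x [^] p) ` carrier G \<union> S) = carrier G"
  shows "generate G S = carrier G"
proof
  let ?H = "generate G S" and ?P = "(\<lambda>x. x [^] p) ` carrier G"
  have H: "subgroup ?H G" by (rule generate_is_subgroup[OF S])
  have Hc: "?H \<subseteq> carrier G" by (rule subgroup.subset[OF H])
  show "?H \<subseteq> carrier G" by fact
  have "generate G (?P \<union> S) \<subseteq> ?H <#> ?P"
  proof (rule generate_subgroup_incl)
    show "subgroup (?H <#> ?P) G" by (rule mult_subgroups[OF H subgroup_powers])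
    have "\<one> \<otimes> x [^] p \<in> ?H <#> ?P" if "x \<in> carrier G" for x
      unfolding set_mult_def using that by (blast intro: generate.one)
    then have "x [^] p \<in> ?H <#> ?P" if "x \<in> carrier G" for x using that by fastforce
    moreover have "s \<otimes> \<one> \<in> ?H <#> ?P" if "s \<in> S" for s
      unfolding set_mult_def using that subgroup.one_closed[OF subgroup_powers[of p]] by (blast intro: generate.incl)
    then have "s \<in> ?H <#> ?P" if "s \<in> S" for s using that S by fastforce
    ultimately show "?P \<union> S \<subseteq> ?H <#> ?P" by blast
  qed
  then have "carrier G \<subseteq> ?H <#> ?P" by (simp only: gen)
  then have dec: "\<exists>h\<in>?H. \<exists>z\<in>carrier G. x = h \<otimes> z [^] p" if "x \<in> carrier G" for x
    using that unfolding set_mult_def by blast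
  have "\<exists>h\<in>?H. \<exists>z\<in>carrier G. x = h \<otimes> z [^] (p ^ m)" if x: "x \<in> carrier G" for x m
  proof (induction m)
    case 0
    then show ?case using x by (intro bexI[of _ \<one>] bexI[of _ x]) (auto intro: generate.one)
  next
    case (Suc m)
    then obtain h z where h: "h \<in> ?H" "z \<in> carrier G" "x = h \<otimes> z [^] (p ^ m)" by blast
    obtain h' z' where h': "h' \<in> ?H" "z' \<in> carrier G" "z = h' \<otimes> z' [^] p" using dec[OF h(2)] by blast
    have c: "h \<in> carrier G" "h' \<in> carrier G" using h h' Hc by auto
    have "x = (h \<otimes> h' [^] (p ^ m)) \<otimes> z' [^] (p ^ Suc m)"
      using h h' c by (simp add: nat_pow_distrib nat_pow_pow m_assoc)
    moreover have "h' [^] (p ^ m) \<in> ?H"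
      using subgroup_int_pow_closed[OF H h'(1), of "int (p ^ m)"] by (simp only: int_pow_int)
    then have "h \<otimes> h' [^] (p ^ m) \<in> ?H" using subgroup.m_closed[OF H h(1)] by blast
    ultimately show ?case using h'(2) by blast
  qed
  moreover have "z [^] (p ^ r) = \<one>" if "z \<in> carrier G" for z
    using pow_order_eq_1[OF that] ord by simp
  ultimately show "carrier G \<subseteq> ?H" using Hc by (metis r_one subsetD subsetI)
qed

text \<open>By \<open>burnside_basis\<close> it suffices to generate modulo the subgroup of
  \<open>p\<close>-th powers; \<open>d\<close> is the rank of the group.\<close>

lemma (in comm_group) card_generating_tuples:
  assumes fin: "finite (carrier G)" and p: "prime p" and ord: "order G = p ^ r"
    and card: "card (carrier G) = card ((\<lambda>x. x [^] p) ` carrier G) * p ^ d"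
  shows "real (card {C\<in>PiE {..<N} (\<lambda>_. carrier G). generate G (C ` {..<N}) = carrier G})
    = real (card (carrier G)) ^ N * gen_prob p N d"
proof -
  let ?P = "(\<lambda>x. x [^] p) ` carrier G"
  have "generate G (C ` {..<N}) = carrier G \<longleftrightarrow> generate G (?P \<union> C ` {..<N}) = carrier G"
    if C: "C \<in> PiE {..<N} (\<lambda>_. carrier G)" for C
  proof
    have Cc: "C ` {..<N} \<subseteq> carrier G" using C by auto
    show "generate G (C ` {..<N}) = carrier G" if "generate G (?P \<union> C ` {..<N}) = carrier G"
      by (rule burnside_basis[OF ord fin Cc that])
    assume g: "generate G (C ` {..<N}) = carrier G"
    have "generate G (C ` {..<N}) \<subseteq> generate G (?P \<union> C ` {..<N})" by (rule mono_generate) auto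
    moreover have "generate G (?P \<union> C ` {..<N}) \<subseteq> carrier G"
      by (rule generate_incl) (use Cc in auto)
    ultimately show "generate G (?P \<union> C ` {..<N}) = carrier G" using g by (simp only: subset_antisym)
  qed
  then have "{C\<in>PiE {..<N} (\<lambda>_. carrier G). generate G (C ` {..<N}) = carrier G} =
      {C\<in>PiE {..<N} (\<lambda>_. carrier G). generate G (?P \<union> C ` {..<N}) = carrier G}"
    by (intro Collect_cong conj_cong refl) simp
  then show ?thesis
    using card_generating_tuples_over[OF fin p subgroup_powers _ card] by simp
qed

section \<open>Replacing a column by a uniform one\<close>

lemma sum_PiE_insert:
  assumes "j \<notin> J" "finite J"
  shows "(\<Sum>C\<in>PiE (insert j J) (\<lambda>_. V). F C) = (\<Sum>C\<in>PiE J (\<lambda>_. V). \<Sum>v\<in>V. F (C(j := v)))"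
proof -
  have "(\<Sum>C\<in>PiE (insert j J) (\<lambda>_. V). F C) = (\<Sum>(v, C)\<in>V \<times> PiE J (\<lambda>_. V). F (C(j := v)))"
    unfolding PiE_insert_eq using inj_combinator[OF assms(1), of "\<lambda>_. V"]
    by (subst sum.reindex) (auto simp: case_prod_unfold)
  also have "\<dots> = (\<Sum>v\<in>V. \<Sum>C\<in>PiE J (\<lambda>_. V). F (C(j := v)))"
    by (rule sum.cartesian_product[symmetric])
  also have "\<dots> = (\<Sum>C\<in>PiE J (\<lambda>_. V). \<Sum>v\<in>V. F (C(j := v)))"
    by (rule sum.swap)
  finally show ?thesis .
qed

text \<open>Laws are indexed column first, \<open>M j i\<close>, because whole columns are replaced;
  the matrices in \<open>padic_cok\<close> are indexed row first.\<close>

definition mat_law :: "nat \<Rightarrow> nat set \<Rightarrow> (nat \<Rightarrow> nat \<Rightarrow> int \<Rightarrow> real) \<Rightarrow> (nat \<Rightarrow> nat \<Rightarrow> int) \<Rightarrow> real" where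
  "mat_law n J M C = (\<Prod>j\<in>J. col_law n (M j) (C j))"

text \<open>A finite sum instead of a measure, so that laws can be exchanged column by column;
  \<open>span_prob_eq_prob\<close> returns to probabilities. The property sees only the column span,
  which determines the quotient.\<close>

definition span_prob ::
  "nat \<Rightarrow> nat \<Rightarrow> ((nat \<Rightarrow> int) set \<Rightarrow> bool) \<Rightarrow> nat set \<Rightarrow> (nat \<Rightarrow> nat \<Rightarrow> int \<Rightarrow> real) \<Rightarrow> real" where
  "span_prob q n \<Phi> J M = (\<Sum>C\<in>PiE J (\<lambda>_. vecs q n).
     mat_law n J M C * of_bool (\<Phi> (generate (zmod_vec q n) (C ` J))))"

lemma sum_mat_law:
  assumes "finite J" "\<And>i j. i < n \<Longrightarrow> j \<in> J \<Longrightarrow> law q (M j i)"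
  shows "(\<Sum>C\<in>PiE J (\<lambda>_. vecs q n). mat_law n J M C) = 1"
  unfolding mat_law_def using assms
  by (subst prod_sum_PiE[symmetric]) (auto simp: finite_vecs sum_col_law)

lemma mat_law_nonneg:
  "(\<And>i j. i < n \<Longrightarrow> j \<in> J \<Longrightarrow> law q (M j i)) \<Longrightarrow> 0 \<le> mat_law n J M C"
  unfolding mat_law_def by (intro prod_nonneg) (use col_law_nonneg in blast)

text \<open>Conditions on the columns in \<open>J\<close>, leaving column \<open>j\<close> as the
  only random one.\<close>

lemma span_prob_insert:
  assumes "j \<notin> J" "finite J"
  shows "span_prob q n \<Phi> (insert j J) M = (\<Sum>C\<in>PiE J (\<lambda>_. vecs q n). mat_law n J M C *
     (\<Sum>v\<in>vecs q n. col_law n (M j) v * of_bool (\<Phi> (generate (zmod_vec q n) (insert v (C ` J))))))"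
proof -
  have "mat_law n (insert j J) M (C(j := v)) = mat_law n J M C * col_law n (M j) v" for C v
  proof -
    have "(\<Prod>i\<in>J. col_law n (M i) ((C(j := v)) i)) = (\<Prod>i\<in>J. col_law n (M i) (C i))"
      using assms by (intro prod.cong) auto
    then show ?thesis using assms by (simp add: mat_law_def)
  qed
  moreover have "(C(j := v)) ` insert j J = insert v (C ` J)" for C :: "nat \<Rightarrow> nat \<Rightarrow> int" and v
    using assms by auto
  ultimately show ?thesis
    unfolding span_prob_def by (subst sum_PiE_insert[OF assms]) (simp add: sum_distrib_left mult.assoc)
qed

lemma card_generate_insert_le:
  assumes "q > 0" "v \<in> vecs q n" "S \<subseteq> vecs q n"
  shows "card (generate (zmod_vec q n) (insert v S)) \<le> q * card (generate (zmod_vec q n) S)"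
proof -
  let ?G = "zmod_vec q n"
  interpret comm_group ?G by (rule comm_group_zmod_vec)
  note car = carrier_zmod_vec[OF assms(1), of n]
  let ?L = "generate ?G S"
  have vc: "v \<in> carrier ?G" and Sc: "S \<subseteq> carrier ?G" using assms car by auto
  have sL: "subgroup ?L ?G" by (rule generate_is_subgroup[OF Sc])
  have finL: "finite ?L" using subgroup.subset[OF sL] car finite_vecs by (metis finite_subset)
  have "v [^]\<^bsub>?G\<^esub> q = \<one>\<^bsub>?G\<^esub>" unfolding zmod_vec_pow[OF vc] by (simp add: zmod_vec_def)
  then have vq: "v [^]\<^bsub>?G\<^esub> q \<in> ?L" by (simp add: generate.one)
  have "generate ?G (insert v S) \<subseteq> generate ?G (insert v ?L)"
    by (rule mono_generate) (auto intro: generate.incl)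
  also have "\<dots> \<subseteq> (\<lambda>(c, x). v [^]\<^bsub>?G\<^esub> c \<otimes>\<^bsub>?G\<^esub> x) ` ({..<q} \<times> ?L)"
    by (rule cosets_by_powers[OF sL vc vq assms(1)])
  finally have "card (generate ?G (insert v S)) \<le>
      card ((\<lambda>(c, x). v [^]\<^bsub>?G\<^esub> c \<otimes>\<^bsub>?G\<^esub> x) ` ({..<q} \<times> ?L))"
    by (rule card_mono[rotated]) (use finL in auto)
  also have "\<dots> \<le> card ({..<q} \<times> ?L)" by (rule card_image_le) (use finL in auto)
  finally show ?thesis by (simp add: card_cartesian_product)
qed

context char_bounded
begin

text \<open>All coordinates of \<open>y\<close> may be divisible by \<open>p\<close>, so reducing
  \<open>y\<close> itself could give zero. Divide by the largest \<open>p ^ a\<close> that divides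
  every coordinate, where \<open>a < k\<close> because \<open>y\<close> is nonzero, and reduce
  afterwards. As \<open>p ^ Suc a\<close> divides \<open>q\<close>, orthogonality to
  \<open>y\<close> modulo \<open>q\<close> leaves orthogonality to \<open>w\<close> modulo
  \<open>p\<close>.\<close>

lemma reduce_mod_p:
  assumes y: "y \<in> vecs q n" "y \<noteq> (\<lambda>i\<in>{..<n}. 0)"
  obtains w where "w \<in> vecs p n" "\<exists>i<n. w i \<noteq> 0"
    "\<And>i. i < n \<Longrightarrow> w i \<noteq> 0 \<Longrightarrow> \<not> int q dvd y i"
    "\<And>v. int q dvd dot n y v \<Longrightarrow> int p dvd dot n w v"
proof -
  define P where "P a \<longleftrightarrow> (\<forall>i<n. int p ^ a dvd y i)" for a
  have "P 0" by (simp add: P_def)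
  have "\<not> P k"
  proof
    assume "P k"
    have "y i = 0" if "i < n" for i
    proof -
      have "int q dvd y i" using \<open>P k\<close> that by (simp add: P_def q)
      moreover have "0 \<le> y i" "y i < int q" using y(1) that by (auto simp: PiE_iff)
      ultimately show ?thesis using zdvd_not_zless[of "y i" "int q"] by linarith
    qed
    then have "y = (\<lambda>i\<in>{..<n}. 0)" using y(1) by (intro PiE_ext[OF y(1)]) (auto simp: q_pos)
    then show False using y(2) by simp
  qed
  obtain a where a: "a < k" "P a" "\<not> P (Suc a)"
  proof (rule ccontr)
    assume "\<not> thesis"
    then have step: "a < k \<Longrightarrow> P a \<Longrightarrow> P (Suc a)" for a using that by blast
    have "P m" if "m \<le> k" for m
      using that by (induction m) (use \<open>P 0\<close> step in auto)
    then show False using \<open>\<not> P k\<close> by blast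
  qed
  define y' where "y' i = y i div int p ^ a" for i
  have y': "y i = int p ^ a * y' i" if "i < n" for i
    using a(2) that by (simp add: P_def y'_def)
  define w where "w = (\<lambda>i\<in>{..<n}. y' i mod int p)"
  have pp: "int p ^ a > 0" using p_pos by simp
  show ?thesis
  proof (rule that[of w])
    show "w \<in> vecs p n" using p_pos by (auto simp: w_def)
    obtain i where i: "i < n" "\<not> int p ^ Suc a dvd y i" using a(3) by (auto simp: P_def)
    then have "\<not> int p dvd y' i" using pp by (simp add: y' mult.commute)
    then show "\<exists>i<n. w i \<noteq> 0" using i(1) by (auto simp: w_def dvd_eq_mod_eq_0)
  next
    fix i assume i: "i < n" "w i \<noteq> 0"
    show "\<not> int q dvd y i"
    proof
      assume "int q dvd y i"
      moreover have "int p ^ Suc a dvd int q" unfolding q of_nat_power using a(1) by (intro le_imp_power_dvd) auto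
      ultimately have "int p ^ Suc a dvd int p ^ a * y' i" using y'[OF i(1)] by (metis dvd_trans)
      then have "int p dvd y' i" using p_pos by (auto simp: mult.commute)
      then show False using i by (simp add: w_def dvd_eq_mod_eq_0)
    qed
  next
    fix v assume v: "int q dvd dot n y v"
    have "dot n y v = int p ^ a * dot n y' v"
      unfolding dot_def sum_distrib_left by (intro sum.cong) (auto simp: y')
    moreover have "int p ^ Suc a dvd int q" unfolding q of_nat_power using a(1) by (intro le_imp_power_dvd) auto
    ultimately have "int p ^ Suc a dvd int p ^ a * dot n y' v" using v by (metis dvd_trans)
    then have "int p dvd dot n y' v" using p_pos by (auto simp: mult.commute)
    moreover have "[dot n w v = dot n y' v] (mod int p)"
      unfolding dot_def by (intro cong_sum cong_mult) (auto simp: w_def cong_def)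
    ultimately show "int p dvd dot n w v" using cong_dvd_iff by blast
  qed
qed

text \<open>A union bound over the thin \<open>w\<close>; for a single \<open>w\<close>,
  independence of the columns gives the product of the bounds from \<open>col_kernel_bound\<close>.
  In its use \<open>D0\<close> belongs to the column being replaced, which lies outside
  \<open>J\<close>.\<close>

lemma thin_kernel_prob:
  assumes J: "finite J" and M: "\<And>i j. i < n \<Longrightarrow> j \<in> J \<Longrightarrow> law q (M j i)"
    and small: "\<And>i j. i < n \<Longrightarrow> j \<in> J \<Longrightarrow> i \<notin> D j \<Longrightarrow> char_small q \<rho> (M j i)"
  shows "(\<Sum>C\<in>PiE J (\<lambda>_. vecs q n). mat_law n J M C *
      of_bool (\<exists>w\<in>thin_vecs p n t D0. \<forall>j\<in>J. int p dvd dot n w (C j))) \<le> thin_bound p \<rho> n t J D D0"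
proof -
  let ?W = "thin_vecs p n t D0" and ?X = "PiE J (\<lambda>_. vecs q n)"
  let ?o = "\<lambda>w C. \<forall>j\<in>J. int p dvd dot n w (C j)"
  have fin: "finite (?W)" by (auto simp: thin_vecs_def finite_vecs)
  have "(\<Sum>C\<in>?X. mat_law n J M C *
      of_bool (\<exists>w\<in>?W. ?o w C))
    \<le> (\<Sum>C\<in>?X. mat_law n J M C *
      (\<Sum>w\<in>?W. of_bool (?o w C)))"
  proof (intro sum_mono mult_left_mono mat_law_nonneg[where q = q] M)
    fix C :: "nat \<Rightarrow> nat \<Rightarrow> int"
    show "of_bool (\<exists>w\<in>?W. ?o w C)
      \<le> (\<Sum>w\<in>?W. of_bool (?o w C) :: real)"
    proof (cases "\<exists>w\<in>?W. ?o w C")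
      case True
      then obtain w where w: "w \<in> ?W" "?o w C" by blast
      have "(of_bool (?o w C) :: real)
         \<le> (\<Sum>w\<in>?W. of_bool (?o w C))"
        using w fin by (intro member_le_sum) auto
      then show ?thesis using w by auto
    qed (auto intro: sum_nonneg)
  qed auto
  also have "\<dots> = (\<Sum>w\<in>?W. \<Sum>C\<in>?X. mat_law n J M C *
      of_bool (?o w C))"
    unfolding sum_distrib_left by (rule sum.swap)
  also have "\<dots> \<le> thin_bound p \<rho> n t J D D0"
    unfolding thin_bound_def
  proof (rule sum_mono)
    fix w assume w: "w \<in> ?W"
    have wp: "int p dvd w i \<longleftrightarrow> w i = 0" if "i < n" for i
    proof -
      have "0 \<le> w i" "w i < int p" using w that by (auto simp: thin_vecs_def PiE_iff)
      then show ?thesis using zdvd_not_zless[of "w i" "int p"] by force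
    qed
    have "(\<Sum>C\<in>?X. mat_law n J M C * of_bool (?o w C))
      = (\<Sum>C\<in>?X. \<Prod>j\<in>J. col_law n (M j) (C j) * of_bool (int p dvd dot n w (C j)))"
    proof (rule sum.cong[OF refl])
      fix C :: "nat \<Rightarrow> nat \<Rightarrow> int"
      have "of_bool (?o w C) = (\<Prod>j\<in>J. of_bool (int p dvd dot n w (C j)) :: real)"
        using J by (induction J rule: finite_induct) auto
      then show "mat_law n J M C * of_bool (?o w C) =
         (\<Prod>j\<in>J. col_law n (M j) (C j) * of_bool (int p dvd dot n w (C j)))"
        by (simp add: mat_law_def prod.distrib)
    qed
    also have "\<dots> = (\<Prod>j\<in>J. \<Sum>v\<in>vecs q n. col_law n (M j) v * of_bool (int p dvd dot n w v))"
      using J by (intro prod_sum_PiE[symmetric] finite_vecs)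
    also have "\<dots> = (\<Prod>j\<in>J. \<Sum>v\<in>{v\<in>vecs q n. int p dvd dot n w v}. col_law n (M j) v)"
      by (subst sum.inter_filter[OF finite_vecs]) (simp add: of_bool_def if_distrib cong: if_cong)
    also have "\<dots> \<le> (\<Prod>j\<in>J. 1 / p + (1 - 1 / p) * \<rho> ^ supp_off n (D j) w)"
    proof (intro prod_mono conjI sum_nonneg col_law_nonneg)
      fix j assume j: "j \<in> J"
      have "{i\<in>{..<n} - D j. \<not> int p dvd w i} = {i\<in>{..<n} - D j. w i \<noteq> 0}" using wp by auto
      then show "(\<Sum>v\<in>{v\<in>vecs q n. int p dvd dot n w v}. col_law n (M j) v)
          \<le> 1 / p + (1 - 1 / p) * \<rho> ^ supp_off n (D j) w"
        using col_kernel_bound[of n "M j" "D j" w] M[OF _ j] small[OF _ j] by (simp add: supp_off_def)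
    qed (use M in auto)
    finally show "(\<Sum>C\<in>?X. mat_law n J M C * of_bool (?o w C))
       \<le> (\<Prod>j\<in>J. 1 / p + (1 - 1 / p) * \<rho> ^ supp_off n (D j) w)" .
  qed
  finally show ?thesis .
qed

text \<open>If no \<open>v\<close> satisfies \<open>\<Phi>\<close>, both averages vanish. Otherwise
  the span of \<open>S\<close> has index at most \<open>q * b\<close>, so few characters are trivial
  on it. Each nontrivial one among them reduces to a \<open>w\<close> orthogonal to
  \<open>S\<close>; not being thin, \<open>w\<close> meets at least \<open>t\<close> balanced
  entries of the column.\<close>

lemma column_average_bound:
  assumes M: "\<And>i. i < n \<Longrightarrow> law q (m i)"
    and small: "\<And>i. i < n \<Longrightarrow> i \<notin> D0 \<Longrightarrow> char_small q \<rho> (m i)"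
    and S: "S \<subseteq> vecs q n"
    and index: "\<And>L. \<Phi> L \<Longrightarrow> card L * b = q ^ n"
    and thick: "\<not> (\<exists>w\<in>thin_vecs p n t D0. \<forall>s\<in>S. int p dvd dot n w s)"
  shows "\<bar>(\<Sum>v\<in>vecs q n. col_law n m v * of_bool (\<Phi> (generate (zmod_vec q n) (insert v S)))) -
     (\<Sum>v\<in>vecs q n. of_bool (\<Phi> (generate (zmod_vec q n) (insert v S)))) / q ^ n\<bar>
     \<le> q * b * \<rho> powr t" (is "\<bar>?E - ?A / _\<bar> \<le> _")
proof (cases "\<exists>v\<in>vecs q n. \<Phi> (generate (zmod_vec q n) (insert v S))")
  case False
  then have "?E = 0"
    "(\<Sum>v\<in>vecs q n. of_bool (\<Phi> (generate (zmod_vec q n) (insert v S))) :: real) = 0"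
    by (auto intro!: sum.neutral)
  then show ?thesis by simp
next
  case True
  let ?G = "zmod_vec q n"
  interpret comm_group ?G by (rule comm_group_zmod_vec)
  note car = carrier_zmod_vec[OF q_pos, of n]
  let ?L = "generate ?G S"
  have Sc: "S \<subseteq> carrier ?G" using S car by simp
  have sL: "subgroup ?L ?G" by (rule generate_is_subgroup[OF Sc])
  obtain v0 where v0: "v0 \<in> vecs q n" "\<Phi> (generate ?G (insert v0 S))" using True by blast
  \<comment> \<open>One more column enlarges a span at most \<open>q\<close> times, so the index of
    \<open>?L\<close> is at most \<open>q\<close> times the index \<open>b\<close> reached with
    \<open>v0\<close>.\<close>
  have "card (perp q n ?L) * card ?L = card (generate ?G (insert v0 S)) * b"
    using card_perp[OF q_pos sL] index[OF v0(2)] by simp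
  also have "\<dots> \<le> q * card ?L * b"
    by (intro mult_right_mono card_generate_insert_le q_pos v0 S) auto
  finally have "card (perp q n ?L) * card ?L \<le> (q * b) * card ?L" by (simp add: mult_ac)
  moreover have "card ?L > 0"
    using subgroup.one_closed[OF sL] subgroup.subset[OF sL] car finite_vecs
    by (metis card_gt_0_iff empty_iff finite_subset)
  ultimately have card_perp_le: "card (perp q n ?L) \<le> q * b" by simp
  have shift: "generate ?G (insert (v \<otimes>\<^bsub>?G\<^esub> l) S) = generate ?G (insert v S)"
    if v: "v \<in> vecs q n" "l \<in> ?L" for v l
  proof
    have vc: "v \<in> carrier ?G" using v car by simp
    have lc: "l \<in> carrier ?G" using v subgroup.subset[OF sL] by auto
    have l1: "l \<in> generate ?G (insert x S)" for x using v mono_generate[of S "insert x S"] by auto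
    have vl: "v \<otimes>\<^bsub>?G\<^esub> l \<in> carrier ?G" using vc lc by simp
    have s1: "subgroup (generate ?G (insert v S)) ?G"
      by (rule generate_is_subgroup) (use vc Sc in auto)
    have s2: "subgroup (generate ?G (insert (v \<otimes>\<^bsub>?G\<^esub> l) S)) ?G"
      by (rule generate_is_subgroup) (use vl Sc in auto)
    show "generate ?G (insert (v \<otimes>\<^bsub>?G\<^esub> l) S) \<subseteq> generate ?G (insert v S)"
      by (rule generate_subgroup_incl[OF _ s1])
        (auto intro: generate.incl intro!: subgroup.m_closed[OF s1] l1)
    have "(v \<otimes>\<^bsub>?G\<^esub> l) \<otimes>\<^bsub>?G\<^esub> inv\<^bsub>?G\<^esub> l \<in> generate ?G (insert (v \<otimes>\<^bsub>?G\<^esub> l) S)"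
      by (rule subgroup.m_closed[OF s2 generate.incl subgroup.m_inv_closed[OF s2 l1]]) simp
    then have vin: "v \<in> generate ?G (insert (v \<otimes>\<^bsub>?G\<^esub> l) S)" using vc lc by (simp add: m_assoc)
    show "generate ?G (insert v S) \<subseteq> generate ?G (insert (v \<otimes>\<^bsub>?G\<^esub> l) S)"
    proof (rule generate_subgroup_incl[OF _ s2])
      show "insert v S \<subseteq> generate ?G (insert (v \<otimes>\<^bsub>?G\<^esub> l) S)"
        using vin by (simp add: subset_iff generate.incl)
    qed
  qed
  have "\<bar>?E -
     ?A / q ^ n\<bar>
     \<le> card (perp q n ?L) * \<rho> powr t"
    unfolding of_nat_power
  proof (rule invariant_expectation_bound[OF q_pos sL])
    fix y assume y: "y \<in> perp q n ?L" "y \<noteq> (\<lambda>i\<in>{..<n}. 0)"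
    then have "y \<in> vecs q n" by (simp add: perp_def)
    then obtain w where w: "w \<in> vecs p n" "\<exists>i<n. w i \<noteq> 0"
      "\<And>i. i < n \<Longrightarrow> w i \<noteq> 0 \<Longrightarrow> \<not> int q dvd y i"
      "\<And>v. int q dvd dot n y v \<Longrightarrow> int p dvd dot n w v"
      using reduce_mod_p y(2) by metis
    have "int q dvd dot n y s" if "s \<in> S" for s
      using y(1) that by (auto simp: perp_def intro: generate.incl)
    then have "\<forall>s\<in>S. int p dvd dot n w s" using w(4) by blast
    then have ge: "t \<le> real (supp_off n D0 w)" using thick w(1,2) unfolding thin_vecs_def by (metis (mono_tags, lifting) mem_Collect_eq not_le)
    have "norm (\<Sum>v\<in>vecs q n. of_real (col_law n m v) * add_char q (dot n y v))
       \<le> \<rho> ^ card {i\<in>{..<n} - D0. \<not> int q dvd y i}"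
      by (rule col_char_bound[OF M small])
    also have "\<dots> \<le> \<rho> ^ supp_off n D0 w"
      unfolding supp_off_def using \<rho> w by (intro power_decreasing card_mono) auto
    also have "\<dots> = \<rho> powr real (supp_off n D0 w)" using \<rho> by (simp add: powr_realpow)
    also have "\<dots> \<le> \<rho> powr t" using \<rho> ge by (intro powr_mono') auto
    finally show "norm (\<Sum>v\<in>vecs q n. of_real (col_law n m v) * add_char q (dot n y v)) \<le> \<rho> powr t" .
  next
    show "(\<Sum>v\<in>vecs q n. col_law n m v) = 1" using M by (rule sum_col_law)
  qed (simp_all add: shift)
  also have "\<dots> \<le> real (q * b) * \<rho> powr t"
    using card_perp_le by (intro mult_right_mono) (simp_all del: of_nat_mult)
  finally show ?thesis by simp
qed

text \<open>When some thin vector is orthogonal to the other columns, the two conditional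
  probabilities differ by at most 1, and this event is paid for by \<open>thin_bound\<close>;
  otherwise \<open>column_average_bound\<close> applies.\<close>

lemma swap_column:
  assumes J: "finite J" "j0 \<notin> J"
    and M: "\<And>i j. i < n \<Longrightarrow> j \<in> insert j0 J \<Longrightarrow> law q (M j i)"
    and small: "\<And>i j. i < n \<Longrightarrow> j \<in> insert j0 J \<Longrightarrow> i \<notin> D j \<Longrightarrow> char_small q \<rho> (M j i)"
    and index: "\<And>L. \<Phi> L \<Longrightarrow> card L * b = q ^ n"
  shows "\<bar>span_prob q n \<Phi> (insert j0 J) M - span_prob q n \<Phi> (insert j0 J) (M(j0 := \<lambda>_. uniform_law q))\<bar>
     \<le> thin_bound p \<rho> n t J D (D j0) + q * b * \<rho> powr t"
proof -
  let ?V = "vecs q n" and ?M' = "M(j0 := \<lambda>_. uniform_law q)"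
  let ?g = "\<lambda>C v. of_bool (\<Phi> (generate (zmod_vec q n) (insert v (C ` J)))) :: real"
  let ?bad = "\<lambda>C. \<exists>w\<in>thin_vecs p n t (D j0). \<forall>j\<in>J. int p dvd dot n w (C j)"
  have W': "mat_law n J ?M' C = mat_law n J M C" for C
    unfolding mat_law_def using J by (intro prod.cong) auto
  have U: "(\<Sum>v\<in>?V. col_law n (\<lambda>_. uniform_law q) v * ?g C v) = (\<Sum>v\<in>?V. ?g C v) / q ^ n" for C
    by (simp add: col_law_def uniform_law_def power_one_over sum_divide_distrib)
  have W0: "0 \<le> mat_law n J M C" for C using M by (intro mat_law_nonneg[where q = q]) auto
  have eq: "span_prob q n \<Phi> (insert j0 J) M - span_prob q n \<Phi> (insert j0 J) ?M' =
     (\<Sum>C\<in>PiE J (\<lambda>_. ?V). mat_law n J M C *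
        ((\<Sum>v\<in>?V. col_law n (M j0) v * ?g C v) - (\<Sum>v\<in>?V. ?g C v) / q ^ n))"
    by (simp add: span_prob_insert J W' U sum_subtractf[symmetric] right_diff_distrib)
  have "\<bar>span_prob q n \<Phi> (insert j0 J) M - span_prob q n \<Phi> (insert j0 J) ?M'\<bar>
     \<le> (\<Sum>C\<in>PiE J (\<lambda>_. ?V). mat_law n J M C * (of_bool (?bad C) + q * b * \<rho> powr t))"
    unfolding eq
  proof (rule order_trans[OF sum_abs], rule sum_mono)
    fix C assume C: "C \<in> PiE J (\<lambda>_. ?V)"
    have "\<bar>(\<Sum>v\<in>?V. col_law n (M j0) v * ?g C v) - (\<Sum>v\<in>?V. ?g C v) / q ^ n\<bar>
       \<le> of_bool (?bad C) + q * b * \<rho> powr t"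
    proof (cases "?bad C")
      case True
      have n0: "0 \<le> col_law n (M j0) v" for v using M by (intro col_law_nonneg[where q = q]) auto
      have "(\<Sum>v\<in>?V. col_law n (M j0) v * ?g C v) \<le> (\<Sum>v\<in>?V. col_law n (M j0) v * 1)"
        by (intro sum_mono mult_left_mono n0) auto
      also have "\<dots> = 1" using sum_col_law[of n q "M j0"] M by simp
      finally have a1: "(\<Sum>v\<in>?V. col_law n (M j0) v * ?g C v) \<le> 1" .
      have a0: "0 \<le> (\<Sum>v\<in>?V. col_law n (M j0) v * ?g C v)" by (intro sum_nonneg mult_nonneg_nonneg n0) auto
      have "(\<Sum>v\<in>?V. ?g C v) \<le> (\<Sum>v\<in>?V. 1)" by (intro sum_mono) auto
      then have b1: "(\<Sum>v\<in>?V. ?g C v) / q ^ n \<le> 1" using q_pos by (simp add: card_vecs)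
      have b0: "0 \<le> (\<Sum>v\<in>?V. ?g C v) / q ^ n" by (intro divide_nonneg_nonneg sum_nonneg) auto
      have "\<bar>(\<Sum>v\<in>?V. col_law n (M j0) v * ?g C v) - (\<Sum>v\<in>?V. ?g C v) / q ^ n\<bar> \<le> 1"
        using a0 a1 b0 b1 unfolding abs_le_iff by linarith
      also have "1 \<le> of_bool (?bad C) + q * b * \<rho> powr t" using True by simp
      finally show ?thesis .
    next
      case False
      have "\<bar>(\<Sum>v\<in>?V. col_law n (M j0) v * ?g C v) - (\<Sum>v\<in>?V. ?g C v) / q ^ n\<bar> \<le> q * b * \<rho> powr t"
      proof (rule column_average_bound[where ?D0.0 = "D j0"])
        show "C ` J \<subseteq> ?V" by (intro image_subsetI) (rule PiE_mem[OF C])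
        show "\<not> (\<exists>w\<in>thin_vecs p n t (D j0). \<forall>s\<in>C ` J. int p dvd dot n w s)" using False by simp
        show "card L * b = q ^ n" if "\<Phi> L" for L using index that by blast
      qed (use M small in auto)
      then show ?thesis using False by simp
    qed
    then show "\<bar>mat_law n J M C * ((\<Sum>v\<in>?V. col_law n (M j0) v * ?g C v) - (\<Sum>v\<in>?V. ?g C v) / q ^ n)\<bar>
      \<le> mat_law n J M C * (of_bool (?bad C) + q * b * \<rho> powr t)"
      by (simp add: abs_mult W0 mult_left_mono)
  qed
  also have "\<dots> = (\<Sum>C\<in>PiE J (\<lambda>_. ?V). mat_law n J M C * of_bool (?bad C)) +
      (\<Sum>C\<in>PiE J (\<lambda>_. ?V). mat_law n J M C) * (q * b * \<rho> powr t)"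
    by (simp add: distrib_left sum.distrib sum_distrib_right)
  also have "(\<Sum>C\<in>PiE J (\<lambda>_. ?V). mat_law n J M C) = 1"
    using M J by (intro sum_mat_law) auto
  also have "(\<Sum>C\<in>PiE J (\<lambda>_. ?V). mat_law n J M C * of_bool (?bad C)) \<le> thin_bound p \<rho> n t J D (D j0)"
    using M J small by (intro thin_kernel_prob) auto
  finally show ?thesis by (simp only: mult_1_left)
qed

end

section \<open>Reduction of \<open>p\<close>-adic cokernels modulo \<open>p ^ Suc r\<close>\<close>

lemma padic_carrier:
  "x \<in> carrier (padic_int p) \<longleftrightarrow>
     (\<forall>k. 0 \<le> x k \<and> x k < int p ^ k \<and> [x (Suc k) = x k] (mod int p ^ k))"
  by (auto simp: padic_int_def padic_int_set_def)

lemma padic_simps [simp]: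
  "x \<oplus>\<^bsub>padic_int p\<^esub> y = (\<lambda>k. (x k + y k) mod int p ^ k)"
  "x \<otimes>\<^bsub>padic_int p\<^esub> y = (\<lambda>k. (x k * y k) mod int p ^ k)"
  "\<zero>\<^bsub>padic_int p\<^esub> = (\<lambda>k. 0)"
  "\<one>\<^bsub>padic_int p\<^esub> = (\<lambda>k. 1 mod int p ^ k)"
  by (simp_all add: padic_int_def)

lemma padic_coherent:
  assumes "x \<in> carrier (padic_int p)" "k \<le> l"
  shows "[x l = x k] (mod int p ^ k)"
  using assms(2)
proof (induction l rule: dec_induct)
  case (step l)
  have "[x (Suc l) = x l] (mod int p ^ l)" using assms(1) by (simp add: padic_carrier)
  then have "[x (Suc l) = x l] (mod int p ^ k)"
    using step.hyps by (meson cong_dvd_modulus le_imp_power_dvd)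
  then show ?case using step.IH cong_trans by blast
qed simp

lemma padic_coherent_mod:
  assumes "x \<in> carrier (padic_int p)" "k \<le> l"
  shows "x l mod int p ^ k = x k"
  using padic_coherent[OF assms] assms(1) by (simp add: padic_carrier cong_def)

text \<open>Reduces closure of the ring operations, and of the series in
  \<open>mat_image_nakayama\<close>, to congruences between integers.\<close>

lemma padic_carrier_modI:
  assumes "p > 0" "\<And>k. [f (Suc k) = f k] (mod int p ^ k)"
  shows "(\<lambda>k. f k mod int p ^ k) \<in> carrier (padic_int p)"
proof -
  have "[f (Suc k) mod int p ^ Suc k = f k mod int p ^ k] (mod int p ^ k)" for k
  proof -
    have "[f (Suc k) mod int p ^ Suc k = f (Suc k)] (mod int p ^ k)"
      by (rule cong_dvd_modulus[of _ _ "int p ^ Suc k"]) (auto simp: cong_def)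
    then show ?thesis using assms(2)[of k] by (simp add: cong_def)
  qed
  then show ?thesis using assms(1) by (simp add: padic_carrier)
qed

lemma padic_Suc_cong: "x \<in> carrier (padic_int p) \<Longrightarrow> [x (Suc k) = x k] (mod int p ^ k)"
  by (simp add: padic_carrier)

lemma padic_mod_self: "x \<in> carrier (padic_int p) \<Longrightarrow> x k mod int p ^ k = x k"
  by (simp add: padic_carrier)

lemma abelian_group_padic:
  assumes "p > 0" shows "abelian_group (padic_int p)"
proof (rule abelian_groupI)
  fix x y assume xy: "x \<in> carrier (padic_int p)" "y \<in> carrier (padic_int p)"
  show "x \<oplus>\<^bsub>padic_int p\<^esub> y \<in> carrier (padic_int p)"
    unfolding padic_simps using xy by (intro padic_carrier_modI assms cong_add padic_Suc_cong)
  show "x \<oplus>\<^bsub>padic_int p\<^esub> y = y \<oplus>\<^bsub>padic_int p\<^esub> x" by (simp add: add.commute)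
next
  fix x assume x: "x \<in> carrier (padic_int p)"
  have "(\<lambda>k. (- x k) mod int p ^ k) \<in> carrier (padic_int p)"
    using x by (intro padic_carrier_modI assms) (simp add: cong_minus_minus_iff padic_Suc_cong)
  moreover have "(\<lambda>k. (- x k) mod int p ^ k) \<oplus>\<^bsub>padic_int p\<^esub> x = \<zero>\<^bsub>padic_int p\<^esub>"
    by (simp add: mod_simps)
  ultimately show "\<exists>y\<in>carrier (padic_int p). y \<oplus>\<^bsub>padic_int p\<^esub> x = \<zero>\<^bsub>padic_int p\<^esub>" by blast
  show "\<zero>\<^bsub>padic_int p\<^esub> \<oplus>\<^bsub>padic_int p\<^esub> x = x" using x by (simp add: padic_mod_self)
next
  show "\<zero>\<^bsub>padic_int p\<^esub> \<in> carrier (padic_int p)" using assms by (simp add: padic_carrier)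
qed (simp add: mod_simps add.assoc)

lemma padic_mult_closed:
  assumes "p > 0" "x \<in> carrier (padic_int p)" "y \<in> carrier (padic_int p)"
  shows "x \<otimes>\<^bsub>padic_int p\<^esub> y \<in> carrier (padic_int p)"
  unfolding padic_simps using assms by (intro padic_carrier_modI cong_mult padic_Suc_cong)

lemma padic_one_closed: "p > 0 \<Longrightarrow> \<one>\<^bsub>padic_int p\<^esub> \<in> carrier (padic_int p)"
  unfolding padic_simps by (intro padic_carrier_modI) auto

lemma padic_finsum:
  assumes "p > 0" "finite J" "\<And>j. j \<in> J \<Longrightarrow> f j \<in> carrier (padic_int p)"
  shows "(\<Oplus>\<^bsub>padic_int p\<^esub>j\<in>J. f j) = (\<lambda>k. (\<Sum>j\<in>J. f j k) mod int p ^ k)"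
proof -
  interpret abelian_group "padic_int p" by (rule abelian_group_padic[OF assms(1)])
  show ?thesis using assms(2,3)
  proof (induction J rule: finite_induct)
    case empty
    then show ?case by simp
  next
    case (insert j J)
    then have "f \<in> J \<rightarrow> carrier (padic_int p)" "f j \<in> carrier (padic_int p)" by auto
    then have "(\<Oplus>\<^bsub>padic_int p\<^esub>i\<in>insert j J. f i) = f j \<oplus>\<^bsub>padic_int p\<^esub> (\<Oplus>\<^bsub>padic_int p\<^esub>i\<in>J. f i)"
      using insert.hyps by (simp del: padic_simps)
    also have "(\<Oplus>\<^bsub>padic_int p\<^esub>i\<in>J. f i) = (\<lambda>k. (\<Sum>j\<in>J. f j k) mod int p ^ k)"
      using insert by simp
    finally show ?case using insert.hyps by (simp add: mod_simps)
  qed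
qed

lemma carrier_padic_vec: "carrier (padic_vec p n) = PiE {..<n} (\<lambda>_. carrier (padic_int p))"
  by (simp add: padic_vec_def)

lemma mult_padic_vec: "x \<otimes>\<^bsub>padic_vec p n\<^esub> y = (\<lambda>i\<in>{..<n}. \<lambda>k. (x i k + y i k) mod int p ^ k)"
  by (simp add: padic_vec_def)

lemma comm_group_padic_vec:
  assumes "p > 0" shows "comm_group (padic_vec p n)"
proof -
  interpret abelian_group "padic_int p" by (rule abelian_group_padic[OF assms])
  have g: "group (padic_vec p n)"
    unfolding padic_vec_def by (rule product_group) (rule a_group)
  show ?thesis
    by (rule group.group_comm_groupI[OF g]) (simp add: mult_padic_vec add.commute)
qed

lemma padic_mat_vec_nth:
  assumes "p > 0" "\<And>i j. i < n \<Longrightarrow> j < m \<Longrightarrow> R i j \<in> carrier (padic_int p)"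
    "v \<in> carrier (padic_vec p m)"
  shows "padic_mat_vec p n m R v = (\<lambda>i\<in>{..<n}. \<lambda>k. (\<Sum>j<m. R i j k * v j k) mod int p ^ k)"
  unfolding padic_mat_vec_def
proof (rule restrict_ext)
  fix i assume "i \<in> {..<n}"
  then have "R i j \<otimes>\<^bsub>padic_int p\<^esub> v j \<in> carrier (padic_int p)" if "j \<in> {..<m}" for j
    using assms that by (intro padic_mult_closed) (auto simp: carrier_padic_vec)
  then show "(\<Oplus>\<^bsub>padic_int p\<^esub>j\<in>{..<m}. R i j \<otimes>\<^bsub>padic_int p\<^esub> v j) =
      (\<lambda>k. (\<Sum>j<m. R i j k * v j k) mod int p ^ k)"
    by (subst padic_finsum[OF assms(1)]) (simp_all add: mod_sum_eq)
qed

lemma padic_divide: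
  assumes p: "p > 0" and x: "x \<in> carrier (padic_int p)" "x r = 0"
  obtains y where "y \<in> carrier (padic_int p)" "\<And>k. x k = (int p ^ r * y k) mod int p ^ k"
proof -
  \<comment> \<open>Residue \<open>k\<close> of the quotient needs \<open>x\<close> to precision
    \<open>k + r\<close>, hence the shift.\<close>
  define y where "y k = x (k + r) div int p ^ r" for k
  have P: "int p ^ r > 0" using p by simp
  have xy: "x (k + r) = int p ^ r * y k" for k
  proof -
    have "x (k + r) mod int p ^ r = 0" using padic_coherent_mod[OF x(1), of r "k + r"] x(2) by simp
    then show ?thesis unfolding y_def by (simp add: mod_eq_0_iff_dvd)
  qed
  have "0 \<le> y k \<and> y k < int p ^ k \<and> [y (Suc k) = y k] (mod int p ^ k)" for k
  proof (intro conjI)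
    have "0 \<le> x (k + r)" "x (k + r) < int p ^ (k + r)"
      using x(1) unfolding padic_carrier by blast+
    then have b: "0 \<le> x (k + r)" "x (k + r) < int p ^ r * int p ^ k"
      by (simp_all add: power_add mult.commute)
    show "0 \<le> y k" using b(1) P by (simp add: y_def pos_imp_zdiv_nonneg_iff)
    show "y k < int p ^ k" using b(2) P unfolding xy by simp
    have "[x (Suc k + r) = x (k + r)] (mod int p ^ (k + r))"
      using padic_Suc_cong[OF x(1), of "k + r"] by simp
    then have "int p ^ r * int p ^ k dvd int p ^ r * (y (Suc k) - y k)"
      unfolding xy by (simp add: cong_iff_dvd_diff power_add right_diff_distrib mult.commute)
    then show "[y (Suc k) = y k] (mod int p ^ k)"
      using P p by (auto simp: cong_iff_dvd_diff)
  qed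
  then have "y \<in> carrier (padic_int p)" by (simp add: padic_carrier)
  moreover have "x k = (int p ^ r * y k) mod int p ^ k" for k
    using padic_coherent_mod[OF x(1), of k "k + r"] xy[of k] by simp
  ultimately show ?thesis using that by blast
qed

definition reduce_vec :: "nat \<Rightarrow> nat \<Rightarrow> (nat \<Rightarrow> nat \<Rightarrow> int) \<Rightarrow> (nat \<Rightarrow> int)" where
  "reduce_vec n k x = (\<lambda>i\<in>{..<n}. x i k)"

lemma reduce_vec_hom:
  assumes "p > 0"
  shows "reduce_vec n k \<in> hom (padic_vec p n) (zmod_vec (p ^ k) n)"
  using assms by (intro homI)
    (auto simp: reduce_vec_def carrier_padic_vec carrier_zmod_vec padic_carrier mult_padic_vec
      mult_zmod_vec PiE_iff intro!: restrict_ext)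

lemma reduce_vec_surj:
  assumes "p > 0"
  shows "reduce_vec n k ` carrier (padic_vec p n) = carrier (zmod_vec (p ^ k) n)"
proof
  show "reduce_vec n k ` carrier (padic_vec p n) \<subseteq> carrier (zmod_vec (p ^ k) n)"
    using reduce_vec_hom[OF assms, of n k] by (auto simp: hom_def)
  show "carrier (zmod_vec (p ^ k) n) \<subseteq> reduce_vec n k ` carrier (padic_vec p n)"
  proof
    fix a assume "a \<in> carrier (zmod_vec (p ^ k) n)"
    then have a: "a \<in> vecs (p ^ k) n" using assms by (simp add: carrier_zmod_vec)
    have "(\<lambda>l. a i mod int p ^ l) \<in> carrier (padic_int p)" for i
      by (rule padic_carrier_modI[OF assms]) simp
    then have "(\<lambda>i\<in>{..<n}. \<lambda>l. a i mod int p ^ l) \<in> carrier (padic_vec p n)"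
      by (simp add: carrier_padic_vec)
    moreover have "reduce_vec n k (\<lambda>i\<in>{..<n}. \<lambda>l. a i mod int p ^ l) = a"
    proof
      fix i show "reduce_vec n k (\<lambda>i\<in>{..<n}. \<lambda>l. a i mod int p ^ l) i = a i"
        using a by (cases "i < n") (auto simp: reduce_vec_def PiE_iff extensional_def)
    qed
    ultimately show "a \<in> reduce_vec n k ` carrier (padic_vec p n)" by (metis imageI)
  qed
qed

lemma linear_combination_in_generate:
  assumes "q > 0" "finite J" "\<And>j. j \<in> J \<Longrightarrow> C j \<in> vecs q n" "\<And>j. j \<in> J \<Longrightarrow> 0 \<le> c j"
  shows "(\<lambda>i\<in>{..<n}. (\<Sum>j\<in>J. c j * C j i) mod int q) \<in> generate (zmod_vec q n) (C ` J)"
  using assms(2,3,4)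
proof (induction J rule: finite_induct)
  case empty
  have "\<one>\<^bsub>zmod_vec q n\<^esub> \<in> generate (zmod_vec q n) {}" by (rule generate.one)
  then show ?case by (simp add: zmod_vec_def restrict_def)
next
  case (insert j J)
  let ?G = "zmod_vec q n"
  interpret comm_group ?G by (rule comm_group_zmod_vec)
  have sub: "C ` insert j J \<subseteq> carrier ?G" using insert.prems carrier_zmod_vec[OF assms(1)] by auto
  have s: "subgroup (generate ?G (C ` insert j J)) ?G" by (rule generate_is_subgroup[OF sub])
  have Cj: "C j \<in> carrier ?G" using sub by simp
  have a: "C j [^]\<^bsub>?G\<^esub> nat (c j) \<in> generate ?G (C ` insert j J)"
    using subgroup_int_pow_closed[OF s generate.incl, of "C j" "int (nat (c j))"]
    unfolding int_pow_int by blast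
  have b: "(\<lambda>i\<in>{..<n}. (\<Sum>j\<in>J. c j * C j i) mod int q) \<in> generate ?G (C ` insert j J)"
  proof (rule subsetD)
    show "generate ?G (C ` J) \<subseteq> generate ?G (C ` insert j J)" by (rule mono_generate) auto
    show "(\<lambda>i\<in>{..<n}. (\<Sum>j\<in>J. c j * C j i) mod int q) \<in> generate ?G (C ` J)"
      by (rule insert.IH) (use insert.prems in blast)+
  qed
  have eq: "C j [^]\<^bsub>?G\<^esub> nat (c j) \<otimes>\<^bsub>?G\<^esub> (\<lambda>i\<in>{..<n}. (\<Sum>j\<in>J. c j * C j i) mod int q)
     = (\<lambda>i\<in>{..<n}. (\<Sum>j\<in>insert j J. c j * C j i) mod int q)"
    unfolding zmod_vec_pow[OF Cj] mult_zmod_vec using insert.prems(2)[of j] insert.hyps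
    by (intro restrict_ext) (simp add: mod_simps)
  show ?case using subgroup.m_closed[OF s a b] unfolding eq .
qed

definition mat_image ::
  "nat \<Rightarrow> nat \<Rightarrow> nat \<Rightarrow> (nat \<Rightarrow> nat \<Rightarrow> (nat \<Rightarrow> int)) \<Rightarrow> (nat \<Rightarrow> nat \<Rightarrow> int) set" where
  "mat_image p n m R = padic_mat_vec p n m R ` carrier (padic_vec p m)"

text \<open>Lagrange's theorem in the quotient. For \<open>order B = p ^ r\<close> it places all
  \<open>p ^ r\<close>-multiples in \<open>N\<close>.\<close>

lemma factor_group_pow_mem:
  assumes N: "N \<lhd> G" and iso: "(G Mod N) \<cong> B" and B: "group B" and x: "x \<in> carrier G"
  shows "x [^]\<^bsub>G\<^esub> order B \<in> N"
proof -
  interpret normal N G by (rule N)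
  interpret Q: group "G Mod N" by (rule factorgroup_is_group)
  interpret h: group_hom G "G Mod N" "\<lambda>a. N #>\<^bsub>G\<^esub> a"
    by (intro group_homI r_coset_hom_Mod factorgroup_is_group is_group)
  have "order (G Mod N) = order B" using iso_same_card[OF iso] by (simp add: order_def)
  then have "(N #>\<^bsub>G\<^esub> x) [^]\<^bsub>G Mod N\<^esub> order B = \<one>\<^bsub>G Mod N\<^esub>"
    using Q.pow_order_eq_1[OF h.hom_closed[OF x]] by simp
  then have "N #>\<^bsub>G\<^esub> (x [^]\<^bsub>G\<^esub> order B) = N"
    using h.hom_nat_pow[OF x, of "order B"] by simp
  then show ?thesis
    using x rcos_self[of "x [^]\<^bsub>G\<^esub> order B"] is_subgroup by (metis nat_pow_closed)
qed

text \<open>The map sending \<open>x\<close> to the coset of \<open>h x\<close> has kernel exactly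
  \<open>N\<close>, because \<open>N\<close> contains the kernel of \<open>h\<close>; the first
  isomorphism theorem does the rest.\<close>

lemma Mod_preimage_iso:
  assumes h: "group_hom G H h" and surj: "h ` carrier G = carrier H"
    and N: "subgroup N G" and H: "comm_group H" and ker: "kernel G H h \<subseteq> N"
  shows "(G Mod N) \<cong> (H Mod (h ` N))"
proof -
  interpret h: group_hom G H h by (rule h)
  interpret H: comm_group H by (rule H)
  have hN: "subgroup (h ` N) H" by (rule h.subgroup_img_is_subgroup[OF N])
  interpret hN: normal "h ` N" H by (rule H.subgroup_imp_normal[OF hN])
  let ?f = "\<lambda>x. (h ` N) #>\<^bsub>H\<^esub> h x"
  have fh: "group_hom G (H Mod h ` N) ?f"
  proof (intro group_homI hN.factorgroup_is_group h.G.is_group)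
    show "?f \<in> hom G (H Mod h ` N)"
      using hom_compose[OF h.homh hN.r_coset_hom_Mod] by (simp add: comp_def)
  qed
  interpret f: group_hom G "H Mod h ` N" ?f by (rule fh)
  have "kernel G (H Mod h ` N) ?f = N"
  proof
    show "kernel G (H Mod h ` N) ?f \<subseteq> N"
    proof
      fix x assume "x \<in> kernel G (H Mod h ` N) ?f"
      then have x: "x \<in> carrier G" "(h ` N) #>\<^bsub>H\<^esub> h x = h ` N" by (auto simp: kernel_def FactGroup_def)
      then have "h x \<in> h ` N" using h.H.rcos_self[OF h.hom_closed[OF x(1)] hN] by auto
      then obtain y where y: "y \<in> N" "h x = h y" by auto
      have yc: "y \<in> carrier G" using y subgroup.subset[OF N] by auto
      have "x \<otimes>\<^bsub>G\<^esub> inv\<^bsub>G\<^esub> y \<in> kernel G H h"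
        using x yc y by (simp add: kernel_def)
      then have "(x \<otimes>\<^bsub>G\<^esub> inv\<^bsub>G\<^esub> y) \<otimes>\<^bsub>G\<^esub> y \<in> N"
        using ker y subgroup.m_closed[OF N] by blast
      then show "x \<in> N" using x yc by (simp add: h.G.m_assoc)
    qed
    show "N \<subseteq> kernel G (H Mod h ` N) ?f"
      using subgroup.subset[OF N] h.H.coset_join2[OF _ hN] by (auto simp: kernel_def FactGroup_def)
  qed
  moreover have "?f ` carrier G = carrier (H Mod h ` N)"
  proof -
    have "?f ` carrier G = (\<lambda>y. (h ` N) #>\<^bsub>H\<^esub> y) ` (h ` carrier G)" by (simp add: image_image)
    also have "\<dots> = carrier (H Mod h ` N)"
      unfolding surj by (auto simp: FactGroup_def RCOSETS_def)
    finally show ?thesis .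
  qed
  ultimately show ?thesis using f.FactGroup_iso by simp
qed

lemma mult_padic_vec_nth:
  "i < n \<Longrightarrow> (x \<otimes>\<^bsub>padic_vec p n\<^esub> y) i k = (x i k + y i k) mod int p ^ k"
  by (simp add: mult_padic_vec)

lemma padic_vec_pow:
  assumes "p > 0" "x \<in> carrier (padic_vec p n)"
  shows "x [^]\<^bsub>padic_vec p n\<^esub> (e::nat) = (\<lambda>i\<in>{..<n}. \<lambda>k. (int e * x i k) mod int p ^ k)"
proof (induction e)
  case 0
  then show ?case by (simp add: padic_vec_def)
next
  case (Suc e)
  interpret comm_group "padic_vec p n" by (rule comm_group_padic_vec[OF assms(1)])
  have "x [^]\<^bsub>padic_vec p n\<^esub> Suc e = x [^]\<^bsub>padic_vec p n\<^esub> e \<otimes>\<^bsub>padic_vec p n\<^esub> x" by simp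
  also have "\<dots> = (\<lambda>i\<in>{..<n}. \<lambda>k. (int (Suc e) * x i k) mod int p ^ k)"
    unfolding Suc.IH mult_padic_vec
    by (intro restrict_ext ext) (simp add: mod_simps algebra_simps)
  finally show ?case .
qed

context
  fixes p n m :: nat and R :: "nat \<Rightarrow> nat \<Rightarrow> nat \<Rightarrow> int"
  assumes p: "p > 0" and R: "\<And>i j. i < n \<Longrightarrow> j < m \<Longrightarrow> R i j \<in> carrier (padic_int p)"
begin

lemma mat_vec_nth:
  "v \<in> carrier (padic_vec p m) \<Longrightarrow>
   padic_mat_vec p n m R v = (\<lambda>i\<in>{..<n}. \<lambda>k. (\<Sum>j<m. R i j k * v j k) mod int p ^ k)"
  by (rule padic_mat_vec_nth[OF p R])

lemma padic_mat_vec_closed: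
  assumes "v \<in> carrier (padic_vec p m)"
  shows "padic_mat_vec p n m R v \<in> carrier (padic_vec p n)"
  unfolding mat_vec_nth[OF assms] carrier_padic_vec
proof (rule restrict_PiE_iff[THEN iffD2], rule ballI)
  fix i assume "i \<in> {..<n}"
  then show "(\<lambda>k. (\<Sum>j<m. R i j k * v j k) mod int p ^ k) \<in> carrier (padic_int p)"
    using assms R by (intro padic_carrier_modI p cong_sum cong_mult padic_Suc_cong)
      (auto simp: carrier_padic_vec)
qed

lemma padic_mat_vec_hom: "padic_mat_vec p n m R \<in> hom (padic_vec p m) (padic_vec p n)"
proof (rule homI)
  fix v w assume vw: "v \<in> carrier (padic_vec p m)" "w \<in> carrier (padic_vec p m)"
  interpret comm_group "padic_vec p m" by (rule comm_group_padic_vec[OF p])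
  have "v \<otimes>\<^bsub>padic_vec p m\<^esub> w \<in> carrier (padic_vec p m)" using vw by simp
  note nth = mat_vec_nth[OF this] mat_vec_nth[OF vw(1)] mat_vec_nth[OF vw(2)]
  have "(\<Sum>j<m. R i j k * ((v j k + w j k) mod int p ^ k)) mod int p ^ k =
     (\<Sum>j<m. R i j k * v j k + R i j k * w j k) mod int p ^ k" for i k
  proof -
    have "[(\<Sum>j<m. R i j k * ((v j k + w j k) mod int p ^ k)) =
       (\<Sum>j<m. R i j k * (v j k + w j k))] (mod int p ^ k)"
      by (intro cong_sum cong_scalar_left) (simp add: cong_def)
    then show ?thesis by (simp add: cong_def distrib_left)
  qed
  then show "padic_mat_vec p n m R (v \<otimes>\<^bsub>padic_vec p m\<^esub> w) =
      padic_mat_vec p n m R v \<otimes>\<^bsub>padic_vec p n\<^esub> padic_mat_vec p n m R w"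
    unfolding nth by (auto simp: mult_padic_vec sum.distrib mod_simps intro!: restrict_ext)
qed (rule padic_mat_vec_closed)

lemma subgroup_mat_image: "subgroup (mat_image p n m R) (padic_vec p n)"
proof -
  interpret group_hom "padic_vec p m" "padic_vec p n" "padic_mat_vec p n m R"
    by (intro group_homI padic_mat_vec_hom comm_group.axioms(2)
        comm_group_padic_vec p)
  show ?thesis unfolding mat_image_def by (rule img_is_subgroup)
qed

text \<open>Modulo \<open>p ^ k\<close> a \<open>p\<close>-adic combination of columns becomes an
  integral one, and each column is the image of a standard basis vector.\<close>

lemma reduce_mat_image:
  "reduce_vec n k ` mat_image p n m R = generate (zmod_vec (p ^ k) n) ((\<lambda>j. \<lambda>i\<in>{..<n}. R i j k) ` {..<m})"
proof
  let ?C = "\<lambda>j. \<lambda>i\<in>{..<n}. R i j k"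
  have pk: "p ^ k > 0" using p by simp
  have C: "?C j \<in> vecs (p ^ k) n" if "j < m" for j
    using R that by (auto simp: padic_carrier)
  have nth: "reduce_vec n k (padic_mat_vec p n m R v) = (\<lambda>i\<in>{..<n}. (\<Sum>j<m. v j k * ?C j i) mod int (p ^ k))"
    if "v \<in> carrier (padic_vec p m)" for v
    unfolding reduce_vec_def mat_vec_nth[OF that]
    by (intro restrict_ext) (simp add: mult.commute)
  show "reduce_vec n k ` mat_image p n m R \<subseteq> generate (zmod_vec (p ^ k) n) (?C ` {..<m})"
    unfolding mat_image_def image_image
  proof (rule image_subsetI)
    fix v assume v: "v \<in> carrier (padic_vec p m)"
    show "reduce_vec n k (padic_mat_vec p n m R v) \<in> generate (zmod_vec (p ^ k) n) (?C ` {..<m})"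
      unfolding nth[OF v]
    proof (rule linear_combination_in_generate[OF pk])
      show "?C j \<in> vecs (p ^ k) n" if "j \<in> {..<m}" for j
        by (rule C) (use that in simp)
      show "0 \<le> v j k" if "j \<in> {..<m}" for j
        using v that by (auto simp: carrier_padic_vec padic_carrier PiE_iff)
    qed simp
  qed
  interpret group "zmod_vec (p ^ k) n" by (rule group_zmod_vec)
  interpret rh: group_hom "padic_vec p n" "zmod_vec (p ^ k) n" "reduce_vec n k"
    by (intro group_homI reduce_vec_hom comm_group.axioms(2)
        comm_group_padic_vec p group_zmod_vec)
  show "generate (zmod_vec (p ^ k) n) (?C ` {..<m}) \<subseteq> reduce_vec n k ` mat_image p n m R"
  proof (rule generate_subgroup_incl[OF _ rh.subgroup_img_is_subgroup[OF subgroup_mat_image]], rule image_subsetI)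
    fix j assume j: "j \<in> {..<m}"
    define v where "v = (\<lambda>j'\<in>{..<m}. if j' = j then \<one>\<^bsub>padic_int p\<^esub> else \<zero>\<^bsub>padic_int p\<^esub>)"
    have v: "v \<in> carrier (padic_vec p m)"
      unfolding v_def carrier_padic_vec using padic_one_closed[OF p] p by (auto simp: padic_carrier)
    have "reduce_vec n k (padic_mat_vec p n m R v) = ?C j"
      unfolding nth[OF v]
    proof (rule restrict_ext)
      fix i assume i: "i \<in> {..<n}"
      have "(\<Sum>j'<m. v j' k * ?C j' i) = (\<Sum>j'<m. if j' = j then (1 mod int p ^ k) * R i j k else 0)"
        using i by (intro sum.cong) (auto simp: v_def)
      also have "\<dots> = (1 mod int p ^ k) * R i j k" using j by simp
      finally have "(\<Sum>j'<m. v j' k * ?C j' i) mod int (p ^ k) = R i j k mod int p ^ k"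
        by (simp add: mod_simps)
      then show "(\<Sum>j'<m. v j' k * ?C j' i) mod int (p ^ k) = R i j k"
        using i j R padic_mod_self by simp
    qed
    then show "?C j \<in> reduce_vec n k ` mat_image p n m R" using v unfolding mat_image_def by (metis imageI)
  qed
qed

text \<open>
  Nakayama's lemma for \<open>p ^ r\<close> times the whole module: iterating the hypothesis expands
  \<open>p ^ r * y\<close> as \<open>R (v 0 + p * v 1 + p ^ 2 * v 2 + \<dots>)\<close>, and the series converges.
\<close>
lemma mat_image_nakayama:
  assumes step: "\<And>y. y \<in> carrier (padic_vec p n) \<Longrightarrow>
      \<exists>v\<in>carrier (padic_vec p m). \<exists>z\<in>carrier (padic_vec p n). \<forall>i<n. \<forall>k.
        [int p ^ r * y i k = (\<Sum>j<m. R i j k * v j k) + int p * (int p ^ r * z i k)] (mod int p ^ k)"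
    and y: "y \<in> carrier (padic_vec p n)"
  shows "(\<lambda>i\<in>{..<n}. \<lambda>k. (int p ^ r * y i k) mod int p ^ k) \<in> mat_image p n m R"
proof -
  let ?P = "carrier (padic_vec p n)" and ?W = "carrier (padic_vec p m)"
  have "\<forall>y\<in>?P. \<exists>v z. v \<in> ?W \<and> z \<in> ?P \<and> (\<forall>i<n. \<forall>k.
      [int p ^ r * y i k = (\<Sum>j<m. R i j k * v j k) + int p * (int p ^ r * z i k)] (mod int p ^ k))"
    using step by blast
  from bchoice[OF this] obtain fv where "\<forall>y\<in>?P. \<exists>z. fv y \<in> ?W \<and> z \<in> ?P \<and> (\<forall>i<n. \<forall>k.
      [int p ^ r * y i k = (\<Sum>j<m. R i j k * fv y j k) + int p * (int p ^ r * z i k)] (mod int p ^ k))"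
    by blast
  from bchoice[OF this] obtain fz where fz: "\<forall>y\<in>?P. fv y \<in> ?W \<and> fz y \<in> ?P \<and> (\<forall>i<n. \<forall>k.
      [int p ^ r * y i k = (\<Sum>j<m. R i j k * fv y j k) + int p * (int p ^ r * fz y i k)] (mod int p ^ k))"
    by blast
  have f: "\<And>y. y \<in> ?P \<Longrightarrow> fv y \<in> ?W" "\<And>y. y \<in> ?P \<Longrightarrow> fz y \<in> ?P"
    "\<And>y i k. y \<in> ?P \<Longrightarrow> i < n \<Longrightarrow>
      [int p ^ r * y i k = (\<Sum>j<m. R i j k * fv y j k) + int p * (int p ^ r * fz y i k)] (mod int p ^ k)"
    using fz by blast+
  \<comment> \<open>\<open>z t\<close> is the remainder after \<open>t\<close> steps of the
    expansion, \<open>v t\<close> the coefficient vector split off at step \<open>t\<close>.\<close>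
  define z where "z t = (fz ^^ t) y" for t
  define v where "v t = fv (z t)" for t
  have z: "z t \<in> ?P" for t by (induction t) (use y f in \<open>auto simp: z_def\<close>)
  have v: "v t \<in> ?W" for t using f z by (simp add: v_def)
  have zS: "z (Suc t) = fz (z t)" for t by (simp add: z_def)
  have vp: "v t j \<in> carrier (padic_int p)" if "j < m" for t j
    using v[of t] that by (auto simp: carrier_padic_vec)
  have expand: "[int p ^ r * y i k = (\<Sum>t<L. int p ^ t * (\<Sum>j<m. R i j k * v t j k)) +
      int p ^ L * (int p ^ r * z L i k)] (mod int p ^ k)" if i: "i < n" for i k L
  proof (induction L)
    case 0
    then show ?case by (simp add: z_def)
  next
    case (Suc L)
    have "[int p ^ L * (int p ^ r * z L i k) =
        int p ^ L * ((\<Sum>j<m. R i j k * v L j k) + int p * (int p ^ r * z (Suc L) i k))] (mod int p ^ k)"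
      using f(3)[OF z i, of L k] by (intro cong_scalar_left) (simp add: v_def zS)
    from cong_trans[OF Suc.IH cong_add[OF cong_refl this]] show ?case
      by (simp add: algebra_simps)
  qed
  \<comment> \<open>Component \<open>k\<close> cuts the series at \<open>t < k\<close>, since the
    later terms vanish modulo \<open>p ^ k\<close>.\<close>
  define w where "w = (\<lambda>j\<in>{..<m}. \<lambda>k. (\<Sum>t<k. int p ^ t * v t j k) mod int p ^ k)"
  have "(\<lambda>k. (\<Sum>t<k. int p ^ t * v t j k) mod int p ^ k) \<in> carrier (padic_int p)" if "j < m" for j
  proof (rule padic_carrier_modI[OF p])
    fix k
    have "[(\<Sum>t<k. int p ^ t * v t j (Suc k)) + int p ^ k * v k j (Suc k) =
        (\<Sum>t<k. int p ^ t * v t j k) + 0] (mod int p ^ k)"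
      by (intro cong_add cong_sum cong_scalar_left padic_Suc_cong vp that) (simp add: cong_0_iff)
    then show "[(\<Sum>t<Suc k. int p ^ t * v t j (Suc k)) = (\<Sum>t<k. int p ^ t * v t j k)] (mod int p ^ k)"
      by simp
  qed
  then have w: "w \<in> ?W" by (simp add: w_def carrier_padic_vec)
  have "padic_mat_vec p n m R w = (\<lambda>i\<in>{..<n}. \<lambda>k. (int p ^ r * y i k) mod int p ^ k)"
    unfolding mat_vec_nth[OF w]
  proof (intro restrict_ext ext)
    fix i k assume i: "i \<in> {..<n}"
    have "[(\<Sum>j<m. R i j k * w j k) = (\<Sum>j<m. R i j k * (\<Sum>t<k. int p ^ t * v t j k))] (mod int p ^ k)"
      by (intro cong_sum cong_scalar_left) (simp add: w_def cong_def)
    moreover have "(\<Sum>j<m. R i j k * (\<Sum>t<k. int p ^ t * v t j k)) =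
        (\<Sum>t<k. int p ^ t * (\<Sum>j<m. R i j k * v t j k))"
      by (simp add: sum_distrib_left mult_ac) (rule sum.swap)
    ultimately show "(\<Sum>j<m. R i j k * w j k) mod int p ^ k = (int p ^ r * y i k) mod int p ^ k"
      using expand[of i k k] i by (simp add: cong_def)
  qed
  then show ?thesis using w unfolding mat_image_def by (metis imageI)
qed

lemma reduce_vec_group_hom: "group_hom (padic_vec p n) (zmod_vec (p ^ k) n) (reduce_vec n k)"
  by (intro group_homI reduce_vec_hom comm_group.axioms(2)
      comm_group_padic_vec p group_zmod_vec)

lemma kernel_reduce_vec:
  assumes "z \<in> kernel (padic_vec p n) (zmod_vec (p ^ r) n) (reduce_vec n r)"
  obtains y where "y \<in> carrier (padic_vec p n)"
    "z = (\<lambda>i\<in>{..<n}. \<lambda>k. (int p ^ r * y i k) mod int p ^ k)"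
proof -
  have z: "z \<in> carrier (padic_vec p n)" "reduce_vec n r z = (\<lambda>i\<in>{..<n}. 0)"
    using assms by (auto simp: kernel_def zmod_vec_def)
  have zi: "z i \<in> carrier (padic_int p)" "z i r = 0" if "i < n" for i
  proof -
    show "z i \<in> carrier (padic_int p)" using z that by (auto simp: carrier_padic_vec)
    show "z i r = 0" using fun_cong[OF z(2), of i] that by (simp add: reduce_vec_def)
  qed
  have "\<forall>i\<in>{..<n}. \<exists>y. y \<in> carrier (padic_int p) \<and> (\<forall>k. z i k = (int p ^ r * y k) mod int p ^ k)"
    using padic_divide[OF p zi] by (metis lessThan_iff)
  then obtain y where y: "\<And>i. i < n \<Longrightarrow> y i \<in> carrier (padic_int p)"
    "\<And>i k. i < n \<Longrightarrow> z i k = (int p ^ r * y i k) mod int p ^ k"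
    by (metis lessThan_iff)
  show ?thesis
  proof (rule that[of "restrict y {..<n}"])
    show "restrict y {..<n} \<in> carrier (padic_vec p n)" using y by (simp add: carrier_padic_vec)
    show "z = (\<lambda>i\<in>{..<n}. \<lambda>k. (int p ^ r * restrict y {..<n} i k) mod int p ^ k)"
    proof
      fix i
      show "z i = (\<lambda>i\<in>{..<n}. \<lambda>k. (int p ^ r * restrict y {..<n} i k) mod int p ^ k) i"
        using y z(1) by (cases "i < n") (auto simp: carrier_padic_vec PiE_iff extensional_def)
    qed
  qed
qed

text \<open>One factor \<open>p\<close> is moved into \<open>y\<close>, which leaves the
  \<open>p ^ r\<close>-multiples that \<open>factor_group_pow_mem\<close> and
  \<open>mat_image_nakayama\<close> handle.\<close>

lemma kernel_reduce_vec_Suc: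
  assumes "z \<in> kernel (padic_vec p n) (zmod_vec (p ^ Suc r) n) (reduce_vec n (Suc r))"
  obtains y where "y \<in> carrier (padic_vec p n)"
    "z = (\<lambda>i\<in>{..<n}. \<lambda>k. (int p ^ r * y i k) mod int p ^ k)"
proof -
  interpret P: comm_group "padic_vec p n" by (rule comm_group_padic_vec[OF p])
  obtain x where x: "x \<in> carrier (padic_vec p n)"
    "z = (\<lambda>i\<in>{..<n}. \<lambda>k. (int p ^ Suc r * x i k) mod int p ^ k)"
    using kernel_reduce_vec[OF assms] by blast
  show ?thesis
  proof (rule that[of "x [^]\<^bsub>padic_vec p n\<^esub> p"])
    show "x [^]\<^bsub>padic_vec p n\<^esub> p \<in> carrier (padic_vec p n)" using x(1) by simp
    show "z = (\<lambda>i\<in>{..<n}. \<lambda>k. (int p ^ r * (x [^]\<^bsub>padic_vec p n\<^esub> p) i k) mod int p ^ k)"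
      unfolding padic_vec_pow[OF p x(1)] x(2)
      by (intro restrict_ext ext) (simp add: mod_simps mult_ac)
  qed
qed

text \<open>Each side forces the image to contain the kernel of reduction, after which
  \<open>Mod_preimage_iso\<close> identifies the two quotients. If the cokernel is \<open>B\<close>,
  it is killed by \<open>p ^ r\<close>. If only the reduced quotient is \<open>B\<close>, then
  \<open>p ^ r\<close>-multiples lie in the image up to \<open>p ^ Suc r\<close>-multiples, and
  Nakayama's lemma removes the error.\<close>

lemma padic_cok_iso_iff:
  assumes B: "comm_group B" and ord: "order B = p ^ r"
  shows "padic_cok p n m R \<cong> B \<longleftrightarrow>
    (zmod_vec (p ^ Suc r) n Mod
      generate (zmod_vec (p ^ Suc r) n) ((\<lambda>j. \<lambda>i\<in>{..<n}. R i j (Suc r)) ` {..<m})) \<cong> B"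
proof -
  let ?P = "padic_vec p n" and ?V = "zmod_vec (p ^ Suc r) n" and ?I = "mat_image p n m R"
  let ?h = "reduce_vec n (Suc r)"
  interpret P: comm_group ?P by (rule comm_group_padic_vec[OF p])
  interpret V: comm_group ?V by (rule comm_group_zmod_vec)
  interpret h: group_hom ?P ?V ?h by (rule reduce_vec_group_hom)
  have gB: "group B" using B by (rule comm_group.axioms(2))
  have I: "subgroup ?I ?P" by (rule subgroup_mat_image)
  have nI: "?I \<lhd> ?P" by (rule P.subgroup_imp_normal[OF I])
  have hI: "?h ` ?I = generate ?V ((\<lambda>j. \<lambda>i\<in>{..<n}. R i j (Suc r)) ` {..<m})"
    by (rule reduce_mat_image)
  have shI: "subgroup (?h ` ?I) ?V" by (rule h.subgroup_img_is_subgroup[OF I])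
  have cok: "padic_cok p n m R = ?P Mod ?I" by (simp add: padic_cok_def mat_image_def)
  have key: "(?P Mod ?I) \<cong> (?V Mod (?h ` ?I))" if "kernel ?P ?V ?h \<subseteq> ?I"
    by (rule Mod_preimage_iso[OF reduce_vec_group_hom reduce_vec_surj[OF p] I comm_group_zmod_vec that])
  have gQ: "group (?P Mod ?I)" by (rule normal.factorgroup_is_group[OF nI])
  show ?thesis
    unfolding cok hI[symmetric]
  proof
    assume iso: "(?P Mod ?I) \<cong> B"
    have "kernel ?P ?V ?h \<subseteq> ?I"
    proof
      fix z assume z: "z \<in> kernel ?P ?V ?h"
      obtain y where y: "y \<in> carrier ?P" "z = (\<lambda>i\<in>{..<n}. \<lambda>k. (int p ^ r * y i k) mod int p ^ k)"
        using z by (rule kernel_reduce_vec_Suc)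
      have "z = y [^]\<^bsub>?P\<^esub> order B" unfolding y(2) padic_vec_pow[OF p y(1)] ord by simp
      then show "z \<in> ?I" using factor_group_pow_mem[OF nI iso gB y(1)] by simp
    qed
    from group.iso_sym[OF gQ key[OF this]] iso show "(?V Mod (?h ` ?I)) \<cong> B"
      by (rule iso_trans)
  next
    assume iso: "(?V Mod (?h ` ?I)) \<cong> B"
    have step: "\<exists>v\<in>carrier (padic_vec p m). \<exists>z\<in>carrier ?P. \<forall>i<n. \<forall>k.
        [int p ^ r * y i k = (\<Sum>j<m. R i j k * v j k) + int p * (int p ^ r * z i k)] (mod int p ^ k)"
      if y: "y \<in> carrier ?P" for y
    proof -
      let ?x = "y [^]\<^bsub>?P\<^esub> order B"
      have xc: "?x \<in> carrier ?P" using y by simp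
      have "?h ?x = ?h y [^]\<^bsub>?V\<^esub> order B" using y by (rule h.hom_nat_pow)
      also have "\<dots> \<in> ?h ` ?I"
        by (rule factor_group_pow_mem[OF V.subgroup_imp_normal[OF shI] iso gB]) (rule h.hom_closed[OF y])
      finally obtain v where v: "v \<in> carrier (padic_vec p m)" "?h ?x = ?h (padic_mat_vec p n m R v)"
        unfolding mat_image_def by auto
      let ?w = "padic_mat_vec p n m R v"
      have wc: "?w \<in> carrier ?P" by (rule padic_mat_vec_closed[OF v(1)])
      \<comment> \<open>The \<open>p ^ r\<close>-multiple \<open>?x\<close> and the image vector
        \<open>?w\<close> have equal reductions, so they differ by a
        \<open>p ^ Suc r\<close>-multiple: the remainder of the Nakayama step.\<close>
      have "?x \<otimes>\<^bsub>?P\<^esub> inv\<^bsub>?P\<^esub> ?w \<in> kernel ?P ?V ?h"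
        using xc wc v(2) V.r_inv[OF h.hom_closed[OF wc]] by (simp add: kernel_def del: power_Suc)
      then obtain z' where z': "z' \<in> carrier (padic_vec p n)"
        "?x \<otimes>\<^bsub>?P\<^esub> inv\<^bsub>?P\<^esub> ?w = (\<lambda>i\<in>{..<n}. \<lambda>k. (int p ^ Suc r * z' i k) mod int p ^ k)"
        by (rule kernel_reduce_vec)
      show ?thesis
      proof (intro bexI[OF _ v(1)] bexI[OF _ z'(1)] allI impI)
        fix i k assume i: "i < n"
        have "?x = (?x \<otimes>\<^bsub>?P\<^esub> inv\<^bsub>?P\<^esub> ?w) \<otimes>\<^bsub>?P\<^esub> ?w"
          using xc wc by (simp add: P.m_assoc)
        then have "?x i k = ((?x \<otimes>\<^bsub>?P\<^esub> inv\<^bsub>?P\<^esub> ?w) \<otimes>\<^bsub>?P\<^esub> ?w) i k" by simp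
        also have "\<dots> = ((?x \<otimes>\<^bsub>?P\<^esub> inv\<^bsub>?P\<^esub> ?w) i k + ?w i k) mod int p ^ k"
          by (rule mult_padic_vec_nth[OF i])
        also have "(?x \<otimes>\<^bsub>?P\<^esub> inv\<^bsub>?P\<^esub> ?w) i k = (int p ^ Suc r * z' i k) mod int p ^ k"
          by (subst z'(2)) (use i in simp)
        also have "?w i k = (\<Sum>j<m. R i j k * v j k) mod int p ^ k"
          unfolding mat_vec_nth[OF v(1)] using i by simp
        finally have "(int p ^ r * y i k) mod int p ^ k = ((int p ^ Suc r * z' i k) mod int p ^ k +
            (\<Sum>j<m. R i j k * v j k) mod int p ^ k) mod int p ^ k"
          unfolding padic_vec_pow[OF p y] ord using i by simp
        then show "[int p ^ r * y i k = (\<Sum>j<m. R i j k * v j k) + int p * (int p ^ r * z' i k)] (mod int p ^ k)"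
          unfolding cong_def by (simp add: mod_simps add.commute mult.assoc)
      qed
    qed
    have "kernel ?P ?V ?h \<subseteq> ?I"
    proof
      fix z assume z: "z \<in> kernel ?P ?V ?h"
      obtain y where y: "y \<in> carrier ?P" "z = (\<lambda>i\<in>{..<n}. \<lambda>k. (int p ^ r * y i k) mod int p ^ k)"
        using z by (rule kernel_reduce_vec_Suc)
      then show "z \<in> ?I" using mat_image_nakayama[OF step y(1)] by simp
    qed
    from key[OF this] iso show "(?P Mod ?I) \<cong> B" by (rule iso_trans)
  qed
qed

end

section \<open>Uniform matrices\<close>

lemma (in group_hom) card_kernel_mult_image:
  "card (carrier G) = card (kernel G H h) * card (h ` carrier G)"
proof -
  let ?H = "H\<lparr>carrier := h ` carrier G\<rparr>"
  have s: "subgroup (h ` carrier G) H" by (rule img_is_subgroup)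
  have gH: "group ?H" by (rule H.subgroup_imp_group[OF s])
  interpret i: group_hom G ?H h
    by (intro group_homI gH G.is_group) (auto simp: hom_def)
  have k: "kernel G ?H h = kernel G H h" by (simp add: kernel_def)
  have "(G Mod kernel G ?H h) \<cong> ?H" by (rule i.FactGroup_iso) simp
  then have "card (rcosets (kernel G H h)) = card (h ` carrier G)"
    using iso_same_card by (fastforce simp: k FactGroup_def)
  then show ?thesis using G.lagrange[OF subgroup_kernel] by (simp add: order_def mult.commute)
qed

lemma (in group) homs_eq_on_generate:
  assumes f: "group_hom G H f" and g: "group_hom G H g" and S: "S \<subseteq> carrier G"
    and eq: "\<And>s. s \<in> S \<Longrightarrow> f s = g s" and x: "x \<in> generate G S"
  shows "f x = g x"
proof -
  interpret f: group_hom G H f by (rule f)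
  interpret g: group_hom G H g by (rule g)
  have "subgroup {x \<in> carrier G. f x = g x} G"
    by (rule subgroupI) auto
  moreover have "S \<subseteq> {x \<in> carrier G. f x = g x}" using S eq by auto
  ultimately have "generate G S \<subseteq> {x \<in> carrier G. f x = g x}"
    by (intro generate_subgroup_incl)
  then show ?thesis using x by blast
qed

text \<open>Extensional maps, so that each epimorphism is counted once and finite groups have
  finitely many.\<close>

definition epis :: "('a, 'b) monoid_scheme \<Rightarrow> ('c, 'd) monoid_scheme \<Rightarrow> ('a \<Rightarrow> 'c) set" where
  "epis G H = {f \<in> hom G H. f \<in> extensional (carrier G) \<and> f ` carrier G = carrier H}"

lemma finite_epis: "finite (carrier G) \<Longrightarrow> finite (carrier H) \<Longrightarrow> finite (epis G H)"
  by (rule finite_subset[OF _ finite_PiE[of "carrier G" "\<lambda>_. carrier H"]])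
    (auto simp: epis_def PiE_def)

lemma epis_group_hom: "group G \<Longrightarrow> group H \<Longrightarrow> f \<in> epis G H \<Longrightarrow> group_hom G H f"
  by (simp add: group_hom_def group_hom_axioms_def epis_def)

text \<open>Composing automorphisms of \<open>B\<close> with one such epimorphism \<open>f0\<close> gives each of them once.\<close>
lemma card_epis_with_kernel:
  assumes G: "group G" and B: "group B" and L: "L \<lhd> G" and iso: "(G Mod L) \<cong> B"
  shows "card {f \<in> epis G B. kernel G B f = L} = card (auto B)"
proof -
  interpret G: group G by (rule G)
  interpret B: group B by (rule B)
  interpret L: normal L G by (rule L)
  obtain \<phi> where \<phi>: "\<phi> \<in> iso (G Mod L) B" using iso by (auto simp: is_iso_def)
  define f0 where "f0 = restrict (\<lambda>x. \<phi> (L #>\<^bsub>G\<^esub> x)) (carrier G)"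
  have \<phi>h: "\<phi> \<in> hom (G Mod L) B" and \<phi>b: "bij_betw \<phi> (carrier (G Mod L)) (carrier B)"
    using \<phi> by (auto simp: iso_def)
  have qc: "L #>\<^bsub>G\<^esub> x \<in> carrier (G Mod L)" if "x \<in> carrier G" for x
    using that by (auto simp: FactGroup_def RCOSETS_def)
  have f0h: "f0 \<in> hom G B"
  proof (rule homI)
    fix x y assume xy: "x \<in> carrier G" "y \<in> carrier G"
    show "f0 x \<in> carrier B" using xy qc \<phi>h by (auto simp: f0_def hom_def)
    have "L #>\<^bsub>G\<^esub> (x \<otimes>\<^bsub>G\<^esub> y) = (L #>\<^bsub>G\<^esub> x) \<otimes>\<^bsub>G Mod L\<^esub> (L #>\<^bsub>G\<^esub> y)"
      using hom_mult[OF L.r_coset_hom_Mod] xy by blast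
    then show "f0 (x \<otimes>\<^bsub>G\<^esub> y) = f0 x \<otimes>\<^bsub>B\<^esub> f0 y"
      using xy qc hom_mult[OF \<phi>h] by (simp add: f0_def)
  qed
  interpret f0: group_hom G B f0
    using f0h by (intro group_homI G B)
  have f0s: "f0 ` carrier G = carrier B"
  proof -
    have "f0 ` carrier G = \<phi> ` ((\<lambda>x. L #>\<^bsub>G\<^esub> x) ` carrier G)"
      by (auto simp: f0_def image_image)
    also have "(\<lambda>x. L #>\<^bsub>G\<^esub> x) ` carrier G = carrier (G Mod L)"
      by (auto simp: FactGroup_def RCOSETS_def)
    also have "\<phi> ` carrier (G Mod L) = carrier B" using \<phi>b by (rule bij_betw_imp_surj_on)
    finally show ?thesis .
  qed
  have f0k: "kernel G B f0 = L"
  proof -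
    have "f0 x = \<one>\<^bsub>B\<^esub> \<longleftrightarrow> x \<in> L" if x: "x \<in> carrier G" for x
    proof -
      have "\<phi> L = \<one>\<^bsub>B\<^esub>"
        using hom_one[OF \<phi>h L.factorgroup_is_group B] by (simp add: FactGroup_def)
      moreover have "L \<in> carrier (G Mod L)"
        using group.is_monoid[OF L.factorgroup_is_group] monoid.one_closed by fastforce
      ultimately have "f0 x = \<one>\<^bsub>B\<^esub> \<longleftrightarrow> L #>\<^bsub>G\<^esub> x = L"
        using x qc[OF x] \<phi>b by (auto simp: f0_def bij_betw_def inj_on_def)
      also have "\<dots> \<longleftrightarrow> x \<in> L"
        using x G.coset_join2[OF x L.is_subgroup] G.rcos_self[OF x L.is_subgroup] by auto
      finally show ?thesis .
    qed
    then show ?thesis using L.subset by (auto simp: kernel_def)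
  qed
  let ?F = "\<lambda>\<sigma>. restrict (\<sigma> \<circ> f0) (carrier G)"
  have "bij_betw ?F (auto B) {f \<in> epis G B. kernel G B f = L}"
    unfolding bij_betw_def
  proof
    show "inj_on ?F (auto B)"
    proof (rule inj_onI)
      fix \<sigma> \<tau> assume st: "\<sigma> \<in> auto B" "\<tau> \<in> auto B" "?F \<sigma> = ?F \<tau>"
      have "\<sigma> b = \<tau> b" if b: "b \<in> carrier B" for b
      proof -
        obtain x where x: "x \<in> carrier G" "b = f0 x" using f0s b by (metis imageE)
        show ?thesis using fun_cong[OF st(3), of x] x by simp
      qed
      then show "\<sigma> = \<tau>" using st by (intro extensionalityI[of \<sigma> "carrier B" \<tau>]) (auto simp: auto_def Bij_def)
    qed
    show "?F ` auto B = {f \<in> epis G B. kernel G B f = L}"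
    proof
      show "?F ` auto B \<subseteq> {f \<in> epis G B. kernel G B f = L}"
      proof (rule image_subsetI)
        fix \<sigma> assume "\<sigma> \<in> auto B"
        then have s: "\<sigma> \<in> hom B B" "bij_betw \<sigma> (carrier B) (carrier B)" by (auto simp: auto_def Bij_def)
        have "?F \<sigma> \<in> hom G B" 
          using hom_compose[OF f0h s(1)] by (auto simp: hom_def)
        moreover have "?F \<sigma> ` carrier G = carrier B"
        proof -
          have "?F \<sigma> ` carrier G = \<sigma> ` (f0 ` carrier G)" by (auto simp: image_image)
          then show ?thesis using f0s bij_betw_imp_surj_on[OF s(2)] by simp
        qed
        moreover have "kernel G B (?F \<sigma>) = L"
        proof -
          have "\<sigma> (f0 x) = \<one>\<^bsub>B\<^esub> \<longleftrightarrow> f0 x = \<one>\<^bsub>B\<^esub>" if "x \<in> carrier G" for x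
            using hom_one[OF s(1) B B] s(2) that f0.hom_closed[OF that] B.one_closed
            unfolding bij_betw_def inj_on_def by metis
          then have "kernel G B (?F \<sigma>) = kernel G B f0" by (auto simp: kernel_def)
          then show ?thesis using f0k by simp
        qed
        ultimately show "?F \<sigma> \<in> {f \<in> epis G B. kernel G B f = L}" by (simp add: epis_def)
      qed
      show "{f \<in> epis G B. kernel G B f = L} \<subseteq> ?F ` auto B"
      proof
        fix f assume f: "f \<in> {f \<in> epis G B. kernel G B f = L}"
        interpret f: group_hom G B f using f epis_group_hom[OF G B] by blast
        have fs: "f ` carrier G = carrier B" "f \<in> extensional (carrier G)" "kernel G B f = L"
          using f by (auto simp: epis_def)
        \<comment> \<open>Equal kernels give equal fibres, so \<open>f\<close> factors through
          \<open>f0\<close> by a well-defined injective \<open>\<sigma>\<close>.\<close>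
        have eq_iff: "f x = f y \<longleftrightarrow> f0 x = f0 y" if "x \<in> carrier G" "y \<in> carrier G" for x y
        proof -
          have "h x = h y \<longleftrightarrow> x \<otimes>\<^bsub>G\<^esub> inv\<^bsub>G\<^esub> y \<in> kernel G B h" if "group_hom G B h" for h
          proof -
            interpret h: group_hom G B h by (rule that)
            have "x \<otimes>\<^bsub>G\<^esub> inv\<^bsub>G\<^esub> y \<in> kernel G B h \<longleftrightarrow> h x \<otimes>\<^bsub>B\<^esub> inv\<^bsub>B\<^esub> (h y) = \<one>\<^bsub>B\<^esub>"
              using \<open>x \<in> carrier G\<close> \<open>y \<in> carrier G\<close> by (simp add: kernel_def)
            also have "\<dots> \<longleftrightarrow> h x = h y"
              using \<open>x \<in> carrier G\<close> \<open>y \<in> carrier G\<close>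
              by (metis B.inv_closed B.inv_equality B.inv_inv B.r_inv h.hom_closed)
            finally show ?thesis by simp
          qed
          from this[OF f.group_hom_axioms] this[OF f0.group_hom_axioms] show ?thesis
            using fs(3) f0k by simp
        qed
        define s where "s b = inv_into (carrier G) f0 b" for b
        have s: "s b \<in> carrier G" "f0 (s b) = b" if "b \<in> carrier B" for b
          using that f0s by (auto simp: s_def inv_into_into f_inv_into_f)
        define \<sigma> where "\<sigma> = restrict (\<lambda>b. f (s b)) (carrier B)"
        have \<sigma>f: "\<sigma> (f0 x) = f x" if "x \<in> carrier G" for x
          using s[OF f0.hom_closed[OF that]] eq_iff[of "s (f0 x)" x] that by (simp add: \<sigma>_def)
        have "\<sigma> \<in> hom B B"
        proof (rule homI)
          fix a b assume ab: "a \<in> carrier B" "b \<in> carrier B"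
          obtain x y where xy: "x \<in> carrier G" "a = f0 x" "y \<in> carrier G" "b = f0 y"
            using f0s ab by (metis imageE)
          show "\<sigma> a \<in> carrier B" using xy \<sigma>f by simp
          have "\<sigma> (f0 (x \<otimes>\<^bsub>G\<^esub> y)) = f (x \<otimes>\<^bsub>G\<^esub> y)" using xy by (intro \<sigma>f) simp
          then show "\<sigma> (a \<otimes>\<^bsub>B\<^esub> b) = \<sigma> a \<otimes>\<^bsub>B\<^esub> \<sigma> b" using xy by (simp add: \<sigma>f)
        qed
        moreover have "bij_betw \<sigma> (carrier B) (carrier B)"
        proof (rule bij_betwI')
          fix a b assume ab: "a \<in> carrier B" "b \<in> carrier B"
          obtain x y where xy: "x \<in> carrier G" "a = f0 x" "y \<in> carrier G" "b = f0 y"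
            using f0s ab by (metis imageE)
          show "(\<sigma> a = \<sigma> b) = (a = b)" using xy \<sigma>f eq_iff by simp
          show "\<sigma> a \<in> carrier B" using xy \<sigma>f by simp
        next
          fix c assume "c \<in> carrier B"
          then obtain x where "x \<in> carrier G" "c = f x" using fs by (metis imageE)
          then show "\<exists>a\<in>carrier B. c = \<sigma> a" using \<sigma>f f0.hom_closed by metis
        qed
        ultimately have "\<sigma> \<in> auto B" by (simp add: auto_def Bij_def \<sigma>_def)
        moreover have "f = ?F \<sigma>"
          using fs(2) by (intro extensionalityI[of f "carrier G"]) (auto simp: \<sigma>f)
        ultimately show "f \<in> ?F ` auto B" by blast
      qed
    qed
  qed
  then show ?thesis by (simp add: bij_betw_same_card)
qed

text \<open>Written with \<open>1 mod int q\<close> so that the entries stay in range for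
  \<open>q = 1\<close> as well.\<close>

definition unit_vec :: "nat \<Rightarrow> nat \<Rightarrow> nat \<Rightarrow> nat \<Rightarrow> int" where
  "unit_vec q n i = (\<lambda>j\<in>{..<n}. if j = i then 1 mod int q else 0)"

lemma unit_vec_closed: "q > 0 \<Longrightarrow> unit_vec q n i \<in> carrier (zmod_vec q n)"
  by (auto simp: unit_vec_def carrier_zmod_vec)

lemma generate_unit_vecs:
  assumes "q > 0"
  shows "generate (zmod_vec q n) (unit_vec q n ` {..<n}) = carrier (zmod_vec q n)"
proof
  interpret comm_group "zmod_vec q n" by (rule comm_group_zmod_vec)
  show "generate (zmod_vec q n) (unit_vec q n ` {..<n}) \<subseteq> carrier (zmod_vec q n)"
    by (rule generate_incl) (use unit_vec_closed[OF assms] in auto)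
  show "carrier (zmod_vec q n) \<subseteq> generate (zmod_vec q n) (unit_vec q n ` {..<n})"
  proof
    fix x assume "x \<in> carrier (zmod_vec q n)"
    then have x: "x \<in> vecs q n" using assms by (simp add: carrier_zmod_vec)
    have "(\<lambda>i\<in>{..<n}. (\<Sum>j<n. x j * unit_vec q n j i) mod int q) \<in>
        generate (zmod_vec q n) (unit_vec q n ` {..<n})"
    proof (rule linear_combination_in_generate[OF assms])
      show "unit_vec q n j \<in> vecs q n" for j
        using unit_vec_closed[OF assms] assms by (simp only: carrier_zmod_vec)
      show "0 \<le> x j" if "j \<in> {..<n}" for j using x that by (auto simp: PiE_iff)
    qed simp
    moreover have "(\<lambda>i\<in>{..<n}. (\<Sum>j<n. x j * unit_vec q n j i) mod int q) = x"
    proof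
      fix i
      show "(\<lambda>i\<in>{..<n}. (\<Sum>j<n. x j * unit_vec q n j i) mod int q) i = x i"
      proof (cases "i < n")
        case True
        have "(\<Sum>j<n. x j * unit_vec q n j i) = (\<Sum>j<n. if j = i then x i * (1 mod int q) else 0)"
          using True by (intro sum.cong) (auto simp: unit_vec_def)
        also have "\<dots> = x i * (1 mod int q)" using True by simp
        finally show ?thesis using True x by (auto simp: mod_simps PiE_iff)
      qed (use x in \<open>auto simp: PiE_iff extensional_def\<close>)
    qed
    ultimately show "x \<in> generate (zmod_vec q n) (unit_vec q n ` {..<n})" by simp
  qed
qed

text \<open>Among abelian groups killed by \<open>q\<close>, the group (Z/q)^n is free on the unit
  vectors: \<open>x\<close> is sent to the product of the powers of \<open>b i\<close> with exponent
  \<open>x i\<close>.\<close>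

lemma hom_with_values:
  assumes q: "q > 0" and B: "comm_group B" and pw: "\<And>a. a \<in> carrier B \<Longrightarrow> a [^]\<^bsub>B\<^esub> q = \<one>\<^bsub>B\<^esub>"
    and b: "\<And>i. i < n \<Longrightarrow> b i \<in> carrier B"
  shows "\<exists>f\<in>hom (zmod_vec q n) B. f \<in> extensional (carrier (zmod_vec q n)) \<and>
    (\<forall>i<n. f (unit_vec q n i) = b i)"
proof -
  interpret B: comm_group B by (rule B)
  interpret V: comm_group "zmod_vec q n" by (rule comm_group_zmod_vec)
  note car = carrier_zmod_vec[OF q, of n]
  \<comment> \<open>Exponents in \<open>B\<close> may be reduced modulo \<open>q\<close>; this makes
    the product formula compatible with addition modulo \<open>q\<close>.\<close>
  have pmod: "a [^]\<^bsub>B\<^esub> nat (m mod int q) = a [^]\<^bsub>B\<^esub> nat m" if a: "a \<in> carrier B" and m: "m \<ge> 0" for a m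
  proof -
    have "nat m = q * nat (m div int q) + nat (m mod int q)"
      using m q by (simp add: nat_mult_distrib[symmetric] nat_add_distrib[symmetric] pos_imp_zdiv_nonneg_iff nat_div_distrib nat_mod_distrib)
    then have "a [^]\<^bsub>B\<^esub> nat m = (a [^]\<^bsub>B\<^esub> q) [^]\<^bsub>B\<^esub> nat (m div int q) \<otimes>\<^bsub>B\<^esub> a [^]\<^bsub>B\<^esub> nat (m mod int q)"
      using a by (metis B.nat_pow_mult B.nat_pow_pow)
    then show ?thesis using a pw by simp
  qed
  define f where "f = restrict (\<lambda>x. finprod B (\<lambda>i. b i [^]\<^bsub>B\<^esub> nat (x i)) {..<n}) (carrier (zmod_vec q n))"
  have closed: "(\<lambda>i. b i [^]\<^bsub>B\<^esub> nat (x i)) \<in> {..<n} \<rightarrow> carrier B" for x :: "nat \<Rightarrow> int"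
    using b by auto
  show ?thesis
  proof (intro bexI[of _ f] conjI allI impI)
    show "f \<in> extensional (carrier (zmod_vec q n))" by (simp add: f_def)
    show "f \<in> hom (zmod_vec q n) B"
    proof (rule homI)
      fix x y assume xy: "x \<in> carrier (zmod_vec q n)" "y \<in> carrier (zmod_vec q n)"
      show "f x \<in> carrier B" using xy B.finprod_closed[OF closed] by (simp add: f_def)
      have "f (x \<otimes>\<^bsub>zmod_vec q n\<^esub> y) = finprod B (\<lambda>i. b i [^]\<^bsub>B\<^esub> nat ((x \<otimes>\<^bsub>zmod_vec q n\<^esub> y) i)) {..<n}"
        using xy by (simp add: f_def)
      also have "\<dots> = finprod B (\<lambda>i. b i [^]\<^bsub>B\<^esub> nat (x i) \<otimes>\<^bsub>B\<^esub> b i [^]\<^bsub>B\<^esub> nat (y i)) {..<n}"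
      proof (rule B.finprod_cong'[OF refl])
        show "(\<lambda>i. b i [^]\<^bsub>B\<^esub> nat (x i) \<otimes>\<^bsub>B\<^esub> b i [^]\<^bsub>B\<^esub> nat (y i)) \<in> {..<n} \<rightarrow> carrier B"
          using b by auto
        fix i assume i: "i \<in> {..<n}"
        have nn: "0 \<le> x i" "0 \<le> y i" using xy i unfolding car by (auto simp: PiE_iff)
        show "b i [^]\<^bsub>B\<^esub> nat ((x \<otimes>\<^bsub>zmod_vec q n\<^esub> y) i) = b i [^]\<^bsub>B\<^esub> nat (x i) \<otimes>\<^bsub>B\<^esub> b i [^]\<^bsub>B\<^esub> nat (y i)"
        proof -
          have bi: "b i \<in> carrier B" using b i by simp
          have "(x \<otimes>\<^bsub>zmod_vec q n\<^esub> y) i = (x i + y i) mod int q" using i by (simp add: mult_zmod_vec)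
          then show ?thesis
            by (simp only: pmod[OF bi add_nonneg_nonneg[OF nn]] nat_add_distrib[OF nn] B.nat_pow_mult[OF bi])
        qed
      qed
      also have "\<dots> = f x \<otimes>\<^bsub>B\<^esub> f y"
        using xy B.finprod_multf[OF closed closed] by (simp add: f_def)
      finally show "f (x \<otimes>\<^bsub>zmod_vec q n\<^esub> y) = f x \<otimes>\<^bsub>B\<^esub> f y" .
    qed
    fix i assume i: "i < n"
    have "f (unit_vec q n i) = finprod B (\<lambda>j. if i = j then b j else \<one>\<^bsub>B\<^esub>) {..<n}"
      unfolding f_def using unit_vec_closed[OF q, of n i] 
    proof (simp, intro B.finprod_cong'[OF refl])
      fix j assume j: "j \<in> {..<n}"
      have "b j [^]\<^bsub>B\<^esub> nat (1 mod int q) = b j" using pmod[of "b j" 1] b j by simp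
      then show "b j [^]\<^bsub>B\<^esub> nat (unit_vec q n i j) = (if i = j then b j else \<one>\<^bsub>B\<^esub>)"
        using j by (auto simp: unit_vec_def)
    qed (use b in auto)
    also have "\<dots> = b i" using i b by (intro B.finprod_singleton) auto
    finally show "f (unit_vec q n i) = b i" .
  qed
qed

text \<open>A homomorphism is determined by its values on the unit vectors, which are arbitrary by
  \<open>hom_with_values\<close>, and it is onto exactly when these values generate
  \<open>B\<close>.\<close>

lemma card_epis_zmod_vec:
  assumes q: "q > 0" and B: "comm_group B" and pw: "\<And>a. a \<in> carrier B \<Longrightarrow> a [^]\<^bsub>B\<^esub> q = \<one>\<^bsub>B\<^esub>"
  shows "card (epis (zmod_vec q n) B) =
    card {b\<in>PiE {..<n} (\<lambda>_. carrier B). generate B (b ` {..<n}) = carrier B}"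
proof -
  let ?V = "zmod_vec q n" and ?T = "{b\<in>PiE {..<n} (\<lambda>_. carrier B). generate B (b ` {..<n}) = carrier B}"
  interpret B: comm_group B by (rule B)
  interpret V: comm_group ?V by (rule comm_group_zmod_vec)
  have uc: "unit_vec q n ` {..<n} \<subseteq> carrier ?V" using unit_vec_closed[OF q] by auto
  let ?F = "\<lambda>f. \<lambda>i\<in>{..<n}. f (unit_vec q n i)"
  have img: "generate B (?F f ` {..<n}) = f ` carrier ?V" if "f \<in> hom ?V B" for f
  proof -
    interpret f: group_hom ?V B f
      using that by (intro group_homI V.is_group B.is_group)
    have "?F f ` {..<n} = f ` (unit_vec q n ` {..<n})" by (auto simp: image_image)
    then show ?thesis using f.generate_img[OF uc] generate_unit_vecs[OF q] by simp
  qed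
  have "bij_betw ?F (epis ?V B) ?T"
    unfolding bij_betw_def
  proof
    show "inj_on ?F (epis ?V B)"
    proof (rule inj_onI)
      fix f g assume fg: "f \<in> epis ?V B" "g \<in> epis ?V B" "?F f = ?F g"
      have e: "f s = g s" if s: "s \<in> unit_vec q n ` {..<n}" for s
      proof -
        obtain i where i: "i < n" "s = unit_vec q n i" using s by auto
        show ?thesis using fun_cong[OF fg(3), of i] i by simp
      qed
      have "f x = g x" if "x \<in> carrier ?V" for x
        using V.homs_eq_on_generate[OF epis_group_hom[OF V.is_group B.is_group fg(1)]
            epis_group_hom[OF V.is_group B.is_group fg(2)] uc e] that generate_unit_vecs[OF q] by simp
      then show "f = g" using fg(1,2) by (intro extensionalityI[of f "carrier ?V"]) (auto simp: epis_def)
    qed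
    show "?F ` epis ?V B = ?T"
    proof
      show "?F ` epis ?V B \<subseteq> ?T"
      proof (rule image_subsetI)
        fix f assume f: "f \<in> epis ?V B"
        then have fh: "f \<in> hom ?V B" "f ` carrier ?V = carrier B" by (auto simp: epis_def)
        have "?F f \<in> PiE {..<n} (\<lambda>_. carrier B)"
          using fh(1) unit_vec_closed[OF q] by (auto simp: hom_def)
        then show "?F f \<in> ?T"
          using img[OF fh(1)] fh(2) by simp
      qed
      show "?T \<subseteq> ?F ` epis ?V B"
      proof
        fix b assume b: "b \<in> ?T"
        then have bc: "b i \<in> carrier B" if "i < n" for i using that by blast
        have "\<exists>f\<in>hom ?V B. f \<in> extensional (carrier ?V) \<and> (\<forall>i<n. f (unit_vec q n i) = b i)"
          by (rule hom_with_values[OF q B pw bc])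
        then obtain f where f: "f \<in> hom ?V B" "f \<in> extensional (carrier ?V)"
          "\<And>i. i < n \<Longrightarrow> f (unit_vec q n i) = b i"
          by blast
        have Ff: "?F f = b"
        proof
          fix i show "?F f i = b i" using b f(3) by (cases "i < n") (auto simp: PiE_iff extensional_def)
        qed
        have "f \<in> epis ?V B" using img[OF f(1)] f b unfolding Ff by (simp add: epis_def)
        then show "b \<in> ?F ` epis ?V B" using Ff by blast
      qed
    qed
  qed
  then show ?thesis by (rule bij_betw_same_card)
qed

text \<open>For kernels of epimorphisms both aspects of the \<open>p\<close>-torsion matter: its
  size, and the fact that its elements are multiples of \<open>s\<close>.\<close>

lemma torsion_zmod_vec:
  assumes "p > 0" "q = p * s" "s > 0"
  shows "(\<lambda>y. \<lambda>i\<in>{..<n}. int s * y i) ` vecs p n = {x \<in> vecs q n. \<forall>i<n. int q dvd int p * x i}"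
    (is "?F ` _ = _")
proof
  show "?F ` vecs p n \<subseteq> {x \<in> vecs q n. \<forall>i<n. int q dvd int p * x i}"
  proof (rule image_subsetI)
    fix y assume y: "y \<in> vecs p n"
    have "int s * y i \<in> {0..<int q}" if "i < n" for i
    proof -
      have "0 \<le> y i" "y i < int p" using y that by (auto simp: PiE_iff)
      then show ?thesis using assms by (simp add: mult.commute)
    qed
    then have "?F y \<in> vecs q n" by (intro restrict_PiE_iff[THEN iffD2] ballI) simp
    then show "?F y \<in> {x \<in> vecs q n. \<forall>i<n. int q dvd int p * x i}"
      using assms by simp
  qed
  show "{x \<in> vecs q n. \<forall>i<n. int q dvd int p * x i} \<subseteq> ?F ` vecs p n"
  proof
    fix x assume x: "x \<in> {x \<in> vecs q n. \<forall>i<n. int q dvd int p * x i}"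
    define y where "y = (\<lambda>i\<in>{..<n}. x i div int s)"
    have xs: "x i = int s * (x i div int s)" if "i < n" for i
    proof -
      have "int p * int s dvd int p * x i" using x that assms by auto
      then have "int s dvd x i" using assms by simp
      then show ?thesis by simp
    qed
    have "y i \<in> {0..<int p}" if "i < n" for i
    proof -
      have "0 \<le> x i" "x i < int q" using x that by (auto simp: PiE_iff)
      then have "0 \<le> int s * (x i div int s)" "int s * (x i div int s) < int s * int p"
        using xs[OF that] assms by (simp_all add: mult.commute)
      then show ?thesis using assms that by (simp add: y_def zero_le_mult_iff)
    qed
    then have "y \<in> vecs p n" by (auto simp: y_def)
    moreover have "x = ?F y"
    proof
      fix i show "x i = ?F y i"
        using xs[of i] x by (cases "i < n") (auto simp: y_def PiE_iff extensional_def)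
    qed
    ultimately show "x \<in> ?F ` vecs p n" by blast
  qed
qed

lemma card_torsion_zmod_vec:
  assumes "p > 0" "q = p * s" "s > 0"
  shows "card {x \<in> vecs q n. \<forall>i<n. int q dvd int p * x i} = p ^ n"
proof -
  let ?F = "\<lambda>y. \<lambda>i\<in>{..<n}. int s * y i"
  have "inj_on ?F (vecs p n)"
  proof (rule inj_onI)
    fix y z assume yz: "y \<in> vecs p n" "z \<in> vecs p n" "?F y = ?F z"
    show "y = z"
    proof (rule PiE_ext[OF yz(1,2)])
      fix i assume "i \<in> {..<n}"
      then show "y i = z i" using fun_cong[OF yz(3), of i] assms by simp
    qed
  qed
  then have "card (?F ` vecs p n) = p ^ n" by (simp only: card_image card_vecs)
  then show ?thesis by (simp only: torsion_zmod_vec[OF assms])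
qed

text \<open>The kernel has rank \<open>n\<close> whatever \<open>f\<close> is: as
  \<open>q = p ^ Suc r\<close>, every \<open>p\<close>-torsion vector is a
  \<open>p ^ r\<close>-multiple, so \<open>f\<close> kills it and the kernel contains all
  \<open>p ^ n\<close> of them. Their number is the index of the \<open>p\<close>-th powers in the
  kernel, so \<open>card_generating_tuples\<close> applies with \<open>d = n\<close>.\<close>

lemma card_generating_tuples_kernel:
  assumes p: "prime p" and q: "q = p ^ Suc r" and B: "comm_group B" and ord: "order B = p ^ r"
    and finB: "finite (carrier B)" and f: "f \<in> epis (zmod_vec q n) B"
  shows "real (card {C\<in>PiE {..<N} (\<lambda>_. vecs q n).
      generate (zmod_vec q n) (C ` {..<N}) = kernel (zmod_vec q n) B f})
    = (real (q ^ n) / real (order B)) ^ N * gen_prob p N n"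
proof -
  let ?V = "zmod_vec q n" and ?L = "kernel (zmod_vec q n) B f"
  have p0: "p > 0" using p prime_gt_0_nat by simp
  have q0: "q > 0" using p0 q by simp
  interpret V: comm_group ?V by (rule comm_group_zmod_vec)
  interpret B: comm_group B by (rule B)
  interpret f: group_hom ?V B f by (rule epis_group_hom[OF V.is_group B.is_group f])
  note car = carrier_zmod_vec[OF q0, of n]
  have fs: "f ` carrier ?V = carrier B" using f by (simp add: epis_def)
  have sL: "subgroup ?L ?V" by (rule f.subgroup_kernel)
  have Lc: "?L \<subseteq> carrier ?V" by (rule subgroup.subset[OF sL])
  have finV: "finite (carrier ?V)" using car finite_vecs by simp
  have finL: "finite ?L" using Lc finV by (rule finite_subset)
  let ?G = "?V\<lparr>carrier := ?L\<rparr>"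
  have gG: "group ?G" by (rule V.subgroup_imp_group[OF sL])
  interpret L: comm_group ?G
    by (rule group.group_comm_groupI[OF gG]) (use Lc V.m_comm in auto)
  have powL: "x [^]\<^bsub>?G\<^esub> m = x [^]\<^bsub>?V\<^esub> m" for x and m :: nat
    by (simp add: nat_pow_def)
  have cardL: "card ?L * order B = q ^ n"
    using f.card_kernel_mult_image fs car card_vecs[of n q] by (simp add: order_def)
  have ordB: "order B > 0" using ord p0 by simp
  have "card ?L dvd p ^ (Suc r * n)" using cardL by (metis dvd_triv_left power_mult q)
  then obtain e where e: "card ?L = p ^ e" using p by (metis divides_primepow_nat)
  have ker: "{x \<in> ?L. x [^]\<^bsub>?V\<^esub> p = \<one>\<^bsub>?V\<^esub>} = {x \<in> vecs q n. \<forall>i<n. int q dvd int p * x i}"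
  proof -
    have iff: "x [^]\<^bsub>?V\<^esub> p = \<one>\<^bsub>?V\<^esub> \<longleftrightarrow> (\<forall>i<n. int q dvd int p * x i)" if "x \<in> carrier ?V" for x
    proof -
      have "x [^]\<^bsub>?V\<^esub> p = \<one>\<^bsub>?V\<^esub> \<longleftrightarrow> (\<lambda>i\<in>{..<n}. (int p * x i) mod int q) = (\<lambda>i\<in>{..<n}. 0)"
        unfolding zmod_vec_pow[OF that] by (simp add: zmod_vec_def)
      also have "\<dots> \<longleftrightarrow> (\<forall>i<n. (int p * x i) mod int q = 0)"
        by (auto simp: restrict_def fun_eq_iff)
      finally show ?thesis by (simp add: dvd_eq_mod_eq_0)
    qed
    have "x \<in> ?L" if x: "x \<in> vecs q n" "\<forall>i<n. int q dvd int p * x i" for x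
    proof -
      have "x \<in> (\<lambda>y. \<lambda>i\<in>{..<n}. int (p ^ r) * y i) ` vecs p n"
        using x p0 by (subst torsion_zmod_vec[of p q]) (auto simp: q)
      then obtain y where y: "y \<in> vecs p n" "x = (\<lambda>i\<in>{..<n}. int (p ^ r) * y i)" by blast
      have yi: "0 \<le> y i" "y i < int p" if "i < n" for i using y(1) that by (auto simp: PiE_iff)
      have "int p \<le> int q" using p0 by (simp add: q)
      then have yc: "y \<in> carrier ?V"
        unfolding car using y(1) by (intro subsetD[OF PiE_mono y(1)]) auto
      have "x = y [^]\<^bsub>?V\<^esub> (p ^ r)"
        unfolding zmod_vec_pow[OF yc] y(2)
        by (intro restrict_ext) (use yi p0 in \<open>simp add: q mult.commute\<close>)
      then have "f x = f y [^]\<^bsub>B\<^esub> order B" using f.hom_nat_pow[OF yc] ord by simp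
      also have "\<dots> = \<one>\<^bsub>B\<^esub>" using yc by (intro B.pow_order_eq_1) simp
      finally show ?thesis using x(1) car by (simp add: kernel_def)
    qed
    then show ?thesis using iff Lc car by blast
  qed
  have "card ?L = card ((\<lambda>x. x [^]\<^bsub>?G\<^esub> p) ` ?L) * p ^ n"
  proof -
    interpret h: group_hom ?G ?G "\<lambda>x. x [^]\<^bsub>?G\<^esub> p"
      by (intro group_homI gG homI L.nat_pow_closed L.nat_pow_distrib)
    have "kernel ?G ?G (\<lambda>x. x [^]\<^bsub>?G\<^esub> p) = {x \<in> carrier ?G. x [^]\<^bsub>?G\<^esub> p = \<one>\<^bsub>?G\<^esub>}"
      by (rule kernel_def)
    also have "\<dots> = {x \<in> ?L. x [^]\<^bsub>?V\<^esub> p = \<one>\<^bsub>?V\<^esub>}" unfolding powL by simp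
    finally have "card (kernel ?G ?G (\<lambda>x. x [^]\<^bsub>?G\<^esub> p)) = card {x \<in> vecs q n. \<forall>i<n. int q dvd int p * x i}"
      by (simp only: ker)
    also have "\<dots> = p ^ n"
      by (rule card_torsion_zmod_vec[OF p0, where s = "p ^ r"]) (use q p0 in auto)
    finally have "card (kernel ?G ?G (\<lambda>x. x [^]\<^bsub>?G\<^esub> p)) = p ^ n" .
    then show ?thesis using h.card_kernel_mult_image by (simp add: mult.commute)
  qed
  then have "real (card {C\<in>PiE {..<N} (\<lambda>_. ?L). generate ?G (C ` {..<N}) = ?L})
      = real (card ?L) ^ N * gen_prob p N n"
    using L.card_generating_tuples[OF _ p, of e n N] finL e by (simp add: order_def)
  also have "{C\<in>PiE {..<N} (\<lambda>_. ?L). generate ?G (C ` {..<N}) = ?L} =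
     {C\<in>PiE {..<N} (\<lambda>_. vecs q n). generate ?V (C ` {..<N}) = ?L}"
  proof (rule Collect_cong, rule iffI)
    fix C assume "C \<in> PiE {..<N} (\<lambda>_. ?L) \<and> generate ?G (C ` {..<N}) = ?L"
    then have C: "C \<in> PiE {..<N} (\<lambda>_. ?L)" "generate ?G (C ` {..<N}) = ?L" by blast+
    have "C ` {..<N} \<subseteq> ?L" using C by blast
    then have "generate ?V (C ` {..<N}) = ?L" using V.generate_consistent[OF _ sL] C(2) by metis
    moreover have "C \<in> PiE {..<N} (\<lambda>_. vecs q n)"
      using C(1) Lc unfolding car by (rule subsetD[OF PiE_mono, rotated])
    ultimately show "C \<in> PiE {..<N} (\<lambda>_. vecs q n) \<and> generate ?V (C ` {..<N}) = ?L" by blast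
  next
    fix C assume "C \<in> PiE {..<N} (\<lambda>_. vecs q n) \<and> generate ?V (C ` {..<N}) = ?L"
    then have C: "C \<in> PiE {..<N} (\<lambda>_. vecs q n)" "generate ?V (C ` {..<N}) = ?L" by blast+
    have "C ` {..<N} \<subseteq> generate ?V (C ` {..<N})" by (auto intro: generate.incl)
    then have CL: "C ` {..<N} \<subseteq> ?L" using C by simp
    then have "generate ?G (C ` {..<N}) = ?L" using V.generate_consistent[OF CL sL] C(2) by simp
    moreover have "C \<in> PiE {..<N} (\<lambda>_. ?L)"
      using C(1) CL by (auto simp only: PiE_def Pi_def extensional_def image_subset_iff)
    ultimately show "C \<in> PiE {..<N} (\<lambda>_. ?L) \<and> generate ?G (C ` {..<N}) = ?L" by blast
  qed
  also have "real (card ?L) = real (q ^ n) / real (order B)"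
    using cardL ordB by (metis nonzero_mult_div_cancel_right of_nat_0_less_iff of_nat_mult less_irrefl)
  finally show ?thesis .
qed

lemma card_filter_eq_sum:
  "finite A \<Longrightarrow> card {x \<in> A. P x} = (\<Sum>x\<in>A. if P x then 1 else 0)"
  using sum.inter_filter[of A "\<lambda>_. 1::nat" P] by simp

text \<open>Pairs of a tuple and an epimorphism whose kernel it spans are summed in both orders. On
  the right, \<open>order B ^ n * gen_prob p n d\<close> counts epimorphisms, \<open>d\<close> being
  the rank of \<open>B\<close>, and the remaining factor counts the tuples for one kernel.\<close>

lemma uniform_cok_count:
  assumes p: "prime p" and q: "q = p ^ Suc r" and B: "comm_group B" and ord: "order B = p ^ r"
    and finB: "finite (carrier B)" 
    and d: "card (carrier B) = card ((\<lambda>x. x [^]\<^bsub>B\<^esub> p) ` carrier B) * p ^ d"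
  shows "real (card {C\<in>PiE {..<N} (\<lambda>_. vecs q n).
      (zmod_vec q n Mod generate (zmod_vec q n) (C ` {..<N})) \<cong> B}) * real (card (auto B))
    = real (order B) ^ n * gen_prob p n d * ((real (q ^ n) / real (order B)) ^ N * gen_prob p N n)"
proof -
  let ?V = "zmod_vec q n"
  have p0: "p > 0" using p prime_gt_0_nat by simp
  have q0: "q > 0" using p0 q by simp
  interpret V: comm_group ?V by (rule comm_group_zmod_vec)
  interpret B: comm_group B by (rule B)
  note car = carrier_zmod_vec[OF q0, of n]
  let ?X = "PiE {..<N} (\<lambda>_. vecs q n)"
  let ?g = "\<lambda>C. generate ?V (C ` {..<N})"
  have finX: "finite ?X" by (intro finite_PiE finite_vecs) simp
  have finE: "finite (epis ?V B)" by (intro finite_epis finB) (simp add: car finite_vecs)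
  have pw: "a [^]\<^bsub>B\<^esub> q = \<one>\<^bsub>B\<^esub>" if "a \<in> carrier B" for a
  proof -
    have "q = order B * p" using ord q by simp
    then show ?thesis using that B.pow_order_eq_1[OF that] by (metis B.nat_pow_pow B.nat_pow_one)
  qed
  have cnt: "card {f \<in> epis ?V B. kernel ?V B f = ?g C} = (if (?V Mod ?g C) \<cong> B then card (auto B) else 0)"
    if C: "C \<in> ?X" for C
  proof (cases "(?V Mod ?g C) \<cong> B")
    case True
    have "C ` {..<N} \<subseteq> carrier ?V" using C unfolding car by blast
    then have "?g C \<lhd> ?V" by (intro V.subgroup_imp_normal V.generate_is_subgroup)
    then show ?thesis using card_epis_with_kernel[OF V.is_group B.is_group _ True] True by simp
  next
    case False
    have "{f \<in> epis ?V B. kernel ?V B f = ?g C} = {}"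
    proof (rule ccontr)
      assume "{f \<in> epis ?V B. kernel ?V B f = ?g C} \<noteq> {}"
      then obtain f where f: "f \<in> epis ?V B" "kernel ?V B f = ?g C" by blast
      interpret f: group_hom ?V B f by (rule epis_group_hom[OF V.is_group B.is_group f(1)])
      have "(?V Mod kernel ?V B f) \<cong> B" using f by (intro f.FactGroup_iso) (simp add: epis_def)
      then show False using False f(2) by simp
    qed
    then have "card {f \<in> epis ?V B. kernel ?V B f = ?g C} = 0" by (simp only: card.empty)
    then show ?thesis using False by (simp only: if_False)
  qed
  have "card {C\<in>?X. (?V Mod ?g C) \<cong> B} * card (auto B) =
      (\<Sum>C\<in>?X. if (?V Mod ?g C) \<cong> B then card (auto B) else 0)"
    unfolding card_filter_eq_sum[OF finX] sum_distrib_right by (intro sum.cong refl) simp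
  also have "\<dots> = (\<Sum>C\<in>?X. card {f \<in> epis ?V B. kernel ?V B f = ?g C})"
    by (intro sum.cong refl) (simp add: cnt)
  also have "\<dots> = (\<Sum>C\<in>?X. \<Sum>f\<in>epis ?V B. if kernel ?V B f = ?g C then 1 else 0)"
    unfolding card_filter_eq_sum[OF finE] by (rule refl)
  also have "\<dots> = (\<Sum>f\<in>epis ?V B. \<Sum>C\<in>?X. if kernel ?V B f = ?g C then 1 else 0)"
    by (rule sum.swap)
  also have "\<dots> = (\<Sum>f\<in>epis ?V B. card {C\<in>?X. ?g C = kernel ?V B f})"
    unfolding card_filter_eq_sum[OF finX] by (intro sum.cong refl) (simp only: eq_commute)
  finally have "real (card {C\<in>?X. (?V Mod ?g C) \<cong> B}) * real (card (auto B)) =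
      (\<Sum>f\<in>epis ?V B. real (card {C\<in>?X. ?g C = kernel ?V B f}))"
    unfolding of_nat_mult[symmetric] of_nat_sum[symmetric] by (rule arg_cong)
  also have "\<dots> = (\<Sum>f\<in>epis ?V B. (real (q ^ n) / real (order B)) ^ N * gen_prob p N n)"
    by (intro sum.cong refl card_generating_tuples_kernel[OF p q B ord finB])
  also have "\<dots> = real (card (epis ?V B)) * ((real (q ^ n) / real (order B)) ^ N * gen_prob p N n)"
    by simp
  also have "card (epis ?V B) = card {b\<in>PiE {..<n} (\<lambda>_. carrier B). generate B (b ` {..<n}) = carrier B}"
    by (rule card_epis_zmod_vec[OF q0 B pw])
  also have "real \<dots> = real (order B) ^ n * gen_prob p n d"
    using B.card_generating_tuples[OF finB p ord d] by (simp add: order_def)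
  finally show ?thesis .
qed

section \<open>Random \<open>p\<close>-adic matrices\<close>

text \<open>Preimages of sets of residues are cylinders, hence open in the inverse limit
  topology.\<close>

lemma padic_coordinate_measurable: "(\<lambda>x. x k) \<in> measurable (padic_borel p) (count_space UNIV)"
proof (rule measurableI)
  fix A :: "int set"
  let ?c = "carrier (padic_int p)"
  have gen: "{U. openin (padic_topology p) U} \<subseteq> Pow ?c"
    using openin_subset by (fastforce simp: padic_topology_def)
  have sp: "space (padic_borel p) = ?c" by (simp add: padic_borel_def space_measure_of_conv)
  have "openin (product_topology (\<lambda>_. discrete_topology (UNIV :: int set)) (UNIV :: nat set)) {x. x k \<in> A}"
    using openin_continuous_map_preimage[OF continuous_map_product_projection[of k UNIV "\<lambda>_. discrete_topology UNIV"], of A]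
    by simp
  then have "openin (padic_topology p) ((\<lambda>x. x k) -` A \<inter> ?c)"
    unfolding padic_topology_def openin_subtopology by (intro exI[of _ "{x. x k \<in> A}"]) auto
  then show "(\<lambda>x. x k) -` A \<inter> space (padic_borel p) \<in> sets (padic_borel p)"
    unfolding sp using gen by (simp add: padic_borel_def sets_measure_of)
qed auto

lemma space_padic_borel: "space (padic_borel p) = carrier (padic_int p)"
  by (simp add: padic_borel_def space_measure_of_conv)

lemma (in prob_space) sum_prob_fibres:
  assumes "finite S" and Y: "Y \<in> measurable M (count_space UNIV)"
  shows "(\<Sum>a\<in>S. prob {\<omega> \<in> space M. Y \<omega> = a}) = prob {\<omega> \<in> space M. Y \<omega> \<in> S}"
proof -
  have "{\<omega> \<in> space M. Y \<omega> \<in> S} = (\<Union>a\<in>S. {\<omega> \<in> space M. Y \<omega> = a})" by auto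
  moreover have "prob (\<Union>a\<in>S. {\<omega> \<in> space M. Y \<omega> = a}) = (\<Sum>a\<in>S. prob {\<omega> \<in> space M. Y \<omega> = a})"
  proof (rule finite_measure_finite_Union[OF assms(1)])
    have "{\<omega> \<in> space M. Y \<omega> = a} = Y -` {a} \<inter> space M" for a by auto
    then show "(\<lambda>a. {\<omega> \<in> space M. Y \<omega> = a}) ` S \<subseteq> events"
      using measurable_sets[OF Y] by auto
    show "disjoint_family_on (\<lambda>a. {\<omega> \<in> space M. Y \<omega> = a}) S"
      by (auto simp: disjoint_family_on_def)
  qed
  ultimately show ?thesis by simp
qed

text \<open>Modulo \<open>p ^ k\<close> the matrix takes finitely many values \<open>D\<close>, so
  the event is a finite disjoint union of events prescribing every entry, and independence factors
  the probability of each.\<close>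

lemma (in prob_space) span_prob_eq_prob:
  fixes X :: "nat \<Rightarrow> nat \<Rightarrow> 'a \<Rightarrow> nat \<Rightarrow> int"
  assumes p: "p > 0" and n: "n > 0" "N > 0"
    and indep: "indep_vars (\<lambda>_. padic_borel p) (\<lambda>(i, j). X i j) ({..<n} \<times> {..<N})"
  shows "prob {\<omega> \<in> space M. \<Phi> (generate (zmod_vec (p ^ k) n) ((\<lambda>j. \<lambda>i\<in>{..<n}. X i j \<omega> k) ` {..<N}))}
    = span_prob (p ^ k) n \<Phi> {..<N} (\<lambda>j i a. prob {\<omega> \<in> space M. X i j \<omega> k = a})"
proof -
  let ?V = "vecs (p ^ k) n" and ?I = "{..<n} \<times> {..<N}"
  let ?PE = "PiE {..<N} (\<lambda>_. ?V)"
  define C where "C \<omega> = (\<lambda>j\<in>{..<N}. \<lambda>i\<in>{..<n}. X i j \<omega> k)" for \<omega>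
  have meas: "X i j \<in> measurable M (padic_borel p)" if "i < n" "j < N" for i j
    using indep that unfolding indep_vars_def2 by auto
  have car: "X i j \<omega> \<in> carrier (padic_int p)" if "i < n" "j < N" "\<omega> \<in> space M" for i j \<omega>
    using measurable_space[OF meas[OF that(1,2)] that(3)] by (simp add: space_padic_borel)
  have CV: "C \<omega> \<in> ?PE" if w: "\<omega> \<in> space M" for \<omega>
  proof -
    have "X i j \<omega> k \<in> {0..<int (p ^ k)}" if "i < n" "j < N" for i j
      using car[OF that w] by (simp add: padic_int_def padic_int_set_def)
    then show ?thesis unfolding C_def by (intro restrict_PiE_iff[THEN iffD2] ballI) auto
  qed
  have indep': "indep_vars (\<lambda>_. count_space UNIV) (\<lambda>ij \<omega>. (case ij of (i, j) \<Rightarrow> X i j \<omega>) k) ?I"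
    using indep_vars_compose2[OF indep, of "\<lambda>_ x. x k" "\<lambda>_. count_space UNIV"] padic_coordinate_measurable
    by (simp add: case_prod_unfold)
  have PD: "{\<omega> \<in> space M. C \<omega> = D} \<in> events \<and>
      prob {\<omega> \<in> space M. C \<omega> = D} = mat_law n {..<N} (\<lambda>j i a. prob {\<omega> \<in> space M. X i j \<omega> k = a}) D"
    if D: "D \<in> ?PE" for D
  proof -
    let ?Y = "\<lambda>ij \<omega>. (case ij of (i, j) \<Rightarrow> X i j \<omega>) k"
    let ?A = "\<lambda>ij. {D (snd ij) (fst ij)}"
    \<comment> \<open>Over an empty index set the intersection below would be \<open>UNIV\<close>
      instead of \<open>space M\<close>; \<open>n > 0\<close> and \<open>N > 0\<close> exclude
      this.\<close>
    have ne: "?I \<noteq> {}" using n by auto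
    have eq: "{\<omega> \<in> space M. C \<omega> = D} = (\<Inter>ij\<in>?I. ?Y ij -` ?A ij \<inter> space M)"
    proof (intro equalityI subsetI)
      fix \<omega> assume w: "\<omega> \<in> {\<omega> \<in> space M. C \<omega> = D}"
      have "X i j \<omega> k = D j i" if "i < n" "j < N" for i j
        using w that by (auto simp: C_def)
      then show "\<omega> \<in> (\<Inter>ij\<in>?I. ?Y ij -` ?A ij \<inter> space M)" using w by auto
    next
      fix \<omega> assume w: "\<omega> \<in> (\<Inter>ij\<in>?I. ?Y ij -` ?A ij \<inter> space M)"
      then have sp: "\<omega> \<in> space M" using ne by blast
      have e: "X i j \<omega> k = D j i" if "i < n" "j < N" for i j
        using INT_D[OF w, of "(i, j)"] that by auto
      have "C \<omega> = D"
      proof (rule PiE_ext[OF CV[OF sp] D])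
        fix j assume j: "j \<in> {..<N}"
        show "C \<omega> j = D j"
          by (rule PiE_ext[OF PiE_mem[OF CV[OF sp] j] PiE_mem[OF D j]]) (use e j in \<open>simp add: C_def\<close>)
      qed
      then show "\<omega> \<in> {\<omega> \<in> space M. C \<omega> = D}" using sp by simp
    qed
    have pr: "prob (\<Inter>ij\<in>?I. ?Y ij -` ?A ij \<inter> space M) = (\<Prod>ij\<in>?I. prob (?Y ij -` ?A ij \<inter> space M))"
      by (rule indep_varsD[OF indep' ne]) auto
    have "(\<Prod>ij\<in>?I. prob (?Y ij -` ?A ij \<inter> space M)) = (\<Prod>(i, j)\<in>?I. prob {\<omega> \<in> space M. X i j \<omega> k = D j i})"
      by (intro prod.cong refl) (auto intro!: arg_cong[of _ _ prob])
    also have "\<dots> = (\<Prod>i<n. \<Prod>j<N. prob {\<omega> \<in> space M. X i j \<omega> k = D j i})"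
      by (rule prod.cartesian_product[symmetric])
    also have "\<dots> = (\<Prod>j<N. \<Prod>i<n. prob {\<omega> \<in> space M. X i j \<omega> k = D j i})"
      by (rule prod.swap)
    finally have "prob {\<omega> \<in> space M. C \<omega> = D} = mat_law n {..<N} (\<lambda>j i a. prob {\<omega> \<in> space M. X i j \<omega> k = a}) D"
      using pr unfolding eq by (simp add: mat_law_def col_law_def)
    moreover have "{\<omega> \<in> space M. C \<omega> = D} \<in> events"
      unfolding eq
    proof (rule sets.finite_INT)
      fix ij assume "ij \<in> ?I"
      then have "?Y ij \<in> measurable M (count_space UNIV)" using indep' unfolding indep_vars_def2 by auto
      then show "?Y ij -` ?A ij \<inter> space M \<in> events" by (rule measurable_sets) simp
    qed (use ne in auto)
    ultimately show ?thesis by simp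
  qed
  define S where "S = {D \<in> ?PE. \<Phi> (generate (zmod_vec (p ^ k) n) (D ` {..<N}))}"
  define E where "E D = {\<omega> \<in> space M. C \<omega> = D}" for D
  define m where "m = (\<lambda>j i a. prob {\<omega> \<in> space M. X i j \<omega> k = a})"
  have finPE: "finite ?PE" by (intro finite_PiE finite_vecs) simp
  have SPE: "D \<in> ?PE" if "D \<in> S" for D using that unfolding S_def by blast
  have ED: "E D \<in> events" "prob (E D) = mat_law n {..<N} m D" if "D \<in> S" for D
    unfolding E_def m_def using PD[OF SPE[OF that]] by blast+
  have img: "(\<lambda>j. \<lambda>i\<in>{..<n}. X i j \<omega> k) ` {..<N} = C \<omega> ` {..<N}" for \<omega>
    by (intro image_cong refl) (simp add: C_def)
  have "{\<omega> \<in> space M. \<Phi> (generate (zmod_vec (p ^ k) n) ((\<lambda>j. \<lambda>i\<in>{..<n}. X i j \<omega> k) ` {..<N}))}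
     = (\<Union>D\<in>S. E D)"
    unfolding img S_def E_def using CV by blast
  also have "prob (\<Union>D\<in>S. E D) = (\<Sum>D\<in>S. prob (E D))"
  proof (rule finite_measure_finite_Union)
    show "finite S" unfolding S_def using finPE by (rule finite_subset[rotated]) blast
    show "E ` S \<subseteq> events" using ED(1) by blast
    show "disjoint_family_on E S" unfolding disjoint_family_on_def E_def by blast
  qed
  also have "(\<Sum>D\<in>S. prob (E D)) = (\<Sum>D\<in>S. mat_law n {..<N} m D)"
    by (simp add: ED(2))
  also have "(\<Sum>D\<in>S. mat_law n {..<N} m D) = (\<Sum>D\<in>?PE.
      if \<Phi> (generate (zmod_vec (p ^ k) n) (D ` {..<N})) then mat_law n {..<N} m D else 0)"
    unfolding S_def by (rule sum.inter_filter[OF finPE])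
  also have "\<dots> = span_prob (p ^ k) n \<Phi> {..<N} m"
    unfolding span_prob_def by (intro sum.cong refl) simp
  finally show ?thesis unfolding m_def .
qed

lemma (in prob_space) law_padic:
  assumes p: "p > 0" and X: "X \<in> measurable M (padic_borel p)"
  shows "law (p ^ k) (\<lambda>a. prob {\<omega> \<in> space M. X \<omega> k = a})"
proof -
  have Y: "(\<lambda>\<omega>. X \<omega> k) \<in> measurable M (count_space UNIV)"
    using measurable_comp[OF X padic_coordinate_measurable] by (simp add: comp_def)
  have "X \<omega> k \<in> {0..<int (p ^ k)}" if "\<omega> \<in> space M" for \<omega>
    using measurable_space[OF X that] unfolding space_padic_borel by (simp add: padic_int_def padic_int_set_def)
  then have "{\<omega> \<in> space M. X \<omega> k \<in> {0..<int (p ^ k)}} = space M" by blast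
  then show ?thesis
    using sum_prob_fibres[OF _ Y, of "{0..<int (p ^ k)}"] by (simp add: law_def prob_space)
qed

text \<open>Balancedness concerns the residue modulo \<open>p\<close>, which coherence reads off the
  residue modulo \<open>p ^ Suc r\<close>.\<close>

lemma (in prob_space) balanced_law_padic:
  assumes p: "p > 0" and X: "X \<in> measurable M (padic_borel p)" and bal: "balanced M p \<epsilon> X"
  shows "balanced_law p (p ^ Suc r) \<epsilon> (\<lambda>a. prob {\<omega> \<in> space M. X \<omega> (Suc r) = a})"
  unfolding balanced_law_def
proof
  fix t
  let ?k = "Suc r"
  have Y: "(\<lambda>\<omega>. X \<omega> ?k) \<in> measurable M (count_space UNIV)"
    using measurable_comp[OF X padic_coordinate_measurable] by (simp add: comp_def)
  have c: "X \<omega> \<in> carrier (padic_int p)" if "\<omega> \<in> space M" for \<omega>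
    using measurable_space[OF X that] unfolding space_padic_borel .
  have rng: "X \<omega> ?k \<in> {0..<int (p ^ ?k)}" if "\<omega> \<in> space M" for \<omega>
    using c[OF that] unfolding padic_int_def padic_int_set_def by (auto simp del: power_Suc)
  have red: "[X \<omega> ?k = X \<omega> 1] (mod int p)" if "\<omega> \<in> space M" for \<omega>
    using padic_coherent[OF c[OF that], of 1 ?k] by simp
  have "(\<Sum>a\<in>{a \<in> {0..<int (p ^ ?k)}. [a = t] (mod int p)}. prob {\<omega> \<in> space M. X \<omega> ?k = a})
     = prob {\<omega> \<in> space M. X \<omega> ?k \<in> {a \<in> {0..<int (p ^ ?k)}. [a = t] (mod int p)}}"
    by (rule sum_prob_fibres[OF finite_subset[of _ "{0..<int (p ^ ?k)}"] Y]) auto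
  also have "{\<omega> \<in> space M. X \<omega> ?k \<in> {a \<in> {0..<int (p ^ ?k)}. [a = t] (mod int p)}} =
      {\<omega> \<in> space M. [X \<omega> 1 = t] (mod int p)}"
    using rng red unfolding cong_def by auto
  also have "prob \<dots> \<le> 1 - \<epsilon>" using bal by (simp add: balanced_def)
  finally show "(\<Sum>a\<in>{a \<in> {0..<int (p ^ ?k)}. [a = t] (mod int p)}. prob {\<omega> \<in> space M. X \<omega> ?k = a}) \<le> 1 - \<epsilon>" .
qed

section \<open>Replacement of all columns and passage to the limit\<close>

lemma mat_law_cong:
  "(\<And>j. j \<in> J \<Longrightarrow> M j = M' j) \<Longrightarrow> mat_law n J M = mat_law n J M'"
  by (auto simp: mat_law_def intro!: ext prod.cong)

context char_bounded
begin

text \<open>A telescoping sum over hybrid laws whose first \<open>s\<close> columns are uniform.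
  These columns have no degenerate entries, which is why \<open>thin\<close> replaces
  \<open>D j\<close> by the empty set for \<open>j < s\<close>.\<close>

lemma swap_all_columns:
  fixes bb t :: real
  assumes M: "\<And>i j. i < n \<Longrightarrow> j < N \<Longrightarrow> law q (M j i)"
    and small: "\<And>i j. i < n \<Longrightarrow> j < N \<Longrightarrow> i \<notin> D j \<Longrightarrow> char_small q \<rho> (M j i)"
    and index: "\<And>L. \<Phi> L \<Longrightarrow> card L * b = q ^ n"
    and thin: "\<And>s. s < N \<Longrightarrow> thin_bound p \<rho> n t ({..<N} - {s}) (\<lambda>j. if j < s then {} else D j) (D s) \<le> bb"
  shows "\<bar>span_prob q n \<Phi> {..<N} M - span_prob q n \<Phi> {..<N} (\<lambda>_ _. uniform_law q)\<bar>
     \<le> N * (bb + q * b * \<rho> powr t)"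
proof -
  define Ms where "Ms s = (\<lambda>j. if j < s then (\<lambda>_. uniform_law q) else M j)" for s
  define Ds where "Ds s = (\<lambda>j. if j < s then {} else D j)" for s
  define c where "c = bb + q * b * \<rho> powr t"
  have "\<bar>span_prob q n \<Phi> {..<N} M - span_prob q n \<Phi> {..<N} (Ms s)\<bar> \<le> s * c" if "s \<le> N" for s
    using that
  proof (induction s)
    case 0
    then show ?case by (simp add: Ms_def)
  next
    case (Suc s)
    then have s: "s < N" by simp
    have ins: "insert s ({..<N} - {s}) = {..<N}" using s by auto
    have upd: "(Ms s)(s := \<lambda>_. uniform_law q) = Ms (Suc s)" by (auto simp: Ms_def fun_eq_iff)
    have "\<bar>span_prob q n \<Phi> (insert s ({..<N} - {s})) (Ms s) -
        span_prob q n \<Phi> (insert s ({..<N} - {s})) ((Ms s)(s := \<lambda>_. uniform_law q))\<bar>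
      \<le> thin_bound p \<rho> n t ({..<N} - {s}) (Ds s) (Ds s s) + q * b * \<rho> powr t"
    proof (rule swap_column[OF _ _ _ _ index])
      show "law q (Ms s j i)" if "i < n" "j \<in> insert s ({..<N} - {s})" for i j
        using that M law_uniform[OF q_pos] s by (auto simp: Ms_def)
      show "char_small q \<rho> (Ms s j i)" if "i < n" "j \<in> insert s ({..<N} - {s})" "i \<notin> Ds s j" for i j
        using that small[of i j] char_small_uniform[OF q_pos, of \<rho>] \<rho> s by (auto simp: Ms_def Ds_def)
    qed auto
    also have "\<dots> \<le> c" using thin[OF s] by (simp add: c_def Ds_def)
    finally have "\<bar>span_prob q n \<Phi> {..<N} (Ms s) - span_prob q n \<Phi> {..<N} (Ms (Suc s))\<bar> \<le> c"
      unfolding ins upd .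
    with Suc show ?case by (simp add: algebra_simps abs_le_iff)
  qed
  from this[of N] have "\<bar>span_prob q n \<Phi> {..<N} M - span_prob q n \<Phi> {..<N} (Ms N)\<bar> \<le> N * c" by simp
  moreover have "mat_law n {..<N} (Ms N) = mat_law n {..<N} (\<lambda>_ _. uniform_law q)"
    by (rule mat_law_cong) (simp add: Ms_def)
  ultimately show ?thesis by (simp add: span_prob_def c_def)
qed

end

lemma span_prob_uniform:
  "span_prob q n \<Phi> {..<N} (\<lambda>_ _. uniform_law q) =
     real (card {C\<in>PiE {..<N} (\<lambda>_. vecs q n). \<Phi> (generate (zmod_vec q n) (C ` {..<N}))}) / real (q ^ n) ^ N"
proof -
  let ?S = "{C\<in>PiE {..<N} (\<lambda>_. vecs q n). \<Phi> (generate (zmod_vec q n) (C ` {..<N}))}"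
  have fin: "finite (PiE {..<N} (\<lambda>_. vecs q n))" by (intro finite_PiE finite_vecs) simp
  have "mat_law n {..<N} (\<lambda>_ _. uniform_law q) C = 1 / real (q ^ n) ^ N" for C
    by (simp add: mat_law_def col_law_def uniform_law_def power_one_over power_divide)
  then have "span_prob q n \<Phi> {..<N} (\<lambda>_ _. uniform_law q) =
      (\<Sum>C\<in>PiE {..<N} (\<lambda>_. vecs q n). if \<Phi> (generate (zmod_vec q n) (C ` {..<N})) then 1 / real (q ^ n) ^ N else 0)"
    unfolding span_prob_def by (intro sum.cong refl) auto
  also have "\<dots> = (\<Sum>C\<in>?S. 1 / real (q ^ n) ^ N)" by (rule sum.inter_filter[OF fin, symmetric])
  finally show ?thesis by simp
qed

lemma gen_prob_tendsto_1:
  assumes "p > 1" shows "(\<lambda>n. gen_prob p n d) \<longlonglongrightarrow> 1"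
proof -
  have "(\<lambda>n. \<Prod>i<d. 1 - real p ^ i / real p ^ n) \<longlonglongrightarrow> (\<Prod>i<d. 1 - 0)"
  proof (intro tendsto_prod tendsto_diff tendsto_const)
    fix i
    have "(\<lambda>n. real p ^ i * (1 / real p) ^ n) \<longlonglongrightarrow> 0"
      using assms by (intro tendsto_mult_right_zero LIMSEQ_realpow_zero) auto
    then show "(\<lambda>n. real p ^ i / real p ^ n) \<longlonglongrightarrow> 0" by (simp add: power_one_over)
  qed
  then show ?thesis by (simp add: gen_prob_def)
qed

text \<open>Reversing the index by \<open>i = n - Suc k\<close> turns
  \<open>p ^ i / p ^ (n + u)\<close> into \<open>1 / p ^ (Suc k + u)\<close>, so these are partial
  products of the limit.\<close>

lemma gen_prob_tendsto_prodinf: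
  assumes p: "p > 1"
  shows "(\<lambda>n. gen_prob p (n + u) n) \<longlonglongrightarrow> (\<Prod>k. 1 - 1 / real p ^ (Suc k + u))"
proof -
  let ?f = "\<lambda>k. 1 - 1 / real p ^ (Suc k + u)"
  have eq: "gen_prob p (n + u) n = (\<Prod>k<n. ?f k)" for n
  proof -
    have "gen_prob p (n + u) n = (\<Prod>k<n. 1 - real p ^ (n - Suc k) / real p ^ (n + u))"
      unfolding gen_prob_def by (rule prod.nat_diff_reindex[symmetric])
    also have "\<dots> = (\<Prod>k<n. ?f k)"
    proof (rule prod.cong[OF refl])
      fix k assume "k \<in> {..<n}"
      then have "n + u = (n - Suc k) + (Suc k + u)" by simp
      then have "real p ^ (n + u) = real p ^ (n - Suc k) * real p ^ (Suc k + u)"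
        by (metis power_add)
      then show "1 - real p ^ (n - Suc k) / real p ^ (n + u) = ?f k"
        using p by simp
    qed
    finally show ?thesis .
  qed
  have "summable (\<lambda>k. (1 / real p ^ Suc u) * (1 / real p) ^ k)"
    using p by (intro summable_mult summable_geometric) simp
  then have "summable (\<lambda>k. norm (?f k - 1))"
    by (simp add: power_add power_one_over mult_ac)
  then have "convergent_prod ?f"
    by (intro abs_convergent_prod_imp_convergent_prod summable_imp_abs_convergent_prod)
  then have "(\<lambda>n. \<Prod>k\<le>n. ?f k) \<longlonglongrightarrow> prodinf ?f" by (rule convergent_prod_LIMSEQ)
  then have "(\<lambda>n. \<Prod>k<Suc n. ?f k) \<longlonglongrightarrow> prodinf ?f" by (simp only: lessThan_Suc_atMost)
  then have "(\<lambda>n. \<Prod>k<n. ?f k) \<longlonglongrightarrow> prodinf ?f" by (rule LIMSEQ_imp_Suc)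
  then show ?thesis by (simp only: eq)
qed

text \<open>In \<open>uniform_cok_count\<close> the power of \<open>q ^ n\<close> cancels against
  the number of matrices, the powers of \<open>order B\<close> leave \<open>order B ^ u\<close> in
  the denominator, and the probability \<open>gen_prob p n d\<close>, with \<open>d\<close> the rank
  of \<open>B\<close>, tends to 1.\<close>

lemma uniform_cok_limit:
  assumes p: "prime p" and q: "q = p ^ Suc r" and B: "comm_group B" and ord: "order B = p ^ r"
    and finB: "finite (carrier B)"
  shows "(\<lambda>n. span_prob q n (\<lambda>L. (zmod_vec q n Mod L) \<cong> B) {..<n + u} (\<lambda>_ _. uniform_law q))
    \<longlonglongrightarrow> (\<Prod>k. 1 - 1 / real p ^ (Suc k + u)) / (real (order B) ^ u * real (card (auto B)))"
proof -
  interpret B: comm_group B by (rule B)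
  have p1: "p > 1" using p by (rule prime_gt_1_nat)
  have q0: "q > 0" using p1 q by simp
  have "card ((\<lambda>x. x [^]\<^bsub>B\<^esub> p) ` carrier B) dvd card (carrier B)"
    by (rule B.card_subgroup_dvd_card[OF B.subgroup_powers B.subgroup_self]) auto
  then obtain m where m: "card (carrier B) = card ((\<lambda>x. x [^]\<^bsub>B\<^esub> p) ` carrier B) * m" by auto
  then have "m dvd p ^ r" using ord by (metis dvd_triv_right order_def)
  then obtain d where d: "m = p ^ d" using p by (metis divides_primepow_nat)
  have b0: "real (order B) > 0" using ord p1 by simp
  have autB: "real (card (auto B)) > 0"
  proof -
    have "auto B \<subseteq> PiE (carrier B) (\<lambda>_. carrier B)"
      by (auto simp: auto_def Bij_def PiE_def bij_betw_def)
    then have "finite (auto B)" by (rule finite_subset) (intro finite_PiE finB)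
    moreover have "restrict id (carrier B) \<in> auto B"
      by (auto simp: auto_def Bij_def hom_def bij_betw_def inj_on_def)
    ultimately show ?thesis by (auto simp: card_gt_0_iff)
  qed
  have eq: "span_prob q n (\<lambda>L. (zmod_vec q n Mod L) \<cong> B) {..<n + u} (\<lambda>_ _. uniform_law q)
     = gen_prob p n d * gen_prob p (n + u) n / (real (order B) ^ u * real (card (auto B)))" for n
  proof -
    have "real (card {C\<in>PiE {..<n + u} (\<lambda>_. vecs q n).
        (zmod_vec q n Mod generate (zmod_vec q n) (C ` {..<n + u})) \<cong> B}) =
      real (order B) ^ n * gen_prob p n d * ((real (q ^ n) / real (order B)) ^ (n + u) * gen_prob p (n + u) n)
        / real (card (auto B))"
      using uniform_cok_count[OF p q B ord finB m[unfolded d], of "n + u" n] autB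
      by (simp add: eq_divide_eq)
    then show ?thesis
      unfolding span_prob_uniform using q0 b0 autB
      by (simp add: power_divide power_add field_simps)
  qed
  have "(\<lambda>n. gen_prob p n d * gen_prob p (n + u) n / (real (order B) ^ u * real (card (auto B))))
     \<longlonglongrightarrow> 1 * (\<Prod>k. 1 - 1 / real p ^ (Suc k + u)) / (real (order B) ^ u * real (card (auto B)))"
    using b0 autB by (intro tendsto_divide tendsto_mult tendsto_const gen_prob_tendsto_1 gen_prob_tendsto_prodinf p1) auto
  then show ?thesis by (simp only: eq mult_1)
qed

text \<open>Column spans are subgroups, so a property may be conjoined with being a subgroup;
  Lagrange's theorem then gives the index condition of \<open>swap_all_columns\<close>.\<close>

lemma span_prob_cong:
  assumes q: "q > 0" and eq: "\<And>L. subgroup L (zmod_vec q n) \<Longrightarrow> \<Phi> L = \<Psi> L"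
  shows "span_prob q n \<Phi> {..<N} M = span_prob q n \<Psi> {..<N} M"
proof -
  interpret comm_group "zmod_vec q n" by (rule comm_group_zmod_vec)
  have "\<Phi> (generate (zmod_vec q n) (C ` {..<N})) = \<Psi> (generate (zmod_vec q n) (C ` {..<N}))"
    if C: "C \<in> PiE {..<N} (\<lambda>_. vecs q n)" for C
  proof (rule eq, rule generate_is_subgroup)
    show "C ` {..<N} \<subseteq> carrier (zmod_vec q n)"
      unfolding carrier_zmod_vec[OF q] by (intro image_subsetI) (rule PiE_mem[OF C])
  qed
  then show ?thesis unfolding span_prob_def by (intro sum.cong refl) simp
qed

lemma card_subgroup_of_quotient_iso:
  assumes q: "q > 0" and L: "subgroup L (zmod_vec q n)" and iso: "(zmod_vec q n Mod L) \<cong> B"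
  shows "card L * order B = q ^ n"
proof -
  interpret group "zmod_vec q n" by (rule group_zmod_vec)
  have "card (rcosets\<^bsub>zmod_vec q n\<^esub> L) = order B"
    using iso_same_card[OF iso] by (simp add: FactGroup_def order_def)
  then show ?thesis
    using lagrange[OF L] card_vecs[of n q] by (simp add: order_def carrier_zmod_vec[OF q] mult.commute)
qed

theorem theorem1p4:
  fixes p u :: nat
    and \<epsilon> \<alpha> \<beta> :: real
    and B :: "('b, 'c) monoid_scheme"
    and \<Omega> :: "nat \<Rightarrow> 'a measure"
    and M :: "nat \<Rightarrow> nat \<Rightarrow> nat \<Rightarrow> 'a \<Rightarrow> (nat \<Rightarrow> int)"
  assumes "prime p"
    and "\<epsilon> > 0"
    and "comm_group B" and "finite (carrier B)" and "\<exists>r. order B = p ^ r"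
    and "\<alpha> > 0" and "\<beta> > 0" and "\<alpha> + \<beta> < 1"
    and "\<And>n. n > 0 \<Longrightarrow> prob_space (\<Omega> n)"
    and "\<And>n. n > 0 \<Longrightarrow>
           prob_space.indep_vars (\<Omega> n) (\<lambda>_. padic_borel p) (\<lambda>(i, j). M n i j)
             ({..<n} \<times> {..<n + u})"
    and "\<And>n j. n > 0 \<Longrightarrow> j < n + u \<Longrightarrow>
           real (card {i \<in> {..<n}. degenerate (\<Omega> n) p \<epsilon> (M n i j)}) \<le> \<alpha> * real n"
    and "\<And>n i. n > 0 \<Longrightarrow> i < n \<Longrightarrow>
           real (card {j \<in> {..<n + u}. degenerate (\<Omega> n) p \<epsilon> (M n i j)}) \<le> \<beta> * real n"
  shows "(\<lambda>n. measure (\<Omega> n)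
            {\<omega> \<in> space (\<Omega> n). padic_cok p n (n + u) (\<lambda>i j. M n i j \<omega>) \<cong> B})
         \<longlonglongrightarrow> (\<Prod>k. 1 - 1 / real p ^ (Suc k + u)) / (real (order B) ^ u * real (card (auto B)))"
proof -
  note p = \<open>prime p\<close> and B = \<open>comm_group B\<close> and finB = \<open>finite (carrier B)\<close>
  note indep = assms(10) and col = assms(11) and row = assms(12)
  obtain r where r: "order B = p ^ r" using assms(5) by blast
  define q where "q = p ^ Suc r"
  have p0: "p > 0" and p2: "p \<ge> 2" using p prime_gt_0_nat prime_ge_2_nat by auto
  have q0: "q > 0" using p0 by (simp add: q_def)
  obtain \<rho> where \<rho>: "0 < \<rho>" "\<rho> < 1"
    and small: "\<And>m. law q m \<Longrightarrow> balanced_law p q \<epsilon> m \<Longrightarrow> char_small q \<rho> m"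
    using entry_char_bound[OF p q_def \<open>\<epsilon> > 0\<close>] by blast
  interpret char_bounded p "Suc r" q \<rho>
    by unfold_locales (use p \<rho> in \<open>auto simp: q_def\<close>)
  obtain \<delta> \<theta> K :: real and n0 where dt: "0 < \<delta>" "0 < \<theta>" "\<theta> < 1" "0 \<le> K"
    and bad: "\<And>n (J :: nat set) D j0. n \<ge> n0 \<Longrightarrow> finite J \<Longrightarrow> n - 1 \<le> card J \<Longrightarrow>
       real (card (D j0 \<inter> {..<n})) \<le> \<alpha> * n \<Longrightarrow>
       (\<And>i. i < n \<Longrightarrow> real (card {j\<in>J. i \<in> D j}) \<le> \<beta> * n) \<Longrightarrow>
       thin_bound p \<rho> n (\<delta> * n) J D (D j0) \<le> K * \<theta> ^ n"
    using thin_bound_exponential[OF p2 \<rho> \<open>\<alpha> > 0\<close> \<open>\<beta> > 0\<close> \<open>\<alpha> + \<beta> < 1\<close>] by blast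
  define b where "b = order B"
  define P where "P n = measure (\<Omega> n)
      {\<omega> \<in> space (\<Omega> n). padic_cok p n (n + u) (\<lambda>i j. M n i j \<omega>) \<cong> B}" for n
  define \<Phi> where "\<Phi> n L \<longleftrightarrow> (zmod_vec q n Mod L) \<cong> B" for n L
  define U where "U n = span_prob q n (\<Phi> n) {..<n + u} (\<lambda>_ _. uniform_law q)" for n
  \<comment> \<open>\<open>n + u\<close> replacements, each costing the thin event and the Fourier
    error at \<open>t = \<delta> * n\<close>.\<close>
  define err where "err n = real (n + u) * (K * \<theta> ^ n + q * b * (\<rho> powr \<delta>) ^ n)" for n
  \<comment> \<open>The assumptions on the random matrices start at \<open>n = 1\<close>, hence the
    maximum.\<close>
  have main: "\<bar>P n - U n\<bar> \<le> err n" if n: "n \<ge> max 1 n0" for n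
  proof -
    have n_pos: "n > 0" and nn0: "n \<ge> n0" using n by auto
    interpret prob_space "\<Omega> n" by (rule assms(9)[OF n_pos])
    define m where "m j i a = prob {\<omega> \<in> space (\<Omega> n). M n i j \<omega> (Suc r) = a}" for j i a
    define D where "D j = {i \<in> {..<n}. degenerate (\<Omega> n) p \<epsilon> (M n i j)}" for j
    have meas: "M n i j \<in> measurable (\<Omega> n) (padic_borel p)" if "i < n" "j < n + u" for i j
      using indep[OF n_pos] that unfolding indep_vars_def2 by auto
    have car: "M n i j \<omega> \<in> carrier (padic_int p)" if "i < n" "j < n + u" "\<omega> \<in> space (\<Omega> n)" for i j \<omega>
      using measurable_space[OF meas[OF that(1,2)] that(3)] by (simp add: space_padic_borel)
    have lw: "law q (m j i)" if "i < n" "j < n + u" for i j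
      unfolding m_def q_def using law_padic[OF p0 meas[OF that]] .
    have sm: "char_small q \<rho> (m j i)" if ij: "i < n" "j < n + u" "i \<notin> D j" for i j
    proof (rule small[OF lw[OF ij(1,2)]])
      have "balanced (\<Omega> n) p \<epsilon> (M n i j)" using ij by (simp add: D_def)
      then show "balanced_law p q \<epsilon> (m j i)"
        unfolding m_def q_def by (rule balanced_law_padic[OF p0 meas[OF ij(1,2)]])
    qed
    have "P n = prob {\<omega> \<in> space (\<Omega> n). \<Phi> n (generate (zmod_vec (p ^ Suc r) n)
        ((\<lambda>j. \<lambda>i\<in>{..<n}. M n i j \<omega> (Suc r)) ` {..<n + u}))}"
      unfolding P_def \<Phi>_def q_def
    proof (intro arg_cong[of _ _ prob] Collect_cong conj_cong refl)
      fix \<omega> assume w: "\<omega> \<in> space (\<Omega> n)"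
      show "padic_cok p n (n + u) (\<lambda>i j. M n i j \<omega>) \<cong> B \<longleftrightarrow>
        (zmod_vec (p ^ Suc r) n Mod generate (zmod_vec (p ^ Suc r) n)
          ((\<lambda>j. \<lambda>i\<in>{..<n}. M n i j \<omega> (Suc r)) ` {..<n + u})) \<cong> B"
        by (rule padic_cok_iso_iff[OF p0 car B r]) (use w in auto)
    qed
    also have "\<dots> = span_prob q n (\<Phi> n) {..<n + u} m"
      unfolding m_def q_def using n_pos by (intro span_prob_eq_prob indep p0) auto
    finally have P: "P n = span_prob q n (\<Phi> n) {..<n + u} m" .
    let ?\<Psi> = "\<lambda>L. subgroup L (zmod_vec q n) \<and> \<Phi> n L"
    have \<Psi>: "span_prob q n (\<Phi> n) {..<n + u} m' = span_prob q n ?\<Psi> {..<n + u} m'" for m'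
      by (rule span_prob_cong[OF q0]) simp
    have "\<bar>span_prob q n ?\<Psi> {..<n + u} m - span_prob q n ?\<Psi> {..<n + u} (\<lambda>_ _. uniform_law q)\<bar>
       \<le> (n + u) * (K * \<theta> ^ n + q * b * \<rho> powr (\<delta> * n))"
    proof (rule swap_all_columns[where D = D])
      show "law q (m j i)" if "i < n" "j < n + u" for i j using that by (rule lw)
      show "char_small q \<rho> (m j i)" if "i < n" "j < n + u" "i \<notin> D j" for i j using that by (rule sm)
      show "card L * b = q ^ n" if "?\<Psi> L" for L
        using that card_subgroup_of_quotient_iso[OF q0] unfolding \<Phi>_def b_def by blast
      fix s assume s: "s < n + u"
      \<comment> \<open>Columns already made uniform have no degenerate entries, which can only
        lower the row counts; column \<open>s\<close> itself still has \<open>D s\<close>.\<close>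
      let ?D = "\<lambda>j. if j < s then {} else D j"
      have "thin_bound p \<rho> n (\<delta> * n) ({..<n + u} - {s}) ?D (?D s) \<le> K * \<theta> ^ n"
      proof (rule bad[OF nn0])
        show "n - 1 \<le> card ({..<n + u} - {s})" using s by simp
        have "D s \<inter> {..<n} = D s" by (auto simp: D_def)
        then show "real (card (?D s \<inter> {..<n})) \<le> \<alpha> * n"
          using col[OF n_pos s] by (simp add: D_def)
        fix i assume i: "i < n"
        have "card {j \<in> {..<n + u} - {s}. i \<in> ?D j} \<le>
            card {j \<in> {..<n + u}. degenerate (\<Omega> n) p \<epsilon> (M n i j)}"
          by (intro card_mono) (auto simp: D_def split: if_splits)
        then show "real (card {j \<in> {..<n + u} - {s}. i \<in> ?D j}) \<le> \<beta> * n"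
          using row[OF n_pos i] by linarith
      qed simp
      then show "thin_bound p \<rho> n (\<delta> * n) ({..<n + u} - {s}) ?D (D s) \<le> K * \<theta> ^ n"
        by simp
    qed
    moreover have "\<rho> powr (\<delta> * n) = (\<rho> powr \<delta>) ^ n"
      using \<rho> by (simp add: powr_powr[symmetric] powr_realpow)
    ultimately show ?thesis by (simp add: P U_def \<Psi> err_def)
  qed
  have "err \<longlonglongrightarrow> 0"
  proof -
    have lim: "(\<lambda>n. real (n + u) * x ^ n) \<longlonglongrightarrow> 0" if x: "0 < x" "x < 1" for x :: real
    proof -
      have "(\<lambda>n. real n * x ^ n + real u * x ^ n) \<longlonglongrightarrow> 0 + real u * 0"
        using x by (intro tendsto_add tendsto_mult tendsto_const powser_times_n_limit_0 LIMSEQ_realpow_zero) auto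
      then show ?thesis by (simp add: distrib_right)
    qed
    have "\<rho> powr \<delta> < 1" using \<rho> dt powr_less_mono'[of \<rho> 0 \<delta>] by simp
    then have "(\<lambda>n. K * (real (n + u) * \<theta> ^ n) + (q * b) * (real (n + u) * (\<rho> powr \<delta>) ^ n))
        \<longlonglongrightarrow> K * 0 + real (q * b) * 0"
      using \<rho> dt by (intro tendsto_add tendsto_mult tendsto_const lim) auto
    then show ?thesis by (simp add: err_def[abs_def] algebra_simps)
  qed
  moreover have "eventually (\<lambda>n. norm (P n - U n) \<le> err n) sequentially"
    using main by (auto simp: eventually_sequentially intro!: exI[of _ "max 1 n0"])
  ultimately have "(\<lambda>n. P n - U n) \<longlonglongrightarrow> 0" by (rule Lim_null_comparison[rotated])
  moreover have "U \<longlonglongrightarrow> (\<Prod>k. 1 - 1 / real p ^ (Suc k + u)) / (real (order B) ^ u * real (card (auto B)))"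
    unfolding U_def[abs_def] \<Phi>_def[abs_def] by (rule uniform_cok_limit[OF p q_def B r finB])
  ultimately have "(\<lambda>n. (P n - U n) + U n) \<longlonglongrightarrow> 
      0 + (\<Prod>k. 1 - 1 / real p ^ (Suc k + u)) / (real (order B) ^ u * real (card (auto B)))"
    by (rule tendsto_add)
  then show ?thesis by (simp add: P_def)
qed

end
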